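(* For all integers $k\geq 1$ and $d\geq 1$ there are constants $C=C(k,d)>0$ and $p_0=p_0(k,d)$, and a real-valued function $\delta(p)=\delta_{k,d}(p)$ of the prime $p$ with $\delta(p)\to 0$ as $p\to\infty$, such that the following holds for every prime $p\geq p_0$. Let $\Gamma\subset\mathbb{F}_p$ with $|\Gamma|=d$, let $\varepsilon>0$ be real, suppose that $B=B(\Gamma,\varepsilon)$ is a regular Bohr set, and let $\chi$ be a non-trivial multiplicative character modulo $p$. When $|B|\geq\sqrt p$, $$\left|\sum_{x\in B}\chi(x)\right|\leq C\,|B|\cdot p^{5d/(16k^2)+\delta(p)}\left(\frac{|B|}{\varepsilon^d p}\right)^{5/(16k)}\left(\frac{p}{|B|}\right)^{-1/(8k)}.$$ When $|B|<\sqrt p$, $$\left|\sum_{x\in B}\chi(x)\right|\leq C\,|B|\cdot p^{5d/(16k^2)+\delta(p)}\left(\frac{|B|}{\varepsilon^d p}\right)^{5/(16k)}\left(\frac{|B|^5}{p^2}\right)^{-1/(8k)}.$$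
   Context: $\mathbb{F}_p$ is the field with $p$ elements, $p$ prime. For real $\theta$, $\|\theta\|$ denotes the distance from $\theta$ to the nearest integer. For $\Gamma\subset\mathbb{F}_p$ and real $\varepsilon>0$, the Bohr set is $$B(\Gamma,\varepsilon)=\left\{x\in\mathbb{F}_p:\left\|\frac{xr}{p}\right\|\leq\varepsilon\text{ for each }r\in\Gamma\right\},$$ where $x,r$ are represented by integers (the value of $\|xr/p\|$ does not depend on the representatives). If $|\Gamma|=d$, then $\varepsilon$ is a regular value for $\Gamma$, and $B(\Gamma,\varepsilon)$ is called regular, if for every real $\kappa$ with $|\kappa|<\frac{1}{100d}$, $$1-100d|\kappa|\leq\frac{|B(\Gamma,(1+\kappa)\varepsilon)|}{|B(\Gamma,\varepsilon)|}\leq 1+100d|\kappa|.$$ A non-trivial multiplicative character modulo $p$ is a non-constant homomorphism $\chi:\mathbb{F}_p^\times\to\mathbb{C}^\times$, extended by $\chi(0)=0$. The paper writes the conclusions as $\ll_{k,d}$ with $o(1)$ in the exponent in place of $\delta(p)$; $X\ll_{k,d}Y$ means $X\leq cY$ for a constant $c$ depending only on $k,d$, once $p$ is sufficiently large, and $o(1)$ is a quantity tending to $0$ as $p\to\infty$. *)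

theory Defs
  imports "HOL-Analysis.Analysis" "HOL-Number_Theory.Number_Theory"
begin

text \<open>The field \<open>\<bbbF>\<^sub>p\<close> is the library's \<^const>\<open>residue_ring\<close> at \<open>int p\<close>, whose carrier is the set of
  representatives \<open>{0..p - 1}\<close>. A type of residues is not used because \<open>p\<close> is quantified after the
  constants of the theorem.\<close>

definition dist_int :: "real \<Rightarrow> real" where
  "dist_int \<theta> = infdist \<theta> \<int>"

definition bohr_set :: "nat \<Rightarrow> int set \<Rightarrow> real \<Rightarrow> int set" where
  "bohr_set p \<Gamma> \<epsilon> =
     {x \<in> carrier (residue_ring (int p)). \<forall>r\<in>\<Gamma>. dist_int (of_int (x * r) / real p) \<le> \<epsilon>}"

text \<open>For \<open>\<epsilon> > 0\<close> the Bohr set contains \<open>0\<close>, so the quotient below has a nonzero denominator.\<close>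

definition bohr_regular :: "nat \<Rightarrow> int set \<Rightarrow> real \<Rightarrow> bool" where
  "bohr_regular p \<Gamma> \<epsilon> \<longleftrightarrow>
     (\<forall>\<kappa>::real. \<bar>\<kappa>\<bar> < 1 / (100 * real (card \<Gamma>)) \<longrightarrow>
        1 - 100 * real (card \<Gamma>) * \<bar>\<kappa>\<bar>
          \<le> real (card (bohr_set p \<Gamma> ((1 + \<kappa>) * \<epsilon>))) / real (card (bohr_set p \<Gamma> \<epsilon>)) \<and>
        real (card (bohr_set p \<Gamma> ((1 + \<kappa>) * \<epsilon>))) / real (card (bohr_set p \<Gamma> \<epsilon>))
          \<le> 1 + 100 * real (card \<Gamma>) * \<bar>\<kappa>\<bar>)"

definition complex_mult_group :: "complex monoid" where
  "complex_mult_group = \<lparr>carrier = UNIV - {0}, mult = (*), one = 1\<rparr>"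

text \<open>Values of \<open>chi\<close> outside \<open>{0..p - 1}\<close> are unconstrained; sums over subsets of \<open>\<bbbF>\<^sub>p\<close> never use them.\<close>

definition nontrivial_mult_character :: "nat \<Rightarrow> (int \<Rightarrow> complex) \<Rightarrow> bool" where
  "nontrivial_mult_character p chi \<longleftrightarrow>
     chi \<in> hom (units_of (residue_ring (int p))) complex_mult_group \<and>
     \<not> chi constant_on Units (residue_ring (int p)) \<and>
     chi 0 = 0"

end

theory Submission
  imports Defs "Berlekamp_Zassenhaus.Finite_Field" "HOL-Algebra.Algebraic_Closure_Type"
begin

hide_const (open) Divisibility.prime Divisibility.irreducible up_ring.coeff up_ring.monom
  Polynomials.degree Polynomials.lead_coeff Coset.order module.smult

text \<open>Put \<open>T = \<lceil>p\<^bsup>1/(2k)\<^esup>\<rceil>\<close> and \<open>\<kappa> = p\<^bsup>-1/(16k)\<^esup>\<close>. Regularity allows the sum over \<open>B = B(\<Gamma>, \<epsilon>)\<close> to be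
  shifted by \<open>y t\<close> with \<open>t \<le> T\<close> and \<open>y\<close> in \<open>B' = B(\<Gamma>, \<kappa> \<epsilon> / T)\<close> at the cost of an admissible error, and
  \<open>\<chi>(x + y t) = \<chi>(y) \<chi>(x/y + t)\<close>. Hoelder's inequality then bounds the sum by the number of solutions of
  \<open>x y' = x' y\<close> in \<open>B\<close> and \<open>B'\<close> and by the \<open>2k\<close>-th moment of \<open>\<Sum>\<^sub>t \<chi>(u + t)\<close>.

  The number of solutions is controlled by the multiplicative energies of \<open>B\<close> and \<open>B'\<close>. Bohr sets have
  bounded additive doubling, so the energy of a Bohr set with \<open>N\<close> elements is
  \<open>O(N\<^bsup>11/4\<^esup> + N\<^bsup>13/4\<^esup> p\<^bsup>-1/4\<^esup>)\<close> by the sum-product argument of Bourgain and Garaev.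

  The moment needs the Weil bound for \<open>\<Prod>\<^sub>c \<chi>(u + c)\<^bsup>m(c)\<^esup>\<close> where some \<open>m(c)\<close> is \<open>1\<close>. This sum is the linear
  coefficient of an \<open>L\<close>-polynomial \<open>\<Sum> \<psi>(g) u\<^bsup>deg g\<^esup>\<close> over monic \<open>g\<close>, whose power sums run over the monic
  primes \<open>P\<close> with \<open>deg P\<close> dividing \<open>r\<close>. Stepanov's method shows that they are \<open>O(p\<^bsup>r/2\<^esup>)\<close> with an arbitrarily
  bad constant, which already places all inverse roots in the disc of radius \<open>p\<^bsup>1/2\<^esup>\<close>. The exponent
  \<open>\<delta>(p)\<close> may be taken to be \<open>0\<close>.\<close>

section \<open>Power sums over the monic primes of a finite field\<close>

text \<open>The exponents come from one computation. Write \<open>N\<close> and \<open>M\<close> for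
  the sizes of \<open>B\<close> and \<open>B'\<close> and let both energies have exponent 11/4.
  Hoelder then bounds the 2k-th power of |sum|/N by a constant times
  \<open>(N M)^(11/8) p^(1/2) / (N M)^2\<close>, which is
  \<open>(N/M)^(5/8) N^(-5/4) p^(1/2)\<close>. Pigeonholing bounds \<open>N/M\<close> by
  \<open>N/(\<epsilon>^d p)\<close> times \<open>(T/\<kappa>)^d\<close> up to a constant, and the
  2k-th root produces \<open>5/(16k)\<close>, \<open>5d/(16k^2)\<close> and
  \<open>(N^5/p^2)^(-1/(8k))\<close>. For \<open>N\<close> above \<open>sqrt p\<close> the second
  term of the energy bound takes over. \<open>T\<close> balances the two parts \<open>T^k p\<close>
  and \<open>T^(2k) p^(1/2)\<close> of the moment. \<open>\<kappa>\<close> makes the shift error no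
  larger than the claimed saving in either range; as \<open>T/\<kappa>\<close> is at most
  \<open>2 p^(1/k)\<close>, the loss still fits into \<open>p^(5d/(16k^2))\<close>, so that no
  \<delta> is needed. Stepanov's method has to run over all extensions of the prime field. They are
  not constructed: the field with \<open>q^r\<close> elements appears as the points of one algebraic
  closure that satisfy \<open>x^(q^r) = x\<close>.\<close>

definition polys_below :: "nat \<Rightarrow> 'a::zero poly set" where
  "polys_below n = {g. \<forall>i\<ge>n. coeff g i = 0}"

lemma polys_below_iff: "g \<in> polys_below n \<longleftrightarrow> g = 0 \<or> degree g < n"
proof (cases "g = 0")
  case False
  show ?thesis
  proof
    assume "g \<in> polys_below n"
    then show "g = 0 \<or> degree g < n"
      using False unfolding polys_below_def by (cases "n \<le> degree g") auto
  next
    assume "g = 0 \<or> degree g < n"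
    then have "coeff g i = 0" if "i \<ge> n" for i using that False by (intro coeff_eq_0) simp
    then show "g \<in> polys_below n" by (simp add: polys_below_def)
  qed
qed (simp add: polys_below_def)

lemma card_polys_below:
  "finite (polys_below n :: 'a::{finite,zero} poly set) \<and> card (polys_below n :: 'a poly set) = CARD('a) ^ n"
proof (induction n)
  case 0
  have "polys_below 0 = {0 :: 'a poly}"
    by (auto simp: polys_below_iff)
  then show ?case by simp
next
  case (Suc n)
  have "bij_betw (\<lambda>(a, g). pCons a g) (UNIV \<times> polys_below n) (polys_below (Suc n) :: 'a poly set)"
  proof (rule bij_betwI')
    fix x y :: "'a \<times> 'a poly"
    show "((\<lambda>(a, g). pCons a g) x = (\<lambda>(a, g). pCons a g) y) = (x = y)" by (cases x; cases y) simp
  next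
    fix x :: "'a \<times> 'a poly" assume "x \<in> UNIV \<times> polys_below n"
    then show "(\<lambda>(a, g). pCons a g) x \<in> polys_below (Suc n)"
      by (auto simp: polys_below_def coeff_pCons split: nat.split)
  next
    fix y :: "'a poly" assume y: "y \<in> polys_below (Suc n)"
    obtain a g where g: "y = pCons a g" by (rule pCons_cases)
    have "coeff g i = 0" if "i \<ge> n" for i
      using y that unfolding g polys_below_def by (auto dest!: spec[of _ "Suc i"])
    then have "g \<in> polys_below n" by (simp add: polys_below_def)
    with g show "\<exists>x\<in>UNIV \<times> polys_below n. y = (\<lambda>(a, g). pCons a g) x" by force
  qed
  from bij_betw_same_card[OF this] bij_betw_finite[OF this] Suc show ?case
    by (simp add: card_cartesian_product)
qed

definition monics :: "nat \<Rightarrow> 'a::comm_semiring_1 poly set" where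
  "monics n = {g. monic g \<and> degree g = n}"

lemma bij_betw_monics: "bij_betw (\<lambda>g. monom 1 n + g) (polys_below n) (monics n :: 'a::comm_ring_1 poly set)"
proof (rule bij_betwI[where g = "\<lambda>g. g - monom 1 n"])
  show "(\<lambda>g. monom 1 n + g) \<in> polys_below n \<rightarrow> (monics n :: 'a poly set)"
  proof
    fix g :: "'a poly" assume g: "g \<in> polys_below n"
    have c: "coeff (monom 1 n + g) n = 1" using g by (simp add: polys_below_def)
    moreover have deg: "degree (monom 1 n + g) \<le> n"
      using g by (intro degree_le) (auto simp: polys_below_def)
    ultimately have "degree (monom 1 n + g) = n"
      by (intro antisym le_degree) auto
    then show "monom 1 n + g \<in> monics n" using c by (simp add: monics_def)
  qed
  show "(\<lambda>g. g - monom 1 n) \<in> monics n \<rightarrow> (polys_below n :: 'a poly set)"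
    by (auto simp: monics_def polys_below_def coeff_eq_0 split: if_splits)
qed auto

lemma finite_monics [simp]: "finite (monics n :: 'a::{finite,comm_ring_1} poly set)"
  using bij_betw_finite[OF bij_betw_monics] card_polys_below by blast

lemma card_monics: "card (monics n :: 'a::{finite,comm_ring_1} poly set) = CARD('a) ^ n"
  using bij_betw_same_card[OF bij_betw_monics[where 'a = 'a and n = n]] card_polys_below[where 'a = 'a and n = n] by simp

definition monic_primes :: "'a::field poly set" where
  "monic_primes = {P. monic P \<and> irreducible P}"

lemma monic_primesD:
  assumes "P \<in> (monic_primes :: 'a::{field_gcd} poly set)"
  shows "monic P" "irreducible P" "degree P > 0" "P \<noteq> 0" "normalize P = P" "prime P"
proof -
  show 1: "monic P" "irreducible P" using assms by (auto simp: monic_primes_def)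
  then show "P \<noteq> 0" by auto
  show "degree P > 0" using 1(2)
    using irreducible_not_unit[OF 1(2)] is_unit_iff_degree[OF \<open>P \<noteq> 0\<close>] \<open>P \<noteq> 0\<close> by simp
  show n: "normalize P = P" using 1(1) by (simp add: normalize_poly_eq_map_poly)
  show "prime P" using irreducible_imp_prime_elem[OF 1(2)] n by (rule Factorial_Ring.primeI)
qed

text \<open>A library prime is normalised, which for a polynomial over a field means having leading
  coefficient 1.\<close>

lemma monic_primesI:
  assumes "prime (P :: 'a::{field_gcd} poly)"
  shows "P \<in> monic_primes"
proof -
  have "P \<noteq> 0" using assms by (metis not_prime_0)
  have "unit_factor P = 1" using assms by (rule unit_factor_prime)
  then have "[:lead_coeff P:] = 1" using \<open>P \<noteq> 0\<close>
    by (simp add: unit_factor_poly_def is_unit_unit_factor dvd_field_iff)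
  then have "lead_coeff P = 1" by (simp add: one_pCons)
  moreover have "irreducible P"
    using assms by (intro prime_elem_imp_irreducible prime_imp_prime_elem)
  ultimately show ?thesis unfolding monic_primes_def by blast
qed

text \<open>The pair \<open>(P, k)\<close> stands for the prime power \<open>P ^ k\<close> and
  carries the weight \<open>degree P\<close>: this is the support of the von Mangoldt function on
  polynomials.\<close>

definition prime_powers_upto :: "nat \<Rightarrow> ('a::field poly \<times> nat) set" where
  "prime_powers_upto r = {(P, k). P \<in> monic_primes \<and> k \<ge> 1 \<and> k * degree P \<le> r}"

lemma finite_prime_powers_upto [simp]: "finite (prime_powers_upto r :: ('a::{finite,field_gcd} poly \<times> nat) set)"
proof (rule finite_subset)
  show "(prime_powers_upto r :: ('a poly \<times> nat) set) \<subseteq> (\<Union>n\<le>r. monics n) \<times> ({..r} :: nat set)"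
  proof
    fix z :: "'a poly \<times> nat" assume z: "z \<in> prime_powers_upto r"
    obtain P k where Pk: "z = (P, k)" by fastforce
    have a: "P \<in> monic_primes" "k \<ge> 1" "k * degree P \<le> r" using z Pk by (auto simp: prime_powers_upto_def)
    note P = monic_primesD[OF a(1)]
    have "degree P \<le> k * degree P" "k \<le> k * degree P" using a(2) P(3) by auto
    then have "degree P \<le> r" "k \<le> r" using a(3) by linarith+
    then show "z \<in> (\<Union>n\<le>r. monics n) \<times> {..r}" using P(1) Pk by (auto simp: monics_def)
  qed
  show "finite ((\<Union>n\<le>r. monics n :: 'a poly set) \<times> ({..r} :: nat set))"
    by (intro finite_cartesian_product finite_UN_I finite_monics finite_atMost)
qed

text \<open>Analogue of \<open>log n\<close> as the sum of the von Mangoldt function over the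
  divisors of \<open>n\<close>: a prime of multiplicity \<open>e\<close> in \<open>g\<close>
  contributes its degree once for each \<open>k\<close> from 1 to \<open>e\<close>.\<close>

lemma degree_eq_sum_prime_powers:
  assumes "g \<in> (monics r :: 'a::{finite,field_gcd} poly set)"
  shows "r = (\<Sum>(P, k)\<in>{(P, k)\<in>prime_powers_upto r. P ^ k dvd g}. degree P)"
proof -
  have g: "monic g" "degree g = r" "g \<noteq> 0" using assms by (auto simp: monics_def)
  have norm: "normalize g = g" using g by (simp add: normalize_poly_eq_map_poly)
  have nz: "p \<noteq> 0" if "p \<in> prime_factors g" for p using that by auto
  have "g = prod_mset (prime_factorization g)"
    using prod_mset_prime_factorization[of g] g norm by simp
  also have "\<dots> = (\<Prod>P\<in>prime_factors g. P ^ multiplicity P g)"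
    unfolding prod_mset_multiplicity
    by (intro prod.cong refl) (simp add: count_prime_factorization in_prime_factors_imp_prime)
  finally have "r = degree (\<Prod>P\<in>prime_factors g. P ^ multiplicity P g)" using g by simp
  also have "\<dots> = (\<Sum>P\<in>prime_factors g. degree (P ^ multiplicity P g))"
    by (rule degree_prod_sum_eq) (use nz in auto)
  also have "\<dots> = (\<Sum>P\<in>prime_factors g. \<Sum>k\<in>{1..multiplicity P g}. degree P)"
    by (intro sum.cong refl) (simp add: degree_power_eq nz)
  also have "\<dots> = (\<Sum>(P, k)\<in>Sigma (prime_factors g) (\<lambda>P. {1..multiplicity P g}). degree P)"
    by (rule sum.Sigma) auto
  also have "Sigma (prime_factors g) (\<lambda>P. {1..multiplicity P g}) = {(P, k)\<in>prime_powers_upto r. P ^ k dvd g}"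
  proof (intro equalityI subsetI; clarify)
    fix P k assume a: "P \<in> prime_factors g" "k \<in> {1..multiplicity P g}"
    then have P: "P \<in> monic_primes" by (auto intro: monic_primesI)
    have dv: "P ^ k dvd g" using a by (simp add: multiplicity_dvd')
    then have "degree (P ^ k) \<le> degree g" using g(3) by (rule dvd_imp_degree_le)
    then have "k * degree P \<le> r" using g a by (simp add: degree_power_eq nz mult.commute)
    with P dv a show "(P, k) \<in> prime_powers_upto r \<and> P ^ k dvd g"
      unfolding prime_powers_upto_def by (intro conjI CollectI case_prodI) simp_all
  next
    fix P k assume a: "(P, k) \<in> prime_powers_upto r" "P ^ k dvd g"
    then have P: "P \<in> monic_primes" "k \<ge> 1" by (auto simp: prime_powers_upto_def)
    note PD = monic_primesD[OF P(1)]
    have "P dvd g" using a(2) P(2) using dvd_trans[OF dvd_power[of k P]] by simp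
    then have "P \<in> prime_factors g" using PD g by (simp add: prime_factors_dvd)
    moreover have "k \<le> multiplicity P g" using a(2) PD g(3) by (simp add: multiplicity_geI irreducible_not_unit)
    ultimately show "P \<in> prime_factors g \<and> k \<in> {1..multiplicity P g}" using P by simp
  qed
  finally show ?thesis .
qed

definition L_coeff :: "('a::{finite,field_gcd} poly \<Rightarrow> complex) \<Rightarrow> nat \<Rightarrow> complex" where
  "L_coeff \<psi> n = (\<Sum>g\<in>monics n. \<psi> g)"

definition prime_powers :: "nat \<Rightarrow> ('a::field poly \<times> nat) set" where
  "prime_powers r = {(P, k). P \<in> monic_primes \<and> k \<ge> 1 \<and> k * degree P = r}"

text \<open>Coefficient of \<open>u^r\<close> in \<open>u L'(u) / L(u)\<close>. When
  \<open>L\<close> is a polynomial with constant term 1, this is minus the sum of the r-th powers of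
  its inverse roots.\<close>

definition L_powsum :: "('a::{finite,field_gcd} poly \<Rightarrow> complex) \<Rightarrow> nat \<Rightarrow> complex" where
  "L_powsum \<psi> r = (\<Sum>(P, k)\<in>prime_powers r. of_nat (degree P) * \<psi> P ^ k)"

lemma prime_powers_subset: "j \<le> r \<Longrightarrow> prime_powers j \<subseteq> prime_powers_upto r"
  by (auto simp: prime_powers_def prime_powers_upto_def)

lemma finite_prime_powers [simp]: "finite (prime_powers r :: ('a::{finite,field_gcd} poly \<times> nat) set)"
  by (rule finite_subset[OF prime_powers_subset[OF order_refl]]) simp

lemma L_coeff_multiples:
  fixes \<psi> :: "'a::{finite,field_gcd} poly \<Rightarrow> complex"
  assumes mult: "\<And>f g. \<psi> (f * g) = \<psi> f * \<psi> g" and Q: "monic Q" "degree Q \<le> r"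
  shows "(\<Sum>g\<in>{g\<in>monics r. Q dvd g}. \<psi> g) = \<psi> Q * L_coeff \<psi> (r - degree Q)"
proof -
  have Q0: "Q \<noteq> 0" using Q(1) by auto
  have "(\<Sum>g\<in>{g\<in>monics r. Q dvd g}. \<psi> g) = (\<Sum>h\<in>monics (r - degree Q). \<psi> (Q * h))"
  proof (rule sum.reindex_bij_betw[symmetric], rule bij_betw_imageI)
    show "inj_on ((*) Q) (monics (r - degree Q))" using Q0 by (auto intro!: inj_onI)
    show "(*) Q ` monics (r - degree Q) = {g \<in> monics r. Q dvd g}"
    proof (intro equalityI subsetI)
      fix g assume "g \<in> (*) Q ` monics (r - degree Q)"
      then obtain h where h: "g = Q * h" "monic h" "degree h = r - degree Q" unfolding monics_def by blast
      have "h \<noteq> 0" using h(2) by auto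
      then have "degree g = r" using h Q Q0 by (simp add: degree_mult_eq)
      moreover have "monic g" using h Q by (simp add: lead_coeff_mult del: coeff_degree_mult)
      ultimately show "g \<in> {g \<in> monics r. Q dvd g}" using h(1) by (auto simp: monics_def)
    next
      fix g assume g: "g \<in> {g \<in> monics r. Q dvd g}"
      then obtain h where h: "g = Q * h" unfolding dvd_def by blast
      have g': "monic g" "degree g = r" "g \<noteq> 0" using g by (auto simp: monics_def)
      have "h \<noteq> 0" using h g'(3) by auto
      have "lead_coeff g = lead_coeff Q * lead_coeff h" unfolding h by (rule lead_coeff_mult)
      then have "monic h" using g'(1) Q(1) by simp
      moreover have "degree h = r - degree Q" using g'(2) h Q0 \<open>h \<noteq> 0\<close> by (simp add: degree_mult_eq)
      ultimately show "g \<in> (*) Q ` monics (r - degree Q)" using h by (auto simp: monics_def)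
    qed
  qed
  then show ?thesis by (simp add: mult L_coeff_def sum_distrib_left)
qed

text \<open>Newton's identities. Sum \<open>degree g * \<psi> g\<close> over the monic
  \<open>g\<close> of degree \<open>r\<close>, expand the degree over the prime powers dividing
  \<open>g\<close>, and interchange: the multiples of \<open>P ^ k\<close> give back an earlier
  \<open>L_coeff\<close>.\<close>

lemma L_coeff_recurrence:
  fixes \<psi> :: "'a::{finite,field_gcd} poly \<Rightarrow> complex"
  assumes one: "\<psi> 1 = 1" and mult: "\<And>f g. \<psi> (f * g) = \<psi> f * \<psi> g"
  shows "of_nat r * L_coeff \<psi> r = (\<Sum>j=1..r. L_powsum \<psi> j * L_coeff \<psi> (r - j))"
proof -
  let ?I = "prime_powers_upto r :: ('a poly \<times> nat) set"
  have pow: "\<psi> (P ^ k) = \<psi> P ^ k" for P k by (induction k) (simp_all add: one mult)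
  define F where "F = (\<lambda>(P, k). of_nat (degree P) * \<psi> P ^ k * L_coeff \<psi> (r - k * degree P))"
  have "of_nat r * L_coeff \<psi> r = (\<Sum>g\<in>monics r. of_nat r * \<psi> g)"
    by (simp add: L_coeff_def sum_distrib_left)
  also have "\<dots> = (\<Sum>g\<in>monics r. \<Sum>x\<in>?I. if fst x ^ snd x dvd g then of_nat (degree (fst x)) * \<psi> g else 0)"
  proof (intro sum.cong refl)
    fix g :: "'a poly" assume g: "g \<in> monics r"
    have "of_nat r * \<psi> g = (\<Sum>x\<in>{(P, k)\<in>?I. P ^ k dvd g}. of_nat (degree (fst x)) * \<psi> g)"
      by (subst degree_eq_sum_prime_powers[OF g]) (simp add: sum_distrib_right case_prod_unfold)
    also have "{(P, k)\<in>?I. P ^ k dvd g} = {x\<in>?I. fst x ^ snd x dvd g}" by auto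
    finally show "of_nat r * \<psi> g = (\<Sum>x\<in>?I. if fst x ^ snd x dvd g then of_nat (degree (fst x)) * \<psi> g else 0)"
      by (simp add: sum.inter_filter)
  qed
  also have "\<dots> = (\<Sum>x\<in>?I. \<Sum>g\<in>monics r. if fst x ^ snd x dvd g then of_nat (degree (fst x)) * \<psi> g else 0)"
    by (rule sum.swap)
  also have "\<dots> = (\<Sum>x\<in>?I. F x)"
  proof (intro sum.cong refl)
    fix x assume x: "x \<in> ?I"
    obtain P k where Pk: "x = (P, k)" by fastforce
    have P: "P \<in> monic_primes" "k * degree P \<le> r" using x by (auto simp: Pk prime_powers_upto_def)
    note PD = monic_primesD[OF P(1)]
    have "degree (P ^ k) = k * degree P" using PD by (simp add: degree_power_eq)
    moreover have "monic (P ^ k)" using PD(1) by (simp add: lead_coeff_power monic_power)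
    ultimately have "(\<Sum>g\<in>{g\<in>monics r. P ^ k dvd g}. \<psi> g) = \<psi> (P ^ k) * L_coeff \<psi> (r - k * degree P)"
      using L_coeff_multiples[OF mult, of "P ^ k" r] P(2) by simp
    then show "(\<Sum>g\<in>monics r. if fst x ^ snd x dvd g then of_nat (degree (fst x)) * \<psi> g else 0) = F x"
      by (simp add: F_def Pk pow sum.inter_filter[symmetric] sum_distrib_left[symmetric])
  qed
  also have "\<dots> = (\<Sum>j\<in>{1..r}. \<Sum>x\<in>{x\<in>?I. snd x * degree (fst x) = j}. F x)"
  proof (rule sum.group[symmetric])
    show "(\<lambda>x. snd x * degree (fst x)) ` ?I \<subseteq> {1..r}"
    proof
      fix j assume "j \<in> (\<lambda>x. snd x * degree (fst x)) ` ?I"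
      then obtain x where x: "x \<in> ?I" "j = snd x * degree (fst x)" by blast
      then have x': "fst x \<in> monic_primes" "snd x \<ge> 1" "snd x * degree (fst x) \<le> r"
        by (auto simp: prime_powers_upto_def)
      then have "snd x * degree (fst x) > 0" using monic_primesD(3)[of "fst x"] by simp
      then show "j \<in> {1..r}" using x(2) x'(3) by simp
    qed
  qed auto
  also have "\<dots> = (\<Sum>j=1..r. L_powsum \<psi> j * L_coeff \<psi> (r - j))"
  proof (intro sum.cong refl)
    fix j assume j: "j \<in> {1..r}"
    have "{x\<in>?I. snd x * degree (fst x) = j} = prime_powers j"
      using j by (auto simp: prime_powers_def prime_powers_upto_def)
    moreover have "F x = (case x of (P, k) \<Rightarrow> of_nat (degree P) * \<psi> P ^ k) * L_coeff \<psi> (r - j)"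
      if "x \<in> prime_powers j" for x
      using that by (auto simp: F_def prime_powers_def)
    ultimately show "(\<Sum>x\<in>{x\<in>?I. snd x * degree (fst x) = j}. F x) = L_powsum \<psi> j * L_coeff \<psi> (r - j)"
      by (simp add: L_powsum_def sum_distrib_right)
  qed
  finally show ?thesis .
qed

text \<open>For constant weight 1 every \<open>L_coeff\<close> is a power of the field size, and the
  recurrence determines the power sums. The result counts the elements of the field with
  \<open>q^r\<close> elements by their minimal polynomials.\<close>

lemma sum_degree_prime_powers:
  assumes "r \<ge> 1"
  shows "(\<Sum>(P, k)\<in>prime_powers r. degree (P :: 'a::{finite,field_gcd} poly)) = CARD('a) ^ r"
proof -
  let ?\<psi> = "\<lambda>_ :: 'a poly. 1 :: complex"
  let ?p = "of_nat CARD('a) :: complex"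
  have A: "L_coeff ?\<psi> n = ?p ^ n" for n by (simp add: L_coeff_def card_monics)
  have rec: "of_nat r * ?p ^ r = (\<Sum>j=1..r. L_powsum ?\<psi> j * ?p ^ (r - j))" for r
    using L_coeff_recurrence[of ?\<psi> r] by (simp add: A)
  obtain s where s: "r = Suc s" using assms by (cases r) auto
  \<comment> \<open>The first \<open>s\<close> summands of the recurrence at \<open>s + 1\<close>
    are \<open>?p\<close> times the recurrence at \<open>s\<close>, which isolates the last power
    sum.\<close>
  have "of_nat (Suc s) * ?p ^ Suc s = (\<Sum>j=1..s. L_powsum ?\<psi> j * ?p ^ (Suc s - j)) + L_powsum ?\<psi> (Suc s)"
    using rec[of "Suc s"] by simp
  also have "(\<Sum>j=1..s. L_powsum ?\<psi> j * ?p ^ (Suc s - j)) = ?p * (\<Sum>j=1..s. L_powsum ?\<psi> j * ?p ^ (s - j))"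
    unfolding sum_distrib_left by (intro sum.cong refl) (simp add: Suc_diff_le)
  also have "\<dots> = ?p * (of_nat s * ?p ^ s)" using rec[of s] by simp
  finally have "L_powsum ?\<psi> r = ?p ^ r" by (simp add: s algebra_simps)
  moreover have "L_powsum ?\<psi> r = of_nat (\<Sum>(P, k)\<in>prime_powers r. degree (P :: 'a poly))"
    by (simp add: L_powsum_def case_prod_unfold)
  ultimately show ?thesis by (metis of_nat_eq_iff of_nat_power)
qed

section \<open>From bounds for power sums to the linear coefficient of a polynomial\<close>

lemma coeff_1_bound:
  fixes f :: "complex poly"
  assumes "poly f 0 = 1" "R > 0" "\<And>z. poly f z = 0 \<Longrightarrow> cmod z \<ge> 1 / R"
  shows "cmod (coeff f 1) \<le> real (degree f) * R"
  using assms
proof (induction "degree f" arbitrary: f)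
  case 0
  then show ?case by (simp add: coeff_eq_0)
next
  case (Suc n)
  have "\<not> constant (poly f)" using Suc(2) constant_degree[of f] by simp
  then obtain z where z: "poly f z = 0" using fundamental_theorem_of_algebra by blast
  have z0: "z \<noteq> 0" using z Suc(3) by auto
  obtain g where g: "f = [:-z, 1:] * g" using z by (auto simp: poly_eq_0_iff_dvd elim: dvdE)
  \<comment> \<open>The root is split off as a factor \<open>1 - u/z\<close>, which keeps the
    constant term 1 and accounts for \<open>- 1/z\<close> in the linear coefficient.\<close>
  define h where "h = smult (- z) g"
  have "[:-z, 1:] = smult (- z) [:1, - (1 / z):]" using z0 by simp
  then have f: "f = [:1, - (1 / z):] * h" unfolding g h_def by (metis mult_smult_left mult_smult_right)
  have h0: "h \<noteq> 0" using f Suc(2) by auto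
  have deg: "degree f = Suc (degree h)" unfolding f by (subst degree_mult_eq) (use h0 z0 in auto)
  have "poly h 0 = 1" using Suc(3) by (simp add: f)
  moreover have "cmod w \<ge> 1 / R" if "poly h w = 0" for w using that Suc(5)[of w] by (simp add: f)
  ultimately have IH: "cmod (coeff h 1) \<le> real (degree h) * R"
    using Suc(1)[of h] Suc(2) Suc(4) deg by simp
  have "coeff f 1 = coeff h 1 - 1 / z"
    using \<open>poly h 0 = 1\<close> by (simp add: f coeff_pCons poly_0_coeff_0)
  moreover have "cmod (1 / z) \<le> R"
    using Suc(5)[OF z] Suc(4) z0 by (simp add: norm_divide field_simps)
  ultimately have "cmod (coeff f 1) \<le> real (degree h) * R + R"
    using IH norm_triangle_ineq4[of "coeff h 1" "1 / z"] by simp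
  then show ?case using deg by (simp add: algebra_simps)
qed

text \<open>By \<open>rec\<close>, \<open>u L'(u) = L(u) G(u)\<close> for \<open>G(u) = \<Sum> S\<^sub>r u\<^sup>r\<close>. A zero of \<open>L\<close> inside the disc of
  convergence of \<open>G\<close> would have higher order on the right than on the left.\<close>

lemma no_root_of_log_derivative:
  fixes A S :: "nat \<Rightarrow> complex"
  assumes A0: "A 0 = 1" and L: "\<And>n. coeff L n = A n"
    and rec: "\<And>r. of_nat r * A r = (\<Sum>j=1..r. S j * A (r - j))"
    and bd: "\<And>r. r \<ge> 1 \<Longrightarrow> cmod (S r) \<le> K * R ^ r" and R: "R > 0"
    and z: "poly L z = 0"
  shows "cmod z \<ge> 1 / R"
proof (rule ccontr)
  assume "\<not> cmod z \<ge> 1 / R"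
  \<comment> \<open>The disc of radius \<open>t\<close> contains a neighbourhood of
    \<open>z\<close>, and the geometric majorant still converges on it.\<close>
  then obtain t where t: "cmod z < t" "t < 1 / R" using dense[of "cmod z" "1 / R"] by auto
  have t0: "t > 0" using t(1) norm_ge_zero[of z] by linarith
  have tR: "R * t < 1" using t(2) R by (simp add: field_simps)
  \<comment> \<open>The recurrence says nothing about \<open>S 0\<close>, and the power series
    starts at \<open>r = 1\<close>.\<close>
  define S' where "S' = (\<lambda>r. if r = 0 then 0 else S r)"
  define B where "B = (\<Sum>r. \<bar>K\<bar> * (R * t) ^ r)"
  have sumB: "summable (\<lambda>r. \<bar>K\<bar> * (R * t) ^ r)"
    using tR R t0 by (intro summable_mult summable_geometric) simp
  have bd': "cmod (S' r * u ^ r) \<le> \<bar>K\<bar> * (R * t) ^ r" if "cmod u \<le> t" for u r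
  proof (cases "r = 0")
    case False
    have "cmod (S' r * u ^ r) = cmod (S r) * cmod u ^ r" using False by (simp add: S'_def norm_mult norm_power)
    also have "\<dots> \<le> (\<bar>K\<bar> * R ^ r) * t ^ r"
    proof (rule mult_mono)
      show "cmod (S r) \<le> \<bar>K\<bar> * R ^ r"
        using order_trans[OF bd[of r] mult_right_mono[of K "\<bar>K\<bar>" "R ^ r"]] False R by simp
      show "cmod u ^ r \<le> t ^ r" using that by (intro power_mono) auto
    qed (use R in auto)
    finally show ?thesis by (simp add: power_mult_distrib)
  qed (simp add: S'_def)
  have summ: "summable (\<lambda>r. cmod (S' r * u ^ r))" if "cmod u \<le> t" for u
    using bd'[OF that] by (intro summable_comparison_test'[OF sumB, of 0]) auto
  define G where "G = (\<lambda>u. \<Sum>r. S' r * u ^ r)"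
  have GB: "cmod (G u) \<le> B" if "cmod u \<le> t" for u
  proof -
    have "cmod (G u) \<le> (\<Sum>r. cmod (S' r * u ^ r))" unfolding G_def by (rule summable_norm[OF summ[OF that]])
    also have "\<dots> \<le> B" unfolding B_def by (rule suminf_le[OF _ summ[OF that] sumB]) (rule bd'[OF that])
    finally show ?thesis .
  qed
  have An: "A n = 0" if "n > degree L" for n using that L[of n] by (simp add: coeff_eq_0)
  have ident: "u * poly (pderiv L) u = G u * poly L u" if u: "cmod u \<le> t" for u
  proof -
    have "summable (\<lambda>n. cmod (A n * u ^ n))"
      by (rule summable_finite[of "{..degree L}"]) (auto simp: An)
    then have "(\<lambda>k. \<Sum>i\<le>k. (S' i * u ^ i) * (A (k - i) * u ^ (k - i))) sums (G u * (\<Sum>n. A n * u ^ n))"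
      unfolding G_def by (rule Cauchy_product_sums[OF summ[OF u]])
    also have "(\<Sum>n. A n * u ^ n) = poly L u"
      by (subst suminf_finite[of "{..degree L}"]) (auto simp: An poly_altdef L)
    also have "(\<lambda>k. \<Sum>i\<le>k. (S' i * u ^ i) * (A (k - i) * u ^ (k - i))) = (\<lambda>k. of_nat k * A k * u ^ k)"
    proof
      fix k
      have "(\<Sum>i\<le>k. (S' i * u ^ i) * (A (k - i) * u ^ (k - i))) = (\<Sum>i\<le>k. S' i * A (k - i) * u ^ k)"
        by (intro sum.cong refl) (simp add: power_add[symmetric] algebra_simps)
      also have "\<dots> = (\<Sum>i=1..k. S' i * A (k - i) * u ^ k)"
        by (intro sum.mono_neutral_right) (auto simp: S'_def)
      also have "\<dots> = (\<Sum>i=1..k. S i * A (k - i)) * u ^ k"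
        unfolding sum_distrib_right by (intro sum.cong) (auto simp: S'_def)
      finally show "(\<Sum>i\<le>k. (S' i * u ^ i) * (A (k - i) * u ^ (k - i))) = of_nat k * A k * u ^ k"
        by (simp add: rec)
    qed
    finally have 1: "(\<lambda>k. of_nat k * A k * u ^ k) sums (G u * poly L u)" .
    have "(\<lambda>k. of_nat k * A k * u ^ k) sums (\<Sum>k\<le>degree L. of_nat k * A k * u ^ k)"
      by (rule sums_finite) (auto simp: An)
    with 1 have "G u * poly L u = (\<Sum>k\<le>degree L. of_nat k * A k * u ^ k)"
      by (rule sums_unique2)
    also have "\<dots> = (\<Sum>k\<le>Suc (degree L). of_nat k * A k * u ^ k)" by (simp add: An)
    also have "\<dots> = (\<Sum>k\<le>degree L. of_nat (Suc k) * A (Suc k) * u ^ Suc k)"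
      by (subst sum.atMost_Suc_shift) simp
    also have "\<dots> = u * (\<Sum>k\<le>degree L. coeff (pderiv L) k * u ^ k)"
      unfolding sum_distrib_left by (intro sum.cong refl) (simp add: coeff_pderiv L)
    also have "(\<Sum>k\<le>degree L. coeff (pderiv L) k * u ^ k) = poly (pderiv L) u"
      unfolding poly_altdef by (rule sum.mono_neutral_right) (auto simp: degree_pderiv coeff_eq_0)
    finally show ?thesis by simp
  qed
  have L0: "L \<noteq> 0" using A0 L[of 0] by auto
  have z0: "z \<noteq> 0" using z A0 L[of 0] by (auto simp: poly_0_coeff_0)
  define e where "e = order z L"
  have e: "e \<noteq> 0" using z L0 by (simp add: e_def order_root)
  obtain Q where Q: "L = [:-z, 1:] ^ e * Q" "\<not> [:-z, 1:] dvd Q"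
    using order_decomp[OF L0, of z] by (auto simp: e_def)
  have Qz: "poly Q z \<noteq> 0" using Q(2) by (simp add: poly_eq_0_iff_dvd)
  obtain e' where e': "e = Suc e'" using e by (cases e) auto
  \<comment> \<open>This is \<open>u L'(u)\<close> after cancelling
    \<open>(u - z) ^ (e - 1)\<close>. The other side of the identity becomes
    \<open>(u - z) Q(u) G(u)\<close>, which tends to 0 because \<open>G\<close> is bounded, whereas
    \<open>H z = z e Q(z)\<close> is nonzero.\<close>
  define H where "H = (\<lambda>u. u * (of_nat e * poly Q u + (u - z) * poly (pderiv Q) u))"
  have H: "H u = (u - z) * poly Q u * G u" if u: "cmod u \<le> t" "u \<noteq> z" for u
  proof -
    have "pderiv L = [:-z, 1:] ^ e' * (smult (of_nat e) Q + [:-z, 1:] * pderiv Q)"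
    proof -
      have "pderiv L = [:-z, 1:] ^ e * pderiv Q + Q * (smult (of_nat e) ([:-z, 1:] ^ e') * pderiv [:-z, 1:])"
        unfolding Q(1) e' by (simp only: pderiv_mult pderiv_power_Suc)
      also have "pderiv [:-z, 1:] = 1" by (simp add: pderiv_pCons)
      finally show ?thesis by (simp only: e' power_Suc mult_smult_left mult_smult_right ring_distribs mult.assoc mult.commute mult.left_commute mult_1_left mult_1_right add.commute)
    qed
    then have 1: "poly (pderiv L) u = (u - z) ^ e' * (of_nat e * poly Q u + (u - z) * poly (pderiv Q) u)"
      by (simp only: poly_mult poly_power poly_add poly_smult poly_pCons poly_0 mult_zero_right add_0_right mult_1_right) (simp add: algebra_simps)
    have 2: "poly L u = (u - z) ^ e' * ((u - z) * poly Q u)"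
      unfolding Q(1) e' by (simp only: poly_mult poly_power poly_pCons poly_0 power_Suc mult_zero_right add_0_right mult_1_right) (simp add: algebra_simps)
    have "(u - z) ^ e' * H u = u * poly (pderiv L) u" by (simp only: 1 H_def mult.assoc mult.left_commute)
    also have "\<dots> = (u - z) ^ e' * ((u - z) * poly Q u * G u)"
      by (simp only: ident[OF u(1)] 2 mult.assoc mult.left_commute mult.commute)
    finally have "(u - z) ^ e' * H u = (u - z) ^ e' * ((u - z) * poly Q u * G u)" .
    then show ?thesis using u(2) by simp
  qed
  have "(H \<longlongrightarrow> 0) (at z)"
  proof (rule Lim_null_comparison)
    have "\<forall>\<^sub>F u in at z. u \<in> ball 0 t" using t(1) by (intro eventually_at_in_open') auto
    moreover have "\<forall>\<^sub>F u in at z. u \<noteq> z" by (simp add: eventually_at_filter)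
    ultimately show "\<forall>\<^sub>F u in at z. cmod (H u) \<le> cmod ((u - z) * poly Q u) * B"
    proof eventually_elim
      case (elim u)
      then have "cmod u \<le> t" by simp
      then show ?case using H[of u] elim GB[of u] by (simp add: norm_mult mult_left_mono)
    qed
    have "((\<lambda>u. cmod ((u - z) * poly Q u) * B) \<longlongrightarrow> cmod ((z - z) * poly Q z) * B) (at z)"
      by (intro tendsto_intros)
    then show "((\<lambda>u. cmod ((u - z) * poly Q u) * B) \<longlongrightarrow> 0) (at z)" by simp
  qed
  moreover have "(H \<longlongrightarrow> z * (of_nat e * poly Q z + (z - z) * poly (pderiv Q) z)) (at z)"
    unfolding H_def by (intro tendsto_intros)
  ultimately have "z * (of_nat e * poly Q z + (z - z) * poly (pderiv Q) z) = 0"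
    by (intro tendsto_unique[OF at_neq_bot]) auto
  then show False using z0 e Qz by simp
qed

lemma coeff_1_bound_of_powsum_bound:
  fixes A S :: "nat \<Rightarrow> complex"
  assumes "A 0 = 1" "\<And>n. n > D \<Longrightarrow> A n = 0"
    and "\<And>r. of_nat r * A r = (\<Sum>j=1..r. S j * A (r - j))"
    and "\<And>r. r \<ge> 1 \<Longrightarrow> cmod (S r) \<le> K * R ^ r" and "R > 0"
  shows "cmod (A 1) \<le> real D * R"
proof -
  define L where "L = (\<Sum>i\<le>D. monom (A i) i)"
  have L: "coeff L n = A n" for n
    using assms(2)[of n] by (simp add: L_def coeff_sum not_le)
  have "degree L \<le> D" by (intro degree_le) (simp add: L assms(2))
  have "cmod (coeff L 1) \<le> real (degree L) * R"
  proof (rule coeff_1_bound)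
    show "poly L 0 = 1" by (simp add: poly_0_coeff_0 L assms(1))
  qed (use no_root_of_log_derivative[OF assms(1) L assms(3,4,5)] assms(5) in auto)
  also have "\<dots> \<le> real D * R" using \<open>degree L \<le> D\<close> assms(5) by simp
  finally show ?thesis by (simp add: L)
qed

section \<open>Norms to the prime field\<close>

text \<open>All points at which polynomials over the base field are evaluated lie in one algebraic
  closure; belonging to the extension of degree \<open>r\<close> is expressed by
  \<open>x ^ (CARD('a) ^ r) = x\<close>.\<close>

definition ev :: "'a::field poly \<Rightarrow> 'a alg_closure \<Rightarrow> 'a alg_closure" where
  "ev g x = poly (map_poly to_ac g) x"

lemma ev_0 [simp]: "ev 0 x = 0" and ev_1 [simp]: "ev 1 x = 1"
  by (simp_all add: ev_def)

lemma ev_pCons [simp]: "ev (pCons a g) x = to_ac a + x * ev g x"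
  by (cases "a = 0 \<and> g = 0") (auto simp: ev_def map_poly_pCons)

lemma ev_add [simp]: "ev (f + g) x = ev f x + ev g x"
  by (induction f g rule: poly_induct2) (simp_all add: algebra_simps)

lemma ev_smult [simp]: "ev (smult c g) x = to_ac c * ev g x"
  by (induction g) (simp_all add: algebra_simps)

lemma ev_mult [simp]: "ev (f * g) x = ev f x * ev g x"
  by (induction f) (simp_all add: algebra_simps)

lemma ev_power [simp]: "ev (f ^ n) x = ev f x ^ n"
  by (induction n) simp_all

lemma ev_sum: "ev (\<Sum>i\<in>I. f i) x = (\<Sum>i\<in>I. ev (f i) x)"
  by (induction I rule: infinite_finite_induct) simp_all

lemma ev_prod: "ev (\<Prod>i\<in>I. f i) x = (\<Prod>i\<in>I. ev (f i) x)"
  by (induction I rule: infinite_finite_induct) simp_all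

lemma ev_diff [simp]: "ev (f - g) x = ev f x - ev g x"
  using ev_add[of "f - g" g x] by simp

text \<open>The equation \<open>CHAR('a) = CARD('a)\<close>, carried along from here on, says that
  \<open>'a\<close> is a prime field, so that powers of \<open>CARD('a)\<close> are powers of the
  characteristic.\<close>

lemma alg_closure_frobenius_add:
  fixes x y :: "'a::{finite_field} alg_closure"
  assumes "CHAR('a) = CARD('a)"
  shows "(x + y) ^ (CARD('a) ^ n) = x ^ (CARD('a) ^ n) + y ^ (CARD('a) ^ n)"
  by (rule freshmans_dream'[where n = n]) (simp_all add: assms[symmetric])

lemma frobenius_inj:
  fixes x y :: "'a::{finite_field} alg_closure"
  assumes "CHAR('a) = CARD('a)" and "x ^ (CARD('a) ^ n) = y ^ (CARD('a) ^ n)"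
  shows "x = y"
proof -
  have "x ^ (CARD('a) ^ n) = (x - y) ^ (CARD('a) ^ n) + y ^ (CARD('a) ^ n)"
    using alg_closure_frobenius_add[OF assms(1), of "x - y" y n] by simp
  then have "(x - y) ^ (CARD('a) ^ n) = 0" using assms(2) by simp
  then show ?thesis by simp
qed

text \<open>The coefficients of \<open>g\<close> are fixed by the Frobenius map.\<close>

lemma ev_frobenius:
  fixes g :: "'a::{finite_field} poly"
  assumes "CHAR('a) = CARD('a)"
  shows "ev g x ^ (CARD('a) ^ n) = ev g (x ^ (CARD('a) ^ n))"
proof (induction g)
  case (pCons a g)
  have "to_ac a ^ (CARD('a) ^ n) = to_ac a"
    by (metis finite_field_power_card_power_eq_same to_ac_power)
  then show ?case
    by (simp add: alg_closure_frobenius_add[OF assms] power_mult_distrib pCons.IH)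
qed simp

lemma monic_prime_root:
  fixes P :: "'a::{finite_field,field_gcd} poly"
  assumes "P \<in> monic_primes"
  obtains x where "ev P x = 0"
proof -
  have "degree (map_poly to_ac P) > 0" using monic_primesD(3)[OF assms] by (simp add: degree_map_poly)
  then show ?thesis using that alg_closed_imp_poly_has_root unfolding ev_def by blast
qed

text \<open>If \<open>P\<close> and \<open>g\<close> were coprime, a Bezout identity evaluated at
  the common zero \<open>x\<close> would read \<open>0 = 1\<close>.\<close>

lemma monic_prime_dvd:
  fixes P :: "'a::{finite_field,field_gcd} poly"
  assumes P: "P \<in> monic_primes" and x: "ev P x = 0" and g: "ev g x = 0"
  shows "P dvd g"
proof (rule ccontr)
  assume "\<not> P dvd g"
  then have "coprime P g"
    using prime_elem_imp_coprime[OF prime_imp_prime_elem[OF monic_primesD(6)[OF P]]] by blast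
  then have "fst (bezout_coefficients P g) * P + snd (bezout_coefficients P g) * g = 1"
    by (simp add: bezout_coefficients_fst_snd)
  then have "ev (fst (bezout_coefficients P g) * P + snd (bezout_coefficients P g) * g) x = 1"
    by simp
  then show False using x g by simp
qed

text \<open>The values at \<open>x\<close> of the polynomials of degree below
  \<open>degree P\<close> are distinct, and all of them inherit from \<open>x\<close> the property
  of being a root of \<open>y^(q^l) - y\<close>. So \<open>q ^ degree P\<close> is at most
  \<open>q ^ l\<close>.\<close>

lemma degree_le_of_frobenius_fixed:
  fixes P :: "'a::{finite_field,field_gcd} poly"
  assumes ch: "CHAR('a) = CARD('a)" and P: "P \<in> monic_primes" and x: "ev P x = 0"
    and l: "l > 0" "x ^ (CARD('a) ^ l) = x"
  shows "degree P \<le> l"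
proof -
  have p: "CARD('a) > 1" using CHAR_prime[where 'a = 'a] prime_gt_1_nat ch by metis
  let ?q = "CARD('a) ^ l" and ?V = "(\<lambda>g. ev g x) ` polys_below (degree P)"
  have q: "?q > 1" by (rule one_less_power[OF p l(1)])
  have "inj_on (\<lambda>g. ev g x) (polys_below (degree P))"
  proof (rule inj_onI)
    fix f g :: "'a poly"
    assume fg: "f \<in> polys_below (degree P)" "g \<in> polys_below (degree P)" "ev f x = ev g x"
    have "f - g \<in> polys_below (degree P)" using fg(1,2) by (simp add: polys_below_def)
    moreover have "P dvd f - g" using monic_prime_dvd[OF P x, of "f - g"] fg(3) by simp
    ultimately show "f = g" by (metis dvd_imp_degree_le eq_iff_diff_eq_0 not_less polys_below_iff)
  qed
  then have card: "card ?V = CARD('a) ^ degree P"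
    using card_polys_below[where 'a = 'a and n = "degree P"] by (simp add: card_image)
  define F where "F = monom 1 ?q - [:0, 1 :: 'a alg_closure:]"
  have "coeff F ?q = 1" using p l(1) q by (simp add: F_def coeff_pCons split: nat.split)
  then have F0: "F \<noteq> 0" by auto
  have "degree F \<le> ?q" using p l(1) q less_imp_le[OF q] unfolding F_def by (intro degree_diff_le) (simp_all add: degree_monom_eq)
  have "?V \<subseteq> {y. poly F y = 0}"
    using ev_frobenius[OF ch, of _ x l] l(2) by (auto simp: F_def poly_monom)
  then have "card ?V \<le> card {y. poly F y = 0}"
    by (intro card_mono poly_roots_finite F0)
  also have "\<dots> \<le> degree F" by (rule card_poly_roots_bound[OF F0])
  finally have "CARD('a) ^ degree P \<le> CARD('a) ^ l" using card \<open>degree F \<le> ?q\<close> by simp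
  then show ?thesis using p power_increasing_iff[of "CARD('a)" "degree P" l] by simp
qed

text \<open>All \<open>x^(q^i)\<close> are roots of \<open>P\<close>. Among the first
  \<open>degree P + 1\<close> of them two coincide, and the preceding bound forces their indices to
  be at least \<open>degree P\<close> apart, hence to be the first and the last.\<close>

lemma monic_prime_conjugates:
  fixes P :: "'a::{finite_field,field_gcd} poly"
  assumes ch: "CHAR('a) = CARD('a)" and P: "P \<in> monic_primes" and x: "ev P x = 0"
  shows "x ^ (CARD('a) ^ degree P) = x" and "inj_on (\<lambda>i. x ^ (CARD('a) ^ i)) {..<degree P}"
proof -
  let ?c = "\<lambda>i. x ^ (CARD('a) ^ i)" and ?P = "map_poly to_ac P"
  have root: "poly ?P (?c i) = 0" for i
    using ev_frobenius[OF ch, of P x i] x by (simp add: ev_def[symmetric] power_0_left)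
  have coll: "degree P \<le> j - i" "x ^ (CARD('a) ^ (j - i)) = x" if "i < j" "?c i = ?c j" for i j
  proof -
    have "?c j = (x ^ (CARD('a) ^ (j - i))) ^ (CARD('a) ^ i)"
      using that(1) by (simp add: power_mult[symmetric] power_add[symmetric])
    then show fx: "x ^ (CARD('a) ^ (j - i)) = x"
      using frobenius_inj[OF ch, of "x ^ (CARD('a) ^ (j - i))" i x] that(2) by simp
    show "degree P \<le> j - i" using degree_le_of_frobenius_fixed[OF ch P x _ fx] that(1) by simp
  qed
  show "inj_on ?c {..<degree P}"
  proof (rule inj_onI)
    fix i j assume ij: "i \<in> {..<degree P}" "j \<in> {..<degree P}" "?c i = ?c j"
    show "i = j"
    proof (cases i j rule: linorder_cases)
      case less then show ?thesis using coll(1)[of i j] ij by simp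
    next
      case greater then show ?thesis using coll(1)[of j i] ij by simp
    qed
  qed
  have P0: "?P \<noteq> 0" using monic_primesD(4)[OF P] by (simp add: map_poly_eq_0_iff)
  have "\<not> inj_on ?c {..degree P}"
  proof
    assume "inj_on ?c {..degree P}"
    then have "degree P + 1 = card (?c ` {..degree P})" by (simp add: card_image)
    also have "\<dots> \<le> card {y. poly ?P y = 0}"
      by (intro card_mono poly_roots_finite P0) (use root in auto)
    also have "\<dots> \<le> degree ?P" by (rule card_poly_roots_bound[OF P0])
    finally show False by (simp add: degree_map_poly)
  qed
  then obtain i j where ij: "i < j" "j \<le> degree P" "?c i = ?c j"
    unfolding inj_on_def by (metis atMost_iff linorder_neqE_nat)
  from coll[OF ij(1,3)] ij show "x ^ (CARD('a) ^ degree P) = x"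
    by (metis diff_le_self le_antisym le_trans)
qed

lemma monic_eqI_roots:
  fixes f g :: "'a::idom poly"
  assumes "monic f" "monic g" "degree f = n" "degree g = n" "finite A" "card A = n"
    and "\<And>x. x \<in> A \<Longrightarrow> poly f x = 0" "\<And>x. x \<in> A \<Longrightarrow> poly g x = 0"
  shows "f = g"
proof (rule ccontr)
  assume "f \<noteq> g"
  then have ne: "f - g \<noteq> 0" by simp
  have "degree (f - g) \<le> n" using assms(3,4) by (intro degree_diff_le) auto
  moreover have "coeff (f - g) n = 0" using assms(1-4) by simp
  ultimately have "degree (f - g) < n"
    using ne by (metis le_neq_implies_less leading_coeff_0_iff)
  moreover have "card A \<le> card {x. poly (f - g) x = 0}"
    by (intro card_mono poly_roots_finite ne) (use assms(7,8) in auto)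
  ultimately show False using card_poly_roots_bound[OF ne] assms(6) by linarith
qed

text \<open>\<open>P\<close> is the product of the factors \<open>X - x^(q^i)\<close>, and
  \<open>c - x^(q^i)\<close> is \<open>(c - x)^(q^i)\<close> because \<open>c\<close> is fixed by
  Frobenius. So \<open>P(c)\<close> is the norm of \<open>c - x\<close>.\<close>

lemma norm_eq_poly:
  fixes P :: "'a::{finite_field,field_gcd} poly"
  assumes ch: "CHAR('a) = CARD('a)" and P: "P \<in> monic_primes" and x: "ev P x = 0"
  shows "to_ac (poly P c) = (to_ac c - x) ^ (\<Sum>i<degree P. CARD('a) ^ i)"
proof -
  let ?c = "\<lambda>i. x ^ (CARD('a) ^ i)" and ?e = "degree P"
  have inj: "inj_on ?c {..<?e}" by (rule monic_prime_conjugates(2)[OF assms])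
  have deg: "degree (map_poly to_ac P) = ?e" by (simp add: degree_map_poly)
  have "map_poly to_ac P = (\<Prod>i<?e. [:- ?c i, 1:])"
  proof (rule monic_eqI_roots[where A = "?c ` {..<?e}" and n = ?e])
    show "monic (map_poly to_ac P)" using monic_primesD(1)[OF P] deg by (simp add: coeff_map_poly)
    show "monic (\<Prod>i<?e. [:- ?c i, 1:])" by (rule monic_prod) simp
    show "degree (\<Prod>i<?e. [:- ?c i, 1:]) = ?e" by (subst degree_prod_sum_eq) auto
    show "card (?c ` {..<?e}) = ?e" using inj by (simp add: card_image)
    show "poly (map_poly to_ac P) y = 0" if "y \<in> ?c ` {..<?e}" for y
      using that ev_frobenius[OF ch, of P x] x by (auto simp: ev_def power_0_left)
    show "poly (\<Prod>i<?e. [:- ?c i, 1:]) y = 0" if "y \<in> ?c ` {..<?e}" for y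
      using that by (auto simp: poly_prod)
  qed (simp_all add: degree_map_poly)
  then have "poly (map_poly to_ac P) (to_ac c) = (\<Prod>i<?e. to_ac c - ?c i)"
    by (simp add: poly_prod)
  also have "poly (map_poly to_ac P) (to_ac c) = to_ac (poly P c)"
    by (induction P) (simp_all add: map_poly_pCons)
  also have "(\<Prod>i<?e. to_ac c - ?c i) = (\<Prod>i<?e. (to_ac c - x) ^ (CARD('a) ^ i))"
    using ev_frobenius[OF ch, of "[:c, -1:]" x] by (intro prod.cong refl) simp
  also have "\<dots> = (to_ac c - x) ^ (\<Sum>i<?e. CARD('a) ^ i)" by (simp add: power_sum)
  finally show ?thesis .
qed

lemma sum_lessThan_add: "(\<Sum>i<m + n. f i :: 'b::comm_monoid_add) = (\<Sum>i<m. f i) + (\<Sum>i<n. f (m + i))" for m n :: nat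
  by (induction n) (simp_all add: add.assoc)

text \<open>The norm from an extension that is \<open>k\<close> times as large: the exponent splits
  into \<open>k\<close> blocks, and each block gives a Frobenius power of \<open>poly P c\<close>,
  which is \<open>poly P c\<close> itself.\<close>

lemma norm_power_eq:
  fixes P :: "'a::{finite_field,field_gcd} poly"
  assumes "CHAR('a) = CARD('a)" and "P \<in> monic_primes" and "ev P x = 0"
  shows "(to_ac c - x) ^ (\<Sum>i<k * degree P. CARD('a) ^ i) = to_ac (poly P c) ^ k"
proof (induction k)
  case (Suc k)
  let ?q = "CARD('a)" and ?e = "degree P"
  have "(\<Sum>i<Suc k * ?e. ?q ^ i) = (\<Sum>i<k * ?e. ?q ^ i) + (\<Sum>i<?e. ?q ^ (k * ?e + i))"
    using sum_lessThan_add[of "\<lambda>i. ?q ^ i" "k * ?e" ?e] by (simp only: mult_Suc add.commute)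
  also have "(\<Sum>i<?e. ?q ^ (k * ?e + i)) = (\<Sum>i<?e. ?q ^ i) * ?q ^ (k * ?e)"
    by (simp add: power_add sum_distrib_right mult.commute)
  finally have "(to_ac c - x) ^ (\<Sum>i<Suc k * ?e. ?q ^ i)
      = to_ac (poly P c) ^ k * to_ac (poly P c) ^ (?q ^ (k * ?e))"
    by (simp only: power_add power_mult Suc.IH norm_eq_poly[OF assms, symmetric])
  also have "to_ac (poly P c) ^ (?q ^ (k * ?e)) = to_ac (poly P c)"
    by (metis finite_field_power_card_power_eq_same to_ac_power)
  finally show ?case by simp
qed simp

section \<open>Stepanov's method\<close>

text \<open>The term of least order at \<open>c\<close> cannot be cancelled, since all other terms
  are divisible by a higher power of \<open>X - c\<close>.\<close>

lemma sum_neq_0_of_distinct_orders: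
  fixes t :: "'b \<Rightarrow> 'a::idom poly"
  assumes fin: "finite A" "A \<noteq> {}" and t: "\<And>x. x \<in> A \<Longrightarrow> t x \<noteq> 0"
    and inj: "inj_on (\<lambda>x. order c (t x)) A"
  shows "(\<Sum>x\<in>A. t x) \<noteq> 0"
proof
  assume 0: "(\<Sum>x\<in>A. t x) = 0"
  obtain a where a: "a \<in> A" "\<And>x. x \<in> A \<Longrightarrow> order c (t a) \<le> order c (t x)"
    using ex_min_if_finite[of "(\<lambda>x. order c (t x)) ` A"] fin by (auto simp: not_less)
  let ?d = "[:-c, 1:] ^ Suc (order c (t a))"
  have "?d dvd t x" if x: "x \<in> A - {a}" for x
  proof -
    have "order c (t x) \<noteq> order c (t a)" using inj x a(1) unfolding inj_on_def by auto
    then have "Suc (order c (t a)) \<le> order c (t x)" using a(2)[of x] x by simp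
    then show ?thesis by (simp only: order_divides simp_thms)
  qed
  then have "?d dvd (\<Sum>x\<in>A - {a}. t x)" by (rule dvd_sum)
  moreover have "t a = - (\<Sum>x\<in>A - {a}. t x)"
    using 0 sum.remove[OF fin(1) a(1), of t] by (simp add: eq_neg_iff_add_eq_0)
  ultimately have "?d dvd t a" by (simp only: dvd_minus_iff)
  then show False using t[OF a(1)] by (simp only: order_divides) simp
qed

lemma poly_frobenius_diff:
  fixes f g :: "'a::finite_field poly"
  assumes "CHAR('a) = CARD('a)"
  shows "(f - g) ^ (CARD('a) ^ n) = f ^ (CARD('a) ^ n) - g ^ (CARD('a) ^ n)"
proof -
  have "((f - g) + g) ^ (CARD('a) ^ n) = (f - g) ^ (CARD('a) ^ n) + g ^ (CARD('a) ^ n)"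
    by (rule freshmans_dream'[where n = n]) (simp_all add: assms[symmetric])
  then show ?thesis by (simp add: algebra_simps)
qed

lemma degree_sum_less:
  assumes "\<And>i. i \<in> A \<Longrightarrow> degree (f i) < n" "n > 0"
  shows "degree (\<Sum>i\<in>A. f i) < n"
  using assms by (induction A rule: infinite_finite_induct) (auto intro: degree_add_less)

lemma degree_power_le':
  assumes "k \<le> l * h"
  shows "degree (f ^ k) \<le> l * h * degree f"
  using order_trans[OF degree_power_le[of f k] mult_le_mono2[OF assms, of "degree f"]] by (simp only: mult.commute)

lemma order_pow:
  fixes f :: "'a::idom poly"
  assumes "f \<noteq> 0"
  shows "order c (f ^ n) = n * order c f"
  using assms by (induction n) (simp_all add: order_mult order_1_eq_0)

text \<open>Bombieri's form of Stepanov's method, without derivatives. In \<open>\<Phi>\<close> the relations \<open>x\<^bsup>q\<^esup> = x\<close> and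
  \<open>f(x)\<^bsup>g\<^esup> = a\<close> have been used to lower the exponents in \<open>f\<^bsup>(n-1)h\<^esup> G\<^bsup>M\<^esup>\<close>, where \<open>g = h + M h'\<close>. There are
  more choices of \<open>r\<close> than values of \<open>\<Phi>\<close>, and \<open>\<Phi> = 0\<close> makes \<open>G\<close> vanish at every such \<open>x\<close>; the
  simple zero of \<open>f\<close> at \<open>c0\<close> keeps the terms of \<open>G\<close> apart.\<close>

lemma stepanov_polynomial:
  fixes f :: "'a::{finite_field,field_gcd} poly"
  assumes ch: "CHAR('a) = CARD('a)" and f0: "f \<noteq> 0" and ord: "order c0 f = 1"
    and n: "n \<ge> 1" and h: "n * h + 1 = CARD('a) ^ s" and h': "n * h' + 1 = CARD('a) ^ s'" "h' \<ge> 1"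
    and cnt: "h' * CARD('a) ^ s + (n - 1) * h * degree f + J < n * J * h'" and a: "a \<noteq> 0"
  obtains G where "G \<noteq> 0" "degree G \<le> h' + n * h' * degree f + J * CARD('a) ^ s'"
    "\<And>x. x ^ (CARD('a) ^ (s + s')) = x \<Longrightarrow> ev f x ^ (h + CARD('a) ^ s * h') = to_ac a \<Longrightarrow> ev G x = 0"
proof -
  define M where "M = CARD('a) ^ s"
  define q' where "q' = CARD('a) ^ s'"
  \<comment> \<open>All \<open>\<Phi> r\<close> have degree below \<open>D\<close>, so
    \<open>\<Phi>\<close> takes at most \<open>q^D\<close> values on the \<open>q^(n J h')\<close>
    elements of \<open>R\<close>.\<close>
  define D where "D = h' * M + (n - 1) * h * degree f + J"
  define Y where "Y = [:-c0, 1:]"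
  define S where "S = {..<n} \<times> {..<J}"
  define \<Phi> where "\<Phi> = (\<lambda>r :: nat \<times> nat \<Rightarrow> 'a poly. \<Sum>(i, j)\<in>S. smult (a ^ i) (r (i, j) ^ M * f ^ ((n - 1 - i) * h) * Y ^ j))"
  define R where "R = (\<Pi>\<^sub>E t\<in>S. polys_below h' :: 'a poly set)"
  have p: "CARD('a) > 1" using CHAR_prime[where 'a = 'a] prime_gt_1_nat ch by metis
  then have M: "M \<ge> 1" by (simp add: M_def)
  have Y: "Y \<noteq> 0" "degree Y = 1" by (simp_all add: Y_def)
  have D: "D < n * J * h'" using cnt by (simp add: D_def M_def)
  have "\<Phi> r \<in> polys_below D" if r: "r \<in> R" for r
  proof -
    have "degree (smult (a ^ i) (r (i, j) ^ M * f ^ ((n - 1 - i) * h) * Y ^ j)) < D" if ij: "(i, j) \<in> S" for i j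
    proof -
      have "r (i, j) \<in> polys_below h'" using r ij by (auto simp: R_def)
      then have "degree (r (i, j)) < h'" using h'(2) by (auto simp: polys_below_iff)
      then have 1: "degree (r (i, j) ^ M) \<le> (h' - 1) * M"
        using degree_power_le[of "r (i, j)" M] mult_le_mono1[of "degree (r (i, j))" "h' - 1" M] by linarith
      have 2: "degree (f ^ ((n - 1 - i) * h)) \<le> (n - 1) * h * degree f"
        by (intro degree_power_le' mult_le_mono1) (rule diff_le_self)
      have "degree (Y ^ j) = j" by (simp add: degree_power_eq Y)
      moreover have "degree (r (i, j) ^ M * f ^ ((n - 1 - i) * h) * Y ^ j) \<le> degree (r (i, j) ^ M) + degree (f ^ ((n - 1 - i) * h)) + degree (Y ^ j)"
        using degree_mult_le[of "r (i, j) ^ M * f ^ ((n - 1 - i) * h)" "Y ^ j"] degree_mult_le[of "r (i, j) ^ M" "f ^ ((n - 1 - i) * h)"]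
        by linarith
      moreover have "(h' - 1) * M \<le> h' * M" by simp
      moreover have "j < J" using ij by (simp add: S_def)
      ultimately have "degree (r (i, j) ^ M * f ^ ((n - 1 - i) * h) * Y ^ j) < D"
        using 1 2 unfolding D_def by linarith
      then show ?thesis using degree_smult_le le_less_trans by blast
    qed
    moreover have "D > 0" using M h'(2) by (simp add: D_def)
    ultimately have "degree (\<Phi> r) < D" unfolding \<Phi>_def by (intro degree_sum_less) auto
    then show ?thesis by (simp add: polys_below_iff)
  qed
  then have "\<Phi> ` R \<subseteq> polys_below D" by blast
  then have "card (\<Phi> ` R) \<le> CARD('a) ^ D"
    using card_polys_below[where 'a = 'a and n = D] card_mono by metis
  also have "\<dots> < CARD('a) ^ (n * J * h')" using D p by simp
  also have "\<dots> = card R"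
    using card_polys_below[where 'a = 'a and n = h']
    by (simp add: R_def card_PiE S_def card_cartesian_product power_mult[symmetric] mult_ac)
  finally have "\<not> inj_on \<Phi> R" using pigeonhole by blast
  then obtain r1 r2 where r: "r1 \<in> R" "r2 \<in> R" "r1 \<noteq> r2" "\<Phi> r1 = \<Phi> r2" by (auto simp: inj_on_def)
  define u where "u = (\<lambda>t. r1 t - r2 t)"
  have u_deg: "u t \<in> polys_below h'" if "t \<in> S" for t
  proof -
    have "r1 t \<in> polys_below h'" "r2 t \<in> polys_below h'" using that r(1,2) by (auto simp: R_def)
    then show ?thesis by (simp add: u_def polys_below_def)
  qed
  have \<Phi>u: "\<Phi> u = 0"
  proof -
    have "\<Phi> u = \<Phi> r1 - \<Phi> r2"
      unfolding \<Phi>_def u_def M_def sum_subtractf[symmetric]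
      by (intro sum.cong refl) (auto simp: poly_frobenius_diff[OF ch] algebra_simps smult_diff_right)
    then show ?thesis using r(4) by simp
  qed
  define U where "U = {t\<in>S. u t \<noteq> 0}"
  have finS: "finite S" by (simp add: S_def)
  have "U \<noteq> {}"
  proof
    assume "U = {}"
    then have "r1 t = r2 t" if "t \<in> S" for t using that by (cases t) (auto simp: U_def u_def)
    then have "r1 = r2" using r(1,2) unfolding R_def by (intro PiE_ext)
    then show False using r(3) by simp
  qed
  \<comment> \<open>The order of term \<open>(i, j)\<close> at \<open>c0\<close> is that of
    \<open>u (i, j)\<close> plus \<open>i * h' + j * q'\<close>. The first part is below
    \<open>h'\<close>, and \<open>n * h' < q'\<close>, so \<open>i\<close> and \<open>j\<close> can
    be read off as digits.\<close>
  define T where "T = (\<lambda>(i, j). u (i, j) * f ^ (i * h') * Y ^ (j * q'))"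
  define G where "G = (\<Sum>t\<in>S. T t)"
  have GU: "G = (\<Sum>t\<in>U. T t)"
    unfolding G_def by (rule sum.mono_neutral_right) (auto simp: finS U_def T_def)
  have nh': "n * h' < q'" using h'(1) by (simp add: q'_def)
  have ordY: "order c0 Y = 1" using order_power_n_n[of c0 1] by (simp add: Y_def)
  have ordT: "order c0 (T (i, j)) = order c0 (u (i, j)) + i * h' + j * q'" if "(i, j) \<in> U" for i j
    using that f0 Y(1) ord
    by (simp add: T_def U_def order_mult order_pow ordY)
  have "G \<noteq> 0"
    unfolding GU
  proof (rule sum_neq_0_of_distinct_orders[where c = c0])
    show "finite U" using finS by (simp add: U_def)
    show "T t \<noteq> 0" if "t \<in> U" for t using that f0 Y(1) by (auto simp: T_def U_def case_prod_unfold)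
    show "inj_on (\<lambda>t. order c0 (T t)) U"
    proof (rule inj_onI, clarify)
      fix i j i2 j2
      assume t: "(i, j) \<in> U" "(i2, j2) \<in> U" and eq: "order c0 (T (i, j)) = order c0 (T (i2, j2))"
      have key: "order c0 (T (i, j)) div q' = j \<and> (order c0 (T (i, j)) mod q') div h' = i" if ij: "(i, j) \<in> U" for i j
      proof -
        have "i < n" "u (i, j) \<noteq> 0" "(i, j) \<in> S" using ij by (auto simp: U_def S_def)
        have "order c0 (u (i, j)) \<le> degree (u (i, j))" using \<open>u (i, j) \<noteq> 0\<close> by (rule order_degree)
        then have o: "order c0 (u (i, j)) < h'"
          using u_deg[OF \<open>(i, j) \<in> S\<close>] \<open>u (i, j) \<noteq> 0\<close> by (simp add: polys_below_iff)
        have "Suc i * h' \<le> n * h'" using \<open>i < n\<close> by (intro mult_le_mono1) simp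
        then have lt: "order c0 (u (i, j)) + i * h' < q'" using o nh' by simp
        then show ?thesis using o by (simp add: ordT[OF ij])
      qed
      show "i = i2 \<and> j = j2" using key[OF t(1)] key[OF t(2)] eq by metis
    qed
  qed (rule \<open>U \<noteq> {}\<close>)
  moreover have "degree G \<le> h' + n * h' * degree f + J * q'"
    unfolding G_def
  proof (rule degree_sum_le[OF finS], clarify)
    fix i j assume ij: "(i, j) \<in> S"
    have "degree (u (i, j)) \<le> h'" using u_deg[OF ij] by (auto simp: polys_below_iff)
    moreover have "degree (f ^ (i * h')) \<le> n * h' * degree f"
      by (rule degree_power_le') (use ij in \<open>simp add: S_def\<close>)
    moreover have "degree (Y ^ (j * q')) \<le> J * q'" using ij by (simp add: degree_power_eq Y S_def)
    moreover have "degree (T (i, j)) \<le> degree (u (i, j)) + degree (f ^ (i * h')) + degree (Y ^ (j * q'))"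
      using degree_mult_le[of "u (i, j) * f ^ (i * h')" "Y ^ (j * q')"] degree_mult_le[of "u (i, j)" "f ^ (i * h')"]
      unfolding T_def by simp
    ultimately show "degree (T (i, j)) \<le> h' + n * h' * degree f + J * q'" by linarith
  qed
  moreover have "ev G x = 0"
    if x: "x ^ (CARD('a) ^ (s + s')) = x" and fx: "ev f x ^ (h + CARD('a) ^ s * h') = to_ac a" for x
  proof -
    let ?F = "ev f x" and ?y = "ev Y x"
    have fx': "?F ^ (h + M * h') = to_ac a" using fx by (simp add: M_def)
    have F0: "?F \<noteq> 0"
    proof
      assume "?F = 0"
      moreover have "h + M * h' > 0" using M h'(2) by simp
      ultimately have "to_ac a = 0" using fx' zero_power[of "h + M * h'", where 'a = "'a alg_closure"] by simp
      then show False using a by simp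
    qed
    have y: "?y ^ (q' * M) = ?y"
      using ev_frobenius[OF ch, of Y x "s + s'"] x by (simp add: q'_def M_def power_add mult.commute)
    \<comment> \<open>The factor \<open>?F ^ ((n - 1) * h)\<close> supplies the exponents needed to
      complete \<open>i * h' * M\<close> to \<open>i * (h + M * h')\<close>, which turns into
      \<open>a ^ i\<close>; what is left over, \<open>(n - 1 - i) * h\<close>, is the exponent in
      \<open>\<Phi>\<close>.\<close>
    have trm: "?F ^ ((n - 1) * h) * ev (T (i, j)) x ^ M = ev (smult (a ^ i) (u (i, j) ^ M * f ^ ((n - 1 - i) * h) * Y ^ j)) x"
      if ij: "(i, j) \<in> S" for i j
    proof -
      have "i \<le> n - 1" using ij by (auto simp: S_def)
      then obtain l where l: "n - 1 = i + l" using le_Suc_ex by blast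
      have e1: "(n - 1) * h + i * h' * M = i * (h + M * h') + (n - 1 - i) * h"
        unfolding l by (simp add: algebra_simps)
      have "?F ^ ((n - 1) * h) * ev (T (i, j)) x ^ M = ?F ^ ((n - 1) * h + i * h' * M) * ev (u (i, j)) x ^ M * ?y ^ (j * q' * M)"
        by (simp add: T_def power_mult_distrib power_mult[symmetric] power_add)
      also have "?y ^ (j * q' * M) = ?y ^ j"
        using y by (metis mult.assoc mult.commute power_mult)
      also have "?F ^ ((n - 1) * h + i * h' * M) = to_ac (a ^ i) * ?F ^ ((n - 1 - i) * h)"
        unfolding e1 power_add using fx' by (metis mult.commute power_mult to_ac_power)
      finally show ?thesis by simp
    qed
    have "ev G x ^ M = (\<Sum>t\<in>S. ev (T t) x ^ M)"
      unfolding G_def ev_sum M_def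
      by (rule freshmans_dream_sum'[where n = s]) (simp_all add: ch[symmetric])
    then have "?F ^ ((n - 1) * h) * ev G x ^ M = (\<Sum>t\<in>S. ?F ^ ((n - 1) * h) * ev (T t) x ^ M)"
      by (simp add: sum_distrib_left)
    also have "\<dots> = ev (\<Phi> u) x"
      unfolding \<Phi>_def ev_sum by (intro sum.cong refl) (use trm in auto)
    finally show ?thesis using \<Phi>u F0 by simp
  qed
  ultimately show ?thesis using that[of G] by (simp add: q'_def)
qed

section \<open>Weil bound for products of shifted characters\<close>

lemma finite_field_power_card_minus_1:
  fixes x :: "'a::finite_field"
  assumes "x \<noteq> 0"
  shows "x ^ (CARD('a) - 1) = 1"
proof -
  have "x * x ^ (CARD('a) - 1) = x ^ CARD('a)" by (simp flip: power_Suc)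
  then show ?thesis using assms by (simp add: finite_field_power_card_eq_same)
qed

section \<open>Multiplicative characters of a finite field, their kernels and values\<close>

locale mult_char =
  fixes chi :: "'a::{finite_field,field_gcd} \<Rightarrow> complex"
  assumes chi_0 [simp]: "chi 0 = 0" and chi_1 [simp]: "chi 1 = 1"
    and chi_mult: "chi (x * y) = chi x * chi y"
    and nontrivial: "\<exists>x. x \<noteq> 0 \<and> chi x \<noteq> 1"
begin

lemma chi_power: "chi (x ^ n) = chi x ^ n"
  by (induction n) (simp_all add: chi_mult)

lemma chi_prod: "chi (\<Prod>i\<in>I. f i) = (\<Prod>i\<in>I. chi (f i))"
  by (induction I rule: infinite_finite_induct) (simp_all add: chi_mult)

lemma cmod_chi:
  assumes "x \<noteq> 0"
  shows "cmod (chi x) = 1"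
proof -
  have "CARD('a) \<ge> card {0, 1 :: 'a}" by (intro card_mono) auto
  then have "CARD('a) - 1 > 0" by simp
  moreover have "chi x ^ (CARD('a) - 1) = 1"
    by (simp only: chi_power[symmetric] finite_field_power_card_minus_1[OF assms] chi_1)
  ultimately show ?thesis using power_eq_1_iff[of "chi x" "CARD('a) - 1"] by simp
qed

lemma cmod_chi_le: "cmod (chi x) \<le> 1"
  by (cases "x = 0") (simp_all add: cmod_chi)

lemma chi_eq_0_iff: "chi x = 0 \<longleftrightarrow> x = 0"
  by (metis cmod_chi norm_zero zero_neq_one chi_0)

lemma chi_divide: "y \<noteq> 0 \<Longrightarrow> chi (x / y) = chi x / chi y"
  using chi_mult[of "x / y" y] by (simp add: chi_eq_0_iff field_simps)

lemma sum_chi: "(\<Sum>x\<in>UNIV. chi x) = 0"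
proof -
  obtain a where a: "a \<noteq> 0" "chi a \<noteq> 1" using nontrivial by blast
  have "(\<Sum>x\<in>UNIV. chi x) = (\<Sum>x\<in>UNIV. chi (a * x))"
    by (rule sum.reindex_bij_witness[of _ "\<lambda>x. a * x" "\<lambda>x. x / a"]) (use a in auto)
  also have "\<dots> = chi a * (\<Sum>x\<in>UNIV. chi x)" by (simp add: chi_mult sum_distrib_left)
  finally have "(\<Sum>x\<in>UNIV. chi x) = chi a * (\<Sum>x\<in>UNIV. chi x)" .
  then show ?thesis using a(2) by (simp add: mult_cancel_right1)
qed

lemma sum_chi_affine:
  assumes "b \<noteq> 0"
  shows "(\<Sum>t\<in>UNIV. chi (a + t * b)) = 0"
proof -
  have "(\<Sum>t\<in>UNIV. chi (a + t * b)) = (\<Sum>x\<in>UNIV. chi x)"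
    by (rule sum.reindex_bij_witness[of _ "\<lambda>x. (x - a) / b" "\<lambda>t. a + t * b"]) (use assms in auto)
  then show ?thesis by (simp add: sum_chi)
qed

definition ker where "ker = {z. z \<noteq> 0 \<and> chi z = 1}"

definition vals where "vals = chi ` (UNIV - {0})"

lemma ker_power:
  assumes "z \<in> ker"
  shows "z ^ card ker = 1"
proof -
  have z: "z \<noteq> 0" "chi z = 1" using assms by (auto simp: ker_def)
  have "(\<Prod>y\<in>ker. z * y) = (\<Prod>y\<in>ker. y)"
    by (rule prod.reindex_bij_witness[of _ "\<lambda>y. y / z" "\<lambda>y. z * y"])
       (use z in \<open>auto simp: ker_def chi_mult chi_divide\<close>)
  then have "z ^ card ker * (\<Prod>y\<in>ker. y) = 1 * (\<Prod>y\<in>ker. y)" by (simp add: prod.distrib)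
  moreover have "(\<Prod>y\<in>ker. y) \<noteq> 0" by (auto simp: ker_def)
  ultimately show ?thesis using mult_right_cancel by blast
qed

text \<open>Turns the condition that \<open>chi z\<close> has a given value into a polynomial
  equation for \<open>z\<close>, as Stepanov's method requires.\<close>

lemma power_card_ker_eq:
  assumes "chi z = chi z'" "z' \<noteq> 0"
  shows "z ^ card ker = z' ^ card ker"
proof -
  have "chi z' \<noteq> 0" using assms(2) by (simp add: chi_eq_0_iff)
  then have "z \<noteq> 0" using assms by auto
  have "chi (z / z') = 1" using assms \<open>chi z' \<noteq> 0\<close> by (simp add: chi_divide)
  then have "z / z' \<in> ker" using \<open>z \<noteq> 0\<close> assms(2) by (simp add: ker_def)
  from ker_power[OF this] show ?thesis using assms(2) by (simp add: power_divide)
qed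

lemma finite_vals [simp]: "finite vals" by (simp add: vals_def)

lemma card_vals_mult_card_ker: "card vals * card ker = CARD('a) - 1"
proof -
  have fib: "card {z\<in>UNIV - {0}. chi z = w} = card ker" if w: "w \<in> vals" for w
  proof -
    obtain z where z: "z \<noteq> 0" "chi z = w" using w by (auto simp: vals_def)
    have cz: "chi z \<noteq> 0" using z(1) by (simp add: chi_eq_0_iff)
    have "bij_betw (\<lambda>y. z * y) ker {z\<in>UNIV - {0}. chi z = w}"
      by (rule bij_betwI[where g = "\<lambda>y. y / z"]) (use z cz in \<open>auto simp: ker_def chi_mult chi_divide\<close>)
    then show ?thesis by (simp add: bij_betw_same_card)
  qed
  have "CARD('a) - 1 = (\<Sum>z\<in>UNIV - {0 :: 'a}. 1)" by simp
  also have "\<dots> = (\<Sum>w\<in>vals. \<Sum>z\<in>{z\<in>UNIV - {0}. chi z = w}. 1)"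
    by (rule sum.group[symmetric]) (auto simp: vals_def)
  also have "\<dots> = (\<Sum>w\<in>vals. card ker)" by (intro sum.cong refl) (use fib in simp)
  finally show ?thesis by simp
qed

text \<open>Because of this relation a main term shared by all character values drops out of a power
  sum.\<close>

lemma sum_vals: "(\<Sum>w\<in>vals. w) = 0"
proof -
  obtain a where a: "a \<noteq> 0" "chi a \<noteq> 1" using nontrivial by blast
  have ca: "chi a \<noteq> 0" using a(1) by (simp add: chi_eq_0_iff)
  have "(\<Sum>w\<in>vals. chi a * w) = (\<Sum>w\<in>vals. w)"
  proof (rule sum.reindex_bij_witness[of _ "\<lambda>w. w / chi a" "\<lambda>w. chi a * w"])
    fix w assume "w \<in> vals"
    then obtain z where z: "z \<noteq> 0" "w = chi z" by (auto simp: vals_def)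
    show "chi a * w \<in> vals" using a z unfolding vals_def
      by (intro image_eqI[of _ _ "a * z"]) (auto simp: chi_mult)
    show "w / chi a \<in> vals" using a z unfolding vals_def
      by (intro image_eqI[of _ _ "z / a"]) (auto simp: chi_divide)
  qed (use ca in auto)
  then have "chi a * (\<Sum>w\<in>vals. w) = (\<Sum>w\<in>vals. w)" by (simp add: sum_distrib_left)
  then show ?thesis using a(2) by (simp add: mult_cancel_right2)
qed

end

section \<open>The L-polynomial of a product of shifted characters\<close>

lemma monics_0: "monics 0 = {1 :: 'a::comm_semiring_1 poly}"
  by (auto simp: monics_def elim!: degree_eq_zeroE)

lemma sum_monics_1:
  fixes F :: "'a::{finite,comm_ring_1} poly \<Rightarrow> complex"
  shows "(\<Sum>g\<in>monics 1. F g) = (\<Sum>u\<in>UNIV. F [:u, 1:])"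
proof (rule sum.reindex_bij_witness[of _ "\<lambda>u. [:u, 1:]" "\<lambda>g. coeff g 0"])
  fix g :: "'a poly" assume g: "g \<in> monics 1"
  show "[:coeff g 0, 1:] = g"
  proof (rule poly_eqI)
    fix n :: nat
    consider "n = 0" | "n = 1" | "n > 1" by linarith
    then show "coeff [:coeff g 0, 1:] n = coeff g n"
      using g by cases (auto simp: monics_def coeff_eq_0)
  qed
  then show "F [:coeff g 0, 1:] = F g" by simp
qed (auto simp: monics_def)

text \<open>Distinct monic primes are coprime, so their product divides \<open>G\<close>.\<close>

lemma sum_degree_le_degree:
  fixes G :: "'a::{finite_field,field_gcd} poly"
  assumes "finite \<P>" "\<P> \<subseteq> monic_primes" "\<And>P. P \<in> \<P> \<Longrightarrow> P dvd G" "G \<noteq> 0"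
  shows "(\<Sum>P\<in>\<P>. degree P) \<le> degree G"
proof -
  have "\<Prod>\<P> dvd G"
    using assms(1-3)
  proof (induction \<P>)
    case (insert P \<P>)
    have P: "prime P" using insert.prems(1) monic_primesD(6) by blast
    have "coprime P Q" if "Q \<in> \<P>" for Q
      using that insert P monic_primesD(6)[of Q] by (intro primes_coprime) auto
    then have "coprime P (\<Prod>\<P>)" by (intro prod_coprime_right) auto
    then have "P * \<Prod>\<P> dvd G" using insert by (intro divides_mult) auto
    then show ?case using insert.hyps by simp
  qed simp
  moreover have "degree (\<Prod>\<P>) = (\<Sum>P\<in>\<P>. degree P)"
    using assms(2) monic_primesD(4) by (intro degree_prod_sum_eq) auto
  ultimately show ?thesis using dvd_imp_degree_le[OF _ assms(4)] by metis
qed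

text \<open>The shift \<open>c0\<close> of exponent 1 serves twice: summing over a free value at
  \<open>c0\<close> gives 0, which cuts off the L-series, and it provides the simple zero used by
  \<open>stepanov_polynomial\<close>.\<close>

locale char_product = mult_char +
  fixes C :: "'a::{finite_field,field_gcd} set" and m :: "'a \<Rightarrow> nat" and c0 :: 'a
  assumes ch: "CHAR('a) = CARD('a)" and c0: "c0 \<in> C" and m_c0: "m c0 = 1"
    and m_pos: "c \<in> C \<Longrightarrow> m c \<ge> 1"
begin

lemma finite_C [simp]: "finite C" by (rule finite_subset[of _ UNIV]) auto

text \<open>A completely multiplicative function whose value at \<open>X + u\<close> is the summand
  at \<open>u\<close> of the character sum to be bounded.\<close>

definition \<psi> :: "'a poly \<Rightarrow> complex" where
  "\<psi> g = (\<Prod>c\<in>C. chi (poly g c) ^ m c)"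

lemma \<psi>_1: "\<psi> 1 = 1" by (simp add: \<psi>_def)

lemma \<psi>_mult: "\<psi> (f * g) = \<psi> f * \<psi> g"
  by (simp add: \<psi>_def chi_mult power_mult_distrib prod.distrib)

lemma L_coeff_0: "L_coeff \<psi> 0 = 1"
  by (simp add: L_coeff_def monics_0 \<psi>_1)

lemma L_coeff_1: "L_coeff \<psi> 1 = (\<Sum>u\<in>UNIV. \<Prod>c\<in>C. chi (u + c) ^ m c)"
  unfolding L_coeff_def sum_monics_1 by (simp add: \<psi>_def)

text \<open>The polynomial \<open>w\<close> has degree \<open>card C - 1\<close>, vanishes on
  \<open>C\<close> except at \<open>c0\<close>, and its multiples may be added to a monic
  \<open>g\<close> of degree \<open>n\<close>. This permutes the monics and changes only the value
  at \<open>c0\<close>, which runs over the whole field.\<close>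

lemma L_coeff_eq_0:
  assumes "n \<ge> card C"
  shows "L_coeff \<psi> n = 0"
proof -
  define w where "w = (\<Prod>c\<in>C - {c0}. [:-c, 1:])"
  have "degree w = (\<Sum>c\<in>C - {c0}. 1)" unfolding w_def by (subst degree_prod_sum_eq) auto
  then have deg: "degree w < n" using assms c0 card_gt_0_iff[of C] by (auto simp: card_Diff_singleton_if)
  have w0: "poly w c0 \<noteq> 0" by (auto simp: w_def poly_prod)
  have wc: "poly w c = 0" if "c \<in> C - {c0}" for c
    using that unfolding w_def poly_prod by (intro prod_zero) auto
  have in_monics: "g + smult t w \<in> monics n" if "g \<in> monics n" for g t
  proof -
    have g: "monic g" "degree g = n" using that by (auto simp: monics_def)
    have "degree (smult t w) < degree g" using deg g(2) degree_smult_le[of t w] by linarith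
    then show ?thesis using g by (simp add: monics_def degree_add_eq_left coeff_eq_0[OF deg])
  qed
  have shift: "(\<Sum>g\<in>monics n. \<psi> (g + smult t w)) = (\<Sum>g\<in>monics n. \<psi> g)" for t
  proof (rule sum.reindex_bij_witness[of _ "\<lambda>g. g - smult t w" "\<lambda>g. g + smult t w"])
    fix g :: "'a poly" assume "g \<in> monics n"
    then show "g - smult t w \<in> monics n" using in_monics[of g "- t"] by simp
  qed (auto intro: in_monics)
  have inner: "(\<Sum>t\<in>UNIV. \<psi> (g + smult t w)) = 0" for g
  proof -
    have "\<psi> (g + smult t w) = chi (poly g c0 + t * poly w c0) * (\<Prod>c\<in>C - {c0}. chi (poly g c) ^ m c)" for t
    proof -
      have "\<psi> (g + smult t w) = chi (poly (g + smult t w) c0) ^ m c0 * (\<Prod>c\<in>C - {c0}. chi (poly (g + smult t w) c) ^ m c)"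
        unfolding \<psi>_def by (rule prod.remove[OF finite_C c0])
      also have "(\<Prod>c\<in>C - {c0}. chi (poly (g + smult t w) c) ^ m c) = (\<Prod>c\<in>C - {c0}. chi (poly g c) ^ m c)"
        by (intro prod.cong refl) (simp add: wc)
      finally show ?thesis by (simp add: m_c0)
    qed
    then show ?thesis using sum_chi_affine[OF w0, of "poly g c0"] by (simp add: sum_distrib_right[symmetric])
  qed
  have "of_nat CARD('a) * L_coeff \<psi> n = (\<Sum>t\<in>(UNIV :: 'a set). \<Sum>g\<in>monics n. \<psi> (g + smult t w))"
    by (simp add: shift L_coeff_def)
  also have "\<dots> = (\<Sum>g\<in>monics n. \<Sum>t\<in>UNIV. \<psi> (g + smult t w))" by (rule sum.swap)
  also have "\<dots> = 0" by (simp add: inner)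
  finally show ?thesis by simp
qed

text \<open>Each prime has as many roots as its degree, so this is the number of elements of the
  field with \<open>q^r\<close> elements whose minimal polynomial \<open>P\<close> satisfies
  \<open>\<psi> P ^ k = w\<close>.\<close>

definition prime_weight :: "nat \<Rightarrow> complex \<Rightarrow> nat" where
  "prime_weight r w = (\<Sum>(P, k)\<in>{(P, k)\<in>prime_powers r. \<psi> P ^ k = w}. degree P)"

text \<open>The factors are \<open>c - X\<close> and not \<open>X - c\<close>, because it is
  \<open>c - x\<close> whose norm is \<open>poly P c\<close>.\<close>

definition f where "f = (\<Prod>c\<in>C. [:c, -1:] ^ m c)"

lemma f_nonzero: "f \<noteq> 0" by (simp add: f_def)

lemma order_f: "order c0 f = 1"
proof -
  have f: "f = [:c0, -1:] * (\<Prod>c\<in>C - {c0}. [:c, -1:] ^ m c)"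
    unfolding f_def by (subst prod.remove[OF finite_C c0]) (simp add: m_c0)
  have "[:c0, -1:] = smult (-1) ([:-c0, 1:] ^ 1)" by simp
  then have "order c0 [:c0, -1:] = order c0 ([:-c0, 1:] ^ 1)"
    by (simp only: order_smult neg_equal_0_iff_equal one_neq_zero not_False_eq_True)
  then have "order c0 [:c0, -1:] = 1" by (simp only: order_power_n_n)
  moreover have "order c0 (\<Prod>c\<in>C - {c0}. [:c, -1:] ^ m c) = 0"
    by (rule order_0I) (auto simp: poly_prod)
  ultimately show ?thesis
    using f_nonzero order_mult[of "[:c0, -1:]" "\<Prod>c\<in>C - {c0}. [:c, -1:] ^ m c" c0] unfolding f by simp
qed

text \<open>The exponent is \<open>(q^r - 1)/n\<close> with \<open>n = card vals\<close>: the norm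
  to the prime field followed by the power \<open>card ker = (q - 1)/n\<close>.\<close>

lemma ev_f_power:
  assumes P: "P \<in> monic_primes" "ev P x = 0" and r: "r = k * degree P"
  shows "ev f x ^ (card ker * (\<Sum>i<r. CARD('a) ^ i)) = to_ac ((\<Prod>c\<in>C. poly P c ^ (k * m c)) ^ card ker)"
proof -
  have "ev f x ^ (card ker * (\<Sum>i<r. CARD('a) ^ i)) = (\<Prod>c\<in>C. ((to_ac c - x) ^ (\<Sum>i<r. CARD('a) ^ i)) ^ m c) ^ card ker"
    by (simp add: f_def ev_prod prod_power_distrib power_mult[symmetric] mult_ac)
  also have "\<dots> = (\<Prod>c\<in>C. (to_ac (poly P c) ^ k) ^ m c) ^ card ker"
    by (simp only: r norm_power_eq[OF ch P])
  finally show ?thesis by (simp add: to_ac_prod power_mult)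
qed

lemma \<psi>_power: "\<psi> P ^ k = chi (\<Prod>c\<in>C. poly P c ^ (k * m c))"
  by (simp add: \<psi>_def chi_prod chi_power prod_power_distrib power_mult[symmetric] mult.commute)

end

lemma geometric_sum_nat:
  fixes q :: nat
  assumes "q > 0"
  shows "(q - 1) * (\<Sum>i<r. q ^ i) + 1 = q ^ r"
proof (induction r)
  case (Suc r)
  let ?S = "\<Sum>i<r. q ^ i"
  have "q = (q - 1) + 1" using assms by simp
  then have "q ^ Suc r = ((q - 1) + 1) * q ^ r" by (simp only: power_Suc)
  also have "\<dots> = (q - 1) * q ^ r + q ^ r" by (simp only: add_mult_distrib mult_1)
  also have "\<dots> = (q - 1) * q ^ r + ((q - 1) * ?S + 1)" by (simp only: Suc)
  also have "\<dots> = (q - 1) * (\<Sum>i<Suc r. q ^ i) + 1"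
    by (simp only: sum.lessThan_Suc add_mult_distrib2 add.assoc add.commute add.left_commute)
  finally show ?case ..
qed simp

section \<open>Stepanov's bound for the power sums and the Weil bound\<close>

context char_product begin

text \<open>Every prime counted has a root at which \<open>G\<close> vanishes and therefore divides
  \<open>G\<close>. No prime is counted twice, since \<open>k\<close> is determined by
  \<open>r\<close> and the degree of \<open>P\<close>.\<close>

lemma prime_weight_le_degree:
  assumes w: "w \<in> vals" and r: "r \<ge> 1" and G: "G \<noteq> 0"
    and van: "\<And>x a. x ^ (CARD('a) ^ r) = x \<Longrightarrow> chi a = w \<Longrightarrow>
      ev f x ^ (card ker * (\<Sum>i<r. CARD('a) ^ i)) = to_ac (a ^ card ker) \<Longrightarrow> ev G x = 0"
  shows "prime_weight r w \<le> degree G"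
proof -
  let ?A = "{(P, k)\<in>prime_powers r. \<psi> P ^ k = w}"
  have "P dvd G" if "(P, k) \<in> ?A" for P k
  proof -
    have P: "P \<in> monic_primes" "k \<ge> 1" "r = k * degree P" "\<psi> P ^ k = w"
      using that by (auto simp: prime_powers_def)
    obtain x where x: "ev P x = 0" using monic_prime_root[OF P(1)] .
    have "x ^ (CARD('a) ^ (j * degree P)) = x" for j
      by (induction j) (simp_all add: power_add power_mult monic_prime_conjugates(1)[OF ch P(1) x])
    then have "x ^ (CARD('a) ^ r) = x" by (simp only: P(3))
    moreover have "chi (\<Prod>c\<in>C. poly P c ^ (k * m c)) = w" using P(4) by (simp add: \<psi>_power)
    ultimately have "ev G x = 0" by (rule van) (rule ev_f_power[OF P(1) x P(3)])
    then show ?thesis by (rule monic_prime_dvd[OF P(1) x])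
  qed
  then have dvd: "P dvd G" if "P \<in> fst ` ?A" for P using that by auto
  have "inj_on fst ?A"
  proof (rule inj_onI)
    fix x y assume xy: "x \<in> ?A" "y \<in> ?A" "fst x = fst y"
    have "fst x \<in> monic_primes" "snd x * degree (fst x) = snd y * degree (fst y)"
      using xy(1,2) by (auto simp: prime_powers_def)
    then have "snd x = snd y" using monic_primesD(3)[of "fst x"] xy(3) by simp
    then show "x = y" using xy(3) by (simp add: prod_eq_iff)
  qed
  then have "prime_weight r w = (\<Sum>P\<in>fst ` ?A. degree P)"
    unfolding prime_weight_def case_prod_unfold by (simp only: sum.reindex o_def)
  also have "\<dots> \<le> degree G"
  proof (rule sum_degree_le_degree[OF _ _ dvd G])
    have "finite ?A" by (rule finite_subset[OF _ finite_prime_powers[of r]]) blast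
    then show "finite (fst ` ?A)" by simp
    show "fst ` ?A \<subseteq> monic_primes" by (auto simp: prime_powers_def)
  qed
  finally show ?thesis .
qed

text \<open>Only its independence of \<open>r\<close> matters.\<close>

definition stepanov_const :: nat where "stepanov_const = 2 * CARD('a) * (1 + degree f) + 3 + degree f"

text \<open>With \<open>s\<close> and \<open>s'\<close> close to \<open>r/2\<close>, the numbers
  \<open>h = (p^s - 1)/n\<close> and \<open>h' = (p^s' - 1)/n\<close> satisfy
  \<open>h + p^s h' = (p^r - 1)/n\<close>. The degree of the auxiliary polynomial exceeds
  \<open>p^r/n\<close>, the expected share of one of the \<open>n\<close> values, by at most a
  constant times \<open>p^(r div 2)\<close>.\<close>

lemma prime_weight_bound:
  assumes w: "w \<in> vals" and r: "r \<ge> 4"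
  shows "card vals * prime_weight r w \<le> CARD('a) ^ r + card vals * stepanov_const * CARD('a) ^ (r div 2)"
proof -
  let ?p = "CARD('a)" and ?n = "card vals" and ?m = "degree f"
  have p: "?p \<ge> 2" using CHAR_prime[where 'a = 'a] prime_ge_2_nat ch by metis
  define s' where "s' = r div 2"
  define s where "s = r - s'"
  have rs: "r = s + s'" "s \<le> Suc s'" "s' \<ge> 2" using r by (auto simp: s_def s'_def)
  define M where "M = ?p ^ s"
  define q' where "q' = ?p ^ s'"
  define h where "h = card ker * (\<Sum>i<s. ?p ^ i)"
  define h' where "h' = card ker * (\<Sum>i<s'. ?p ^ i)"
  have n: "?n \<ge> 1" using w by (metis card_gt_0_iff empty_iff finite_vals Suc_leI One_nat_def)
  have h: "?n * h + 1 = M" and h': "?n * h' + 1 = q'"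
    by (simp_all only: h_def h'_def M_def q'_def mult.assoc[symmetric] card_vals_mult_card_ker geometric_sum_nat[OF finite_UNIV_card_ge_0[OF finite]])
  have "?p ^ 2 \<le> q'" unfolding q'_def using rs(3) p by (intro power_increasing) auto
  moreover have "2 ^ 2 \<le> ?p ^ 2" using p by (intro power_mono) auto
  ultimately have q4: "q' \<ge> 4" by simp
  have h'1: "h' \<ge> 1" using h' q4 by (cases h') auto
  have Mp: "M \<le> ?p * q'" unfolding M_def q'_def
    using power_increasing[of s "Suc s'" ?p] rs(2) p by simp
  define c1 where "c1 = 2 * ?p * (1 + ?m) + 1"
  \<comment> \<open>\<open>M div ?n\<close> produces the leading term \<open>p^r/n\<close> of the
    degree. The constant \<open>c1\<close> makes the unknowns outnumber the coefficients and enters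
    only the lower-order term.\<close>
  define J where "J = M div ?n + 1 + c1"
  have nJ: "M + ?n * c1 \<le> ?n * J"
  proof -
    have "M \<le> ?n * (M div ?n) + ?n"
      using mult_div_mod_eq[of ?n M] mod_less_divisor[of ?n M] n by linarith
    then show ?thesis by (simp add: J_def algebra_simps)
  qed
  have "h' * M + (?n - 1) * h * ?m + J < ?n * J * h'"
  proof -
    have "2 \<le> q'" using q4 by simp
    \<comment> \<open>Since \<open>?n * h' = d + 1\<close>, the product \<open>?n * J * h'\<close>
      is \<open>J * d + J\<close>, and its last summand absorbs the \<open>J\<close> on the left.
      From \<open>q'\<close> being at least 4 follows \<open>q' \<le> 2 * d\<close>, which bounds
      \<open>M\<close> by a multiple of \<open>d\<close>.\<close>
    then obtain d where d: "q' = 2 + d" using le_Suc_ex by blast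
    have "?p * q' \<le> ?p * (2 * d)" using q4 d by (intro mult_le_mono2) simp
    with Mp have "M \<le> ?p * (2 * d)" by (rule le_trans)
    have "?n * (h' * M + (?n - 1) * h * ?m) < ?n * J * d"
    proof -
      have "?n * h' = d + 1" using h' d by simp
      then have e1: "?n * (h' * M) = d * M + M" by (simp only: mult.assoc[symmetric] add_mult_distrib mult_1)
      have e2: "?n * ((?n - 1) * h * ?m) \<le> ?n * (M * ?m)"
      proof -
        have "(?n - 1) * h \<le> M" using h mult_le_mono1[of "?n - 1" ?n h] by linarith
        then show ?thesis by (intro mult_le_mono2 mult_le_mono1)
      qed
      have e3: "M + ?n * (M * ?m) < ?n * c1 * d"
      proof -
        have "M \<le> ?n * M" using mult_le_mono1[OF n, of M] by (simp only: mult_1)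
        then have "M + ?n * (M * ?m) \<le> ?n * M + ?n * (M * ?m)" by (rule add_right_mono)
        also have "\<dots> = ?n * (1 + ?m) * M" by (simp add: algebra_simps)
        also have "\<dots> \<le> ?n * (1 + ?m) * (?p * (2 * d))" using \<open>M \<le> ?p * (2 * d)\<close> by (rule mult_le_mono2)
        also have "\<dots> < \<dots> + ?n * d" using n q4 d by simp
        also have "\<dots> = ?n * c1 * d" by (simp add: c1_def algebra_simps)
        finally show ?thesis .
      qed
      have "?n * (h' * M + (?n - 1) * h * ?m) \<le> d * M + (M + ?n * (M * ?m))"
        unfolding add_mult_distrib2 e1 using e2 by linarith
      also have "\<dots> < d * M + ?n * c1 * d" using e3 by (rule add_strict_left_mono)
      also have "\<dots> = (M + ?n * c1) * d" by (simp add: algebra_simps)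
      also have "\<dots> \<le> ?n * J * d" using nJ by (rule mult_le_mono1)
      finally show ?thesis .
    qed
    then have "?n * (h' * M + (?n - 1) * h * ?m) < ?n * (J * d)" by (simp only: mult.assoc[of ?n J d])
    then have 1: "h' * M + (?n - 1) * h * ?m < J * d" by (metis nat_mult_less_cancel_disj)
    have "?n * J * h' = J * (?n * h')" by (simp only: mult_ac)
    also have "?n * h' = d + 1" using h' d by simp
    finally have "?n * J * h' = J * d + J" by (simp only: add_mult_distrib2 mult_1_right)
    with 1 show ?thesis by linarith
  qed
  note cnt = this
  obtain a where a: "a \<noteq> 0" "chi a = w" using w by (auto simp: vals_def)
  obtain G where G: "G \<noteq> 0" "degree G \<le> h' + ?n * h' * ?m + J * q'"
    "\<And>x. x ^ (?p ^ (s + s')) = x \<Longrightarrow> ev f x ^ (h + ?p ^ s * h') = to_ac (a ^ card ker) \<Longrightarrow> ev G x = 0"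
    using stepanov_polynomial[OF ch f_nonzero order_f n h[unfolded M_def] h'[unfolded q'_def] h'1 cnt[unfolded M_def] power_not_zero[OF a(1)]]
    unfolding q'_def by blast
  have exp: "card ker * (\<Sum>i<r. ?p ^ i) = h + ?p ^ s * h'"
    unfolding rs(1) h_def h'_def sum_lessThan_add by (simp add: power_add sum_distrib_left algebra_simps)
  have "prime_weight r w \<le> degree G"
  proof (rule prime_weight_le_degree[OF w _ G(1)])
    fix x b assume x: "x ^ (?p ^ r) = x" "chi b = w" and e: "ev f x ^ (card ker * (\<Sum>i<r. ?p ^ i)) = to_ac (b ^ card ker)"
    have "b ^ card ker = a ^ card ker" using x(2) a by (intro power_card_ker_eq) auto
    then show "ev G x = 0" using G(3)[of x] x(1) e rs(1) exp by simp
  qed (use r in simp)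
  then have "?n * prime_weight r w \<le> ?n * (h' + ?n * h' * ?m + J * q')" using G(2) by (meson le_trans mult_le_mono2)
  also have "\<dots> \<le> ?n * (q' + q' * ?m + J * q')"
  proof -
    have "?n * h' \<le> q'" using h' by simp
    moreover have "h' \<le> q'" using h' mult_le_mono1[OF n, of h'] by linarith
    ultimately show ?thesis by (intro mult_le_mono2 add_le_mono mult_le_mono1) auto
  qed
  also have "\<dots> = ?n * (M div ?n) * q' + ?n * (2 + ?m + c1) * q'" by (simp add: J_def algebra_simps)
  also have "\<dots> \<le> M * q' + ?n * (2 + ?m + c1) * q'" by simp
  also have "2 + ?m + c1 = stepanov_const" by (simp add: stepanov_const_def c1_def)
  also have "M * q' + ?n * stepanov_const * q' = ?p ^ r + ?n * stepanov_const * q'" by (simp add: M_def q'_def rs(1) power_add)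
  finally show ?thesis by (simp add: q'_def s'_def)
qed

text \<open>If \<psi> vanishes at \<open>P ^ k\<close>, then \<open>P\<close> has a root
  \<open>c\<close> in \<open>C\<close> and is \<open>X - c\<close>. Such pairs contribute nothing to
  the power sum, and at most \<open>card C\<close> to the total weight \<open>q^r\<close>.\<close>

lemma L_powsum_eq: "r \<ge> 1 \<Longrightarrow> L_powsum \<psi> r = (\<Sum>w\<in>vals. w * of_nat (prime_weight r w))"
  and sum_prime_weight_ge: "r \<ge> 1 \<Longrightarrow> CARD('a) ^ r \<le> (\<Sum>w\<in>vals. prime_weight r w) + card C"
proof -
  assume r: "r \<ge> 1"
  let ?A = "{(P, k)\<in>prime_powers r. \<psi> P ^ k \<in> vals}" and ?B = "{(P, k)\<in>prime_powers r. \<psi> P ^ k \<notin> vals}"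
  have un: "prime_powers r = ?A \<union> ?B" "?A \<inter> ?B = {}" by auto
  have fin: "finite ?A" "finite ?B" by (rule finite_subset[OF _ finite_prime_powers[of r]]; blast)+
  have zero: "\<psi> P ^ k = 0 \<and> (P, k) \<in> (\<lambda>c. ([:-c, 1:], r)) ` C" if "(P, k) \<in> ?B" for P k
  proof -
    have P: "P \<in> monic_primes" "k \<ge> 1" "k * degree P = r" using that by (auto simp: prime_powers_def)
    let ?z = "\<Prod>c\<in>C. poly P c ^ (k * m c)"
    have "chi ?z \<notin> vals" using that by (simp add: \<psi>_power)
    then have z: "?z = 0" unfolding vals_def by blast
    then obtain c where "c \<in> C" "poly P c ^ (k * m c) = 0" using prod_zero_iff[OF finite_C] by auto
    then have c: "c \<in> C" "poly P c = 0" by auto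
    then have "[:-c, 1:] dvd P" by (simp add: poly_eq_0_iff_dvd)
    moreover have "irreducible P" using monic_primesD(2)[OF P(1)] .
    moreover have "\<not> [:-c, 1:] dvd 1" by (simp add: poly_dvd_1)
    ultimately have "P dvd [:-c, 1:]" by (metis irreducibleD')
    then have "degree P \<le> 1" using dvd_imp_degree_le[of P "[:-c, 1:]"] by simp
    then have d: "degree P = 1" using monic_primesD(3)[OF P(1)] by simp
    have "P = [:-c, 1:]"
      by (rule monic_eqI_roots[where A = "{c}" and n = 1]) (use monic_primesD(1)[OF P(1)] d c(2) in auto)
    moreover have "\<psi> P ^ k = 0" by (simp only: \<psi>_power z chi_0)
    ultimately show ?thesis using c(1) P(3) d by auto
  qed
  have group: "(\<Sum>x\<in>?A. F x) = (\<Sum>w\<in>vals. \<Sum>x\<in>{(P, k)\<in>prime_powers r. \<psi> P ^ k = w}. F x)"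
    for F :: "'a poly \<times> nat \<Rightarrow> 'b::comm_monoid_add"
  proof -
    have "(\<Sum>x\<in>?A. F x) = (\<Sum>w\<in>vals. \<Sum>x\<in>{x\<in>?A. \<psi> (fst x) ^ snd x = w}. F x)"
      by (rule sum.group[OF fin(1) finite_vals, symmetric]) auto
    also have "\<dots> = (\<Sum>w\<in>vals. \<Sum>x\<in>{(P, k)\<in>prime_powers r. \<psi> P ^ k = w}. F x)"
      by (intro sum.cong refl) auto
    finally show ?thesis .
  qed
  have "L_powsum \<psi> r = (\<Sum>(P, k)\<in>?A. of_nat (degree P) * \<psi> P ^ k) + (\<Sum>(P, k)\<in>?B. of_nat (degree P) * \<psi> P ^ k)"
    unfolding L_powsum_def by (subst un(1), rule sum.union_disjoint[OF fin un(2)])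
  also have "(\<Sum>(P, k)\<in>?B. of_nat (degree P) * \<psi> P ^ k) = 0"
  proof (rule sum.neutral, rule ballI)
    fix x assume x: "x \<in> ?B"
    then have "\<psi> (fst x) ^ snd x = 0" using zero[of "fst x" "snd x"] by simp
    then show "(case x of (P, k) \<Rightarrow> of_nat (degree P) * \<psi> P ^ k) = 0" by (simp only: case_prod_unfold mult_zero_right)
  qed
  finally show "L_powsum \<psi> r = (\<Sum>w\<in>vals. w * of_nat (prime_weight r w))"
    unfolding group
  proof (simp only: add_0_right, intro sum.cong refl)
    fix w
    let ?I = "{(P, k)\<in>prime_powers r. \<psi> P ^ k = w}"
    have "(\<Sum>(P, k)\<in>?I. of_nat (degree P) * \<psi> P ^ k) = (\<Sum>x\<in>?I. w * of_nat (degree (fst x)))"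
      by (rule sum.cong) auto
    then show "(\<Sum>(P, k)\<in>?I. of_nat (degree P) * \<psi> P ^ k) = w * of_nat (prime_weight r w)"
      by (simp only: prime_weight_def case_prod_unfold of_nat_sum sum_distrib_left)
  qed
  have "CARD('a) ^ r = (\<Sum>(P, k)\<in>?A. degree P) + (\<Sum>(P, k)\<in>?B. degree P)"
    unfolding sum_degree_prime_powers[OF r, symmetric, where 'a = 'a]
    by (subst un(1), rule sum.union_disjoint[OF fin un(2)])
  also have "(\<Sum>(P, k)\<in>?B. degree P) \<le> (\<Sum>(P, k)\<in>(\<lambda>c. ([:-c, 1:], r)) ` C. degree P)"
  proof (rule sum_mono2)
    show "?B \<subseteq> (\<lambda>c. ([:-c, 1:], r)) ` C"
    proof
      fix x assume "x \<in> ?B"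
      then show "x \<in> (\<lambda>c. ([:-c, 1:], r)) ` C" using zero[of "fst x" "snd x"] by simp
    qed
  qed simp_all
  also have "\<dots> = (\<Sum>c\<in>C. 1)" by (subst sum.reindex) (auto simp: inj_on_def)
  also have "(\<Sum>(P, k)\<in>?A. degree P) = (\<Sum>w\<in>vals. prime_weight r w)" unfolding group by (simp add: prime_weight_def)
  finally show "CARD('a) ^ r \<le> (\<Sum>w\<in>vals. prime_weight r w) + card C" by simp
qed

text \<open>Upper bounds for the single weights suffice. As the values sum to 0, the common bound
  \<open>B\<close> may be subtracted from every weight; the differences then have one sign, and
  their total is small because the sum of all weights is known from below.\<close>

lemma L_powsum_bound:
  assumes "r \<ge> 4"
  shows "cmod (L_powsum \<psi> r) \<le> real (card vals * stepanov_const + card C) * sqrt (real CARD('a)) ^ r"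
proof -
  let ?p = "real CARD('a)" and ?n = "card vals"
  define q' where "q' = ?p ^ (r div 2)"
  have p: "?p \<ge> 1" using finite_UNIV_card_ge_0[where 'a = 'a] by simp
  have n: "real ?n > 0" using nontrivial card_gt_0_iff[of vals] by (auto simp: vals_def)
  then have ne: "vals \<noteq> {}" by auto
  define B where "B = ?p ^ r / ?n + stepanov_const * q'"
  have NB: "real (prime_weight r w) \<le> B" if "w \<in> vals" for w
  proof -
    have "real (?n * prime_weight r w) \<le> real (CARD('a) ^ r + ?n * stepanov_const * CARD('a) ^ (r div 2))"
      using prime_weight_bound[OF that assms] by (simp only: of_nat_le_iff)
    then have "?n * real (prime_weight r w) \<le> ?p ^ r + ?n * stepanov_const * q'" by (simp only: q'_def of_nat_mult of_nat_add of_nat_power)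
    then have "real (prime_weight r w) \<le> (?p ^ r + ?n * stepanov_const * q') / ?n" using n by (simp only: pos_le_divide_eq mult.commute)
    also have "\<dots> = B" using ne by (simp add: B_def add_divide_distrib)
    finally show ?thesis .
  qed
  have "L_powsum \<psi> r = (\<Sum>w\<in>vals. w * of_real (real (prime_weight r w) - B))"
  proof -
    have "(\<Sum>w\<in>vals. w * of_real (real (prime_weight r w) - B)) = (\<Sum>w\<in>vals. w * of_nat (prime_weight r w) - of_real B * w)"
      by (intro sum.cong refl) (simp add: right_diff_distrib mult.commute)
    also have "\<dots> = (\<Sum>w\<in>vals. w * of_nat (prime_weight r w)) - of_real B * (\<Sum>w\<in>vals. w)"
      by (simp only: sum_subtractf sum_distrib_left)
    finally show ?thesis using assms by (simp add: L_powsum_eq sum_vals)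
  qed
  then have "cmod (L_powsum \<psi> r) \<le> (\<Sum>w\<in>vals. cmod (w * of_real (real (prime_weight r w) - B)))"
    by (metis norm_sum)
  also have "\<dots> = (\<Sum>w\<in>vals. B - real (prime_weight r w))"
  proof (intro sum.cong refl)
    fix w assume w: "w \<in> vals"
    then have "cmod w = 1" by (auto simp: vals_def intro: cmod_chi)
    then show "cmod (w * of_real (real (prime_weight r w) - B)) = B - real (prime_weight r w)"
      using NB[OF w] by (simp only: norm_mult norm_of_real mult_1_left)
  qed
  also have "\<dots> = ?n * B - real (\<Sum>w\<in>vals. prime_weight r w)" by (simp add: sum_subtractf)
  also have "\<dots> \<le> ?n * B - (?p ^ r - card C)"
  proof -
    have "real (CARD('a) ^ r) \<le> real ((\<Sum>w\<in>vals. prime_weight r w) + card C)"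
      using sum_prime_weight_ge[of r] assms by (simp only: of_nat_le_iff)
    then show ?thesis by simp
  qed
  also have "?n * B = ?p ^ r + ?n * stepanov_const * q'" using ne by (simp add: B_def distrib_left)
  also have "?p ^ r + ?n * stepanov_const * q' - (?p ^ r - card C) = ?n * stepanov_const * q' + card C * 1" by simp
  also have "\<dots> \<le> ?n * stepanov_const * sqrt ?p ^ r + card C * sqrt ?p ^ r"
  proof -
    have "q' = sqrt ?p ^ (2 * (r div 2))" using p by (simp add: q'_def power_mult)
    also have "\<dots> \<le> sqrt ?p ^ r" using p by (intro power_increasing) auto
    finally have "?n * stepanov_const * q' \<le> ?n * stepanov_const * sqrt ?p ^ r" by (rule mult_left_mono) simp
    moreover have "1 \<le> sqrt ?p ^ r" using p by (intro one_le_power) simp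
    then have "real (card C) * 1 \<le> real (card C) * sqrt ?p ^ r" by (rule mult_left_mono) simp
    ultimately show ?thesis by linarith
  qed
  also have "\<dots> = real (?n * stepanov_const + card C) * sqrt ?p ^ r" by (simp only: of_nat_add of_nat_mult distrib_right)
  finally show ?thesis .
qed

theorem weil_bound:
  "cmod (\<Sum>u\<in>UNIV. \<Prod>c\<in>C. chi (u + c) ^ m c) \<le> real (card C) * sqrt (real CARD('a))"
proof -
  let ?R = "sqrt (real CARD('a))"
  have R: "?R \<ge> 1" using finite_UNIV_card_ge_0[where 'a = 'a] by simp
  \<comment> \<open>The values \<open>r < 4\<close>, which the preceding bound leaves out, go into
    the constant.\<close>
  define B where "B = real (card vals * stepanov_const + card C) + (\<Sum>r<4. cmod (L_powsum \<psi> r))"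
  have "cmod (L_powsum \<psi> r) \<le> B * ?R ^ r" if "r \<ge> 1" for r
  proof (cases "r \<ge> 4")
    case True
    have "cmod (L_powsum \<psi> r) \<le> real (card vals * stepanov_const + card C) * ?R ^ r" by (rule L_powsum_bound[OF True])
    also have "\<dots> \<le> B * ?R ^ r" using R by (intro mult_right_mono) (auto simp: B_def intro!: sum_nonneg)
    finally show ?thesis .
  next
    case False
    then have "cmod (L_powsum \<psi> r) \<le> (\<Sum>r<4. cmod (L_powsum \<psi> r))" by (intro member_le_sum) auto
    also have "\<dots> \<le> B * 1" by (simp add: B_def)
    also have "\<dots> \<le> B * ?R ^ r" using R by (intro mult_left_mono one_le_power) (auto simp: B_def intro!: add_nonneg_nonneg sum_nonneg)
    finally show ?thesis .
  qed
  then have "cmod (L_coeff \<psi> 1) \<le> real (card C - 1) * ?R"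
    using L_coeff_0 L_coeff_eq_0 L_coeff_recurrence[of \<psi>, OF \<psi>_1 \<psi>_mult] R
    by (intro coeff_1_bound_of_powsum_bound[where A = "L_coeff \<psi>" and S = "L_powsum \<psi>" and K = B]) auto
  also have "\<dots> \<le> real (card C) * ?R" using R by (intro mult_right_mono) auto
  finally show ?thesis unfolding L_coeff_1 .
qed

end

section \<open>Moments of short character sums\<close>

context mult_char begin

lemma mult_char_cnj: "mult_char (\<lambda>x. cnj (chi x))"
proof
  show "\<exists>x. x \<noteq> 0 \<and> cnj (chi x) \<noteq> 1"
    using nontrivial by (metis complex_cnj_cnj complex_cnj_one)
qed (simp_all add: chi_mult)

lemma card_gt_2: "CARD('a) > 2"
proof -
  obtain a where a: "a \<noteq> 0" "chi a \<noteq> 1" using nontrivial by blast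
  then have "a \<noteq> 1" by auto
  then have "3 = card {0, 1, a}" using a(1) by simp
  also have "\<dots> \<le> CARD('a)" by (intro card_mono) auto
  finally show ?thesis by simp
qed

text \<open>Makes a product that mixes \<open>chi\<close> with its conjugate a product of powers of
  \<open>chi\<close>. The exponent is positive, so the identity also holds at 0.\<close>

lemma cnj_chi: "cnj (chi x) = chi x ^ (CARD('a) - 2)"
proof (cases "x = 0")
  case True
  then show ?thesis using card_gt_2 by (simp add: zero_power)
next
  case False
  have "CARD('a) - 1 = Suc (CARD('a) - 2)" using card_gt_2 by simp
  then have "chi x * chi x ^ (CARD('a) - 2) = chi (x ^ (CARD('a) - 1))"
    by (simp only: chi_power power_Suc chi_mult)
  also have "\<dots> = 1" by (simp only: finite_field_power_card_minus_1[OF False] chi_1)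
  also have "1 = chi x * cnj (chi x)"
    using cmod_chi[OF False] by (simp add: complex_norm_square[symmetric])
  finally show ?thesis using False by (simp add: chi_eq_0_iff)
qed

text \<open>The factors sharing a shift are collected into a single one, and a shift occurring only once
  provides the simple zero that \<^const>\<open>char_product\<close> asks for.\<close>

lemma shifted_product_bound:
  fixes s :: "'i \<Rightarrow> 'a" and e :: "'i \<Rightarrow> nat"
  assumes ch: "CHAR('a) = CARD('a)" and I: "finite I" "i0 \<in> I"
    and single: "\<And>i. i \<in> I \<Longrightarrow> i \<noteq> i0 \<Longrightarrow> s i \<noteq> s i0"
    and e: "\<And>i. i \<in> I \<Longrightarrow> e i \<ge> 1" "e i0 = 1"
  shows "cmod (\<Sum>u\<in>UNIV. \<Prod>i\<in>I. chi (u + s i) ^ e i) \<le> real (card I) * sqrt (real CARD('a))"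
proof -
  define m where "m = (\<lambda>c. \<Sum>i\<in>{i\<in>I. s i = c}. e i)"
  interpret char_product chi "s ` I" m "s i0"
  proof
    have "{i\<in>I. s i = s i0} = {i0}" using single I(2) by auto
    then show "m (s i0) = 1" by (simp add: m_def e(2))
    show "m c \<ge> 1" if c: "c \<in> s ` I" for c
    proof -
      obtain i where i: "i \<in> I" "s i = c" using c by blast
      have "1 \<le> e i" using e(1) i(1) by blast
      also have "\<dots> \<le> m c" unfolding m_def using I(1) i by (intro member_le_sum) auto
      finally show ?thesis .
    qed
  qed (use ch I in auto)
  have "(\<Prod>i\<in>I. chi (u + s i) ^ e i) = (\<Prod>c\<in>s ` I. chi (u + c) ^ m c)" for u
  proof -
    have "(\<Prod>i\<in>I. chi (u + s i) ^ e i) = (\<Prod>c\<in>s ` I. \<Prod>i\<in>{i\<in>I. s i = c}. chi (u + s i) ^ e i)"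
      by (rule prod.group[symmetric]) (use I in auto)
    also have "\<dots> = (\<Prod>c\<in>s ` I. chi (u + c) ^ m c)"
      by (intro prod.cong refl) (simp add: m_def power_sum)
    finally show ?thesis .
  qed
  then have "cmod (\<Sum>u\<in>UNIV. \<Prod>i\<in>I. chi (u + s i) ^ e i) \<le> real (card (s ` I)) * sqrt (real CARD('a))"
    using weil_bound by simp
  also have "\<dots> \<le> real (card I) * sqrt (real CARD('a))"
    using card_image_le[OF I(1), of s] by (intro mult_right_mono) auto
  finally show ?thesis .
qed

end

text \<open>If every value of a tuple of length \<open>2 * k\<close> is repeated, there are at most
  \<open>k\<close> values. Map each index to the least index with the same value: this map and the
  values of the tuple on its image determine the tuple.\<close>

lemma card_no_unique_value:
  assumes "k \<ge> 1"
  shows "card {f \<in> {..<2 * k} \<rightarrow>\<^sub>E {1..T}. \<forall>i<2 * k. \<exists>j<2 * k. j \<noteq> i \<and> f j = (f i :: nat)} \<le> (2 * k) ^ (2 * k) * T ^ k"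
    (is "card ?B \<le> _")
proof (cases "T = 0")
  case True
  then have "{..<2 * k} \<rightarrow>\<^sub>E {1..T} = {}" using assms by (auto simp: PiE_eq_empty_iff intro!: exI[of _ 0])
  then have "?B = {}" by blast
  then show ?thesis by (simp only: card.empty zero_le)
next
  case False
  let ?I = "{..<2 * k}"
  define \<Sigma> where "\<Sigma> = {\<sigma> \<in> ?I \<rightarrow>\<^sub>E ?I. card (\<sigma> ` ?I) \<le> k}"
  define E :: "(nat \<Rightarrow> nat) \<Rightarrow> (nat \<Rightarrow> nat) set" where "E = (\<lambda>\<sigma>. (\<lambda>v. restrict (v \<circ> \<sigma>) ?I) ` (\<sigma> ` ?I \<rightarrow>\<^sub>E {1..T}))"
  have fin\<Sigma>: "finite \<Sigma>" unfolding \<Sigma>_def by (rule finite_subset[of _ "?I \<rightarrow>\<^sub>E ?I"]) (auto intro!: finite_PiE)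
  have "?B \<subseteq> (\<Union>\<sigma>\<in>\<Sigma>. E \<sigma>)"
  proof
    fix f assume f: "f \<in> ?B"
    define \<sigma> where "\<sigma> = restrict (\<lambda>i. LEAST j. f j = f i) ?I"
    have L: "f (\<sigma> i) = f i" "\<sigma> i \<in> ?I" "\<And>j. f j = f i \<Longrightarrow> \<sigma> j = \<sigma> i \<or> j \<notin> ?I" if "i \<in> ?I" for i
    proof -
      have s: "\<sigma> i = (LEAST j. f j = f i)" using that by (simp add: \<sigma>_def)
      show "f (\<sigma> i) = f i" unfolding s by (rule LeastI) simp
      have "\<sigma> i \<le> i" unfolding s by (rule Least_le) simp
      then show "\<sigma> i \<in> ?I" using that by simp
      show "\<sigma> j = \<sigma> i \<or> j \<notin> ?I" if "f j = f i" for j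
        using that \<open>i \<in> ?I\<close> by (auto simp: \<sigma>_def)
    qed
    have "2 * card (\<sigma> ` ?I) = (\<Sum>r\<in>\<sigma> ` ?I. 2)" by simp
    also have "\<dots> \<le> (\<Sum>r\<in>\<sigma> ` ?I. card {i\<in>?I. \<sigma> i = r})"
    proof (rule sum_mono)
      fix r assume "r \<in> \<sigma> ` ?I"
      then obtain i where i: "i \<in> ?I" "r = \<sigma> i" by auto
      have "\<forall>i<2 * k. \<exists>j<2 * k. j \<noteq> i \<and> f j = f i" using f by simp
      then obtain j where j: "j \<in> ?I" "j \<noteq> i" "f j = f i" using i(1) by auto
      have "2 = card {i, j}" using j(2) by simp
      also have "\<dots> \<le> card {i\<in>?I. \<sigma> i = r}" using L(3)[OF i(1) j(3)] i j(1) by (intro card_mono) auto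
      finally show "2 \<le> card {i\<in>?I. \<sigma> i = r}" .
    qed
    also have "\<dots> = (\<Sum>r\<in>\<sigma> ` ?I. \<Sum>i\<in>{i\<in>?I. \<sigma> i = r}. 1)" by simp
    also have "\<dots> = (\<Sum>i\<in>?I. 1)" by (rule sum.group) auto
    finally have "\<sigma> \<in> \<Sigma>" using L(2) by (auto simp: \<Sigma>_def \<sigma>_def)
    moreover have "f \<in> E \<sigma>"
      unfolding E_def
    proof (rule image_eqI)
      show "restrict f (\<sigma> ` ?I) \<in> \<sigma> ` ?I \<rightarrow>\<^sub>E {1..T}" using f L(2) by (auto simp: PiE_iff)
      have fe: "f \<in> extensional ?I" using f by (auto simp: PiE_iff)
      show "f = restrict (restrict f (\<sigma> ` ?I) \<circ> \<sigma>) ?I"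
        by (rule extensionalityI[OF fe]) (use L(1) in auto)
    qed
    ultimately show "f \<in> (\<Union>\<sigma>\<in>\<Sigma>. E \<sigma>)" by blast
  qed
  moreover have "finite (E \<sigma>)" for \<sigma> unfolding E_def by (intro finite_imageI finite_PiE) auto
  ultimately have "card ?B \<le> card (\<Union>\<sigma>\<in>\<Sigma>. E \<sigma>)" using fin\<Sigma> by (intro card_mono) auto
  also have "\<dots> \<le> (\<Sum>\<sigma>\<in>\<Sigma>. card (E \<sigma>))" by (rule card_UN_le[OF fin\<Sigma>])
  also have "\<dots> \<le> (\<Sum>\<sigma>\<in>\<Sigma>. T ^ k)"
  proof (rule sum_mono)
    fix \<sigma> assume \<sigma>: "\<sigma> \<in> \<Sigma>"
    have "card (E \<sigma>) \<le> card (\<sigma> ` ?I \<rightarrow>\<^sub>E {1..T})" unfolding E_def by (intro card_image_le finite_PiE) auto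
    also have "\<dots> = T ^ card (\<sigma> ` ?I)" by (simp add: card_PiE)
    also have "\<dots> \<le> T ^ k" using \<sigma> False by (intro power_increasing) (auto simp: \<Sigma>_def)
    finally show "card (E \<sigma>) \<le> T ^ k" .
  qed
  also have "\<dots> = card \<Sigma> * T ^ k" by simp
  also have "card \<Sigma> \<le> card (?I \<rightarrow>\<^sub>E ?I)" unfolding \<Sigma>_def by (intro card_mono finite_PiE) auto
  also have "card (?I \<rightarrow>\<^sub>E ?I) = (2 * k) ^ (2 * k)" by (simp add: card_PiE)
  finally show ?thesis by simp
qed

context mult_char begin

text \<open>Expanding the power gives one complete sum per tuple. The few tuples in which every
  value repeats are estimated trivially by \<open>p\<close>; any other tuple has an unshared value
  and falls under the Weil bound.\<close>

lemma moment_bound: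
  assumes ch: "CHAR('a) = CARD('a)" and T: "T < CARD('a)" and k: "k \<ge> 1"
  shows "(\<Sum>u\<in>UNIV. cmod (\<Sum>t=1..T. chi (u + of_nat t)) ^ (2 * k))
    \<le> real ((2 * k) ^ (2 * k) * T ^ k) * real CARD('a) + real (T ^ (2 * k)) * (real (2 * k) * sqrt (real CARD('a)))"
proof -
  let ?I = "{..<2 * k}" and ?p = "real CARD('a)"
  define F where "F = ?I \<rightarrow>\<^sub>E {1..T}"
  define B where "B = {f \<in> F. \<forall>i<2 * k. \<exists>j<2 * k. j \<noteq> i \<and> f j = f i}"
  define w where "w = (\<lambda>i z. if i < k then chi z else cnj (chi z))"
  define S where "S = (\<lambda>f. \<Sum>u\<in>UNIV. \<Prod>i\<in>?I. w i (u + of_nat (f i)))"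
  have finF: "finite F" unfolding F_def by (intro finite_PiE) auto
  have BF: "B \<subseteq> F" by (auto simp: B_def)
  have expand: "of_real (cmod (\<Sum>t=1..T. chi (u + of_nat t)) ^ (2 * k)) = (\<Sum>f\<in>F. \<Prod>i\<in>?I. w i (u + of_nat (f i)))" for u
  proof -
    let ?z = "\<Sum>t=1..T. chi (u + of_nat t)"
    have "(\<Sum>f\<in>F. \<Prod>i\<in>?I. w i (u + of_nat (f i))) = (\<Prod>i\<in>?I. \<Sum>t=1..T. w i (u + of_nat t))"
      unfolding F_def by (rule prod_sum_PiE[symmetric]) auto
    also have "\<dots> = (\<Prod>i\<in>?I. if i < k then ?z else cnj ?z)"
      by (intro prod.cong refl) (simp add: w_def)
    also have "\<dots> = (\<Prod>i\<in>{..<k}. if i < k then ?z else cnj ?z) * (\<Prod>i\<in>{k..<2 * k}. if i < k then ?z else cnj ?z)"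
    proof -
      have I: "?I = {..<k} \<union> {k..<2 * k}" and D: "{..<k} \<inter> {k..<2 * k} = {}" by auto
      show ?thesis unfolding I by (rule prod.union_disjoint[OF finite_lessThan finite_atLeastLessThan D])
    qed
    also have "\<dots> = (\<Prod>i\<in>{..<k}. ?z) * (\<Prod>i\<in>{k..<2 * k}. cnj ?z)"
      by (intro arg_cong2[of _ _ _ _ "(*)"] prod.cong) auto
    also have "\<dots> = (?z * cnj ?z) ^ k" by (simp only: prod_constant card_lessThan card_atLeastLessThan power_mult_distrib mult_2 add_diff_cancel_left')
    also have "\<dots> = of_real (cmod ?z ^ (2 * k))"
      by (simp only: complex_norm_square[symmetric] power_mult of_real_power)
    finally show ?thesis ..
  qed
  have S_triv: "cmod (S f) \<le> ?p" for f
  proof -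
    have "cmod (S f) \<le> (\<Sum>u\<in>(UNIV :: 'a set). 1)"
      unfolding S_def
    proof (rule sum_norm_le)
      fix u :: 'a
      have "cmod (w i z) \<le> 1" for i z by (simp add: w_def cmod_chi_le)
      then show "cmod (\<Prod>i\<in>?I. w i (u + of_nat (f i))) \<le> 1"
        unfolding prod_norm[symmetric] by (intro prod_le_1) auto
    qed
    then show ?thesis by simp
  qed
  have S_weil: "cmod (S f) \<le> real (2 * k) * sqrt ?p" if f: "f \<in> F - B" for f
  proof -
    obtain i0 where i0: "i0 < 2 * k" "\<And>j. j < 2 * k \<Longrightarrow> j \<noteq> i0 \<Longrightarrow> f j \<noteq> f i0"
      using f by (auto simp: B_def)
    have fT: "f i \<in> {1..T}" if "i < 2 * k" for i
    proof -
      have "f \<in> ?I \<rightarrow>\<^sub>E {1..T}" using f unfolding F_def by blast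
      then show ?thesis by (rule PiE_mem) (simp add: that)
    qed
    \<comment> \<open>By \<open>T < CARD('a)\<close>, distinct integers up to \<open>T\<close>
      remain distinct in the field.\<close>
    have ne: "(of_nat (f j) :: 'a) \<noteq> of_nat (f i0)" if "j \<in> ?I" "j \<noteq> i0" for j
    proof
      assume "(of_nat (f j) :: 'a) = of_nat (f i0)"
      then have "[f j = f i0] (mod CHAR('a))" by (rule of_nat_eq_iff_cong_CHAR[THEN iffD1])
      then have "[f j = f i0] (mod CARD('a))" unfolding ch .
      moreover have "f j < CARD('a)" "f i0 < CARD('a)" using fT[of j] fT[of i0] T that(1) i0(1) by auto
      ultimately have "f j = f i0" by (simp add: cong_def)
      then show False using i0(2) that by simp
    qed
    \<comment> \<open>Exponent 1 on the half that contains the unshared index \<open>i0\<close>, and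
      the exponent of a conjugate on the other half. If \<open>i0\<close> lies in the second half,
      \<open>chi\<close> and its conjugate exchange roles.\<close>
    define e where "e = (\<lambda>i. if (i < k) = (i0 < k) then 1 else CARD('a) - 2)"
    have "CARD('a) - 2 \<ge> 1" using card_gt_2 by linarith
    then have e: "e i \<ge> 1" for i by (simp only: e_def split: if_split) simp
    show ?thesis
    proof (cases "i0 < k")
      case True
      have "w i z = chi z ^ e i" for i z using True by (simp add: w_def e_def cnj_chi)
      then have "S f = (\<Sum>u\<in>UNIV. \<Prod>i\<in>?I. chi (u + of_nat (f i)) ^ e i)" by (simp add: S_def)
      then show ?thesis
        using shifted_product_bound[OF ch, of ?I i0 "\<lambda>i. of_nat (f i)" e] i0(1) ne e by (simp add: e_def)
    next
      case False
      interpret c: mult_char "\<lambda>x. cnj (chi x)" by (rule mult_char_cnj)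
      have "w i z = cnj (chi z) ^ e i" for i z
        using False c.cnj_chi[of z] by (simp add: w_def e_def)
      then have "S f = (\<Sum>u\<in>UNIV. \<Prod>i\<in>?I. cnj (chi (u + of_nat (f i))) ^ e i)" by (simp add: S_def)
      then show ?thesis
        using c.shifted_product_bound[OF ch, of ?I i0 "\<lambda>i. of_nat (f i)" e] i0(1) ne e by (simp add: e_def)
    qed
  qed
  have "complex_of_real (\<Sum>u\<in>UNIV. cmod (\<Sum>t=1..T. chi (u + of_nat t)) ^ (2 * k)) = (\<Sum>f\<in>F. S f)"
    unfolding of_real_sum expand S_def by (rule sum.swap)
  then have "(\<Sum>u\<in>UNIV. cmod (\<Sum>t=1..T. chi (u + of_nat t)) ^ (2 * k)) = cmod (\<Sum>f\<in>F. S f)"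
    by (simp only: flip: \<open>_ = (\<Sum>f\<in>F. S f)\<close>) (simp only: norm_of_real abs_of_nonneg sum_nonneg zero_le_power norm_ge_zero)
  also have "\<dots> \<le> (\<Sum>f\<in>F. cmod (S f))" by (rule norm_sum)
  also have "\<dots> = (\<Sum>f\<in>B. cmod (S f)) + (\<Sum>f\<in>F - B. cmod (S f))"
    using sum.subset_diff[OF BF finF, of "\<lambda>f. cmod (S f)"] by simp
  also have "\<dots> \<le> (\<Sum>f\<in>B. ?p) + (\<Sum>f\<in>F - B. real (2 * k) * sqrt ?p)"
    by (intro add_mono sum_mono S_triv S_weil)
  also have "\<dots> = real (card B) * ?p + real (card (F - B)) * (real (2 * k) * sqrt ?p)" by simp
  also have "\<dots> \<le> real ((2 * k) ^ (2 * k) * T ^ k) * ?p + real (T ^ (2 * k)) * (real (2 * k) * sqrt ?p)"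
  proof (intro add_mono mult_right_mono)
    show "real (card B) \<le> real ((2 * k) ^ (2 * k) * T ^ k)"
      using card_no_unique_value[OF k, of T] unfolding B_def F_def by (simp only: of_nat_le_iff)
    have "card (F - B) \<le> card F" using finF by (intro card_mono) auto
    also have "card F = T ^ (2 * k)" unfolding F_def by (simp add: card_PiE)
    finally show "real (card (F - B)) \<le> real (T ^ (2 * k))" by (simp only: of_nat_le_iff)
  qed auto
  finally show ?thesis .
qed

end

section \<open>Multiplicative energy of sets with small doubling\<close>

text \<open>Take \<open>F\<close> maximal with disjoint translates \<open>y + I\<close>;
  disjointness is the injectivity of addition on the product of \<open>F\<close> and
  \<open>I\<close>. By maximality every translate \<open>x + I\<close> meets one of them.\<close>

lemma ruzsa_covering:
  fixes U I :: "'a::ab_group_add set"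
  assumes fin: "finite U" "finite I" and ne: "I \<noteq> {}"
  obtains F where "F \<subseteq> U" "card F * card I \<le> card {x + i |x i. x \<in> U \<and> i \<in> I}"
    "\<forall>x\<in>U. \<exists>y\<in>F. \<exists>i\<in>I. \<exists>j\<in>I. x = y + (i - j)"
proof -
  define \<F> where "\<F> = {F. F \<subseteq> U \<and> inj_on (\<lambda>(x, i). x + i) (F \<times> I)}"
  have "finite \<F>" unfolding \<F>_def by (rule finite_subset[of _ "Pow U"]) (use fin in auto)
  moreover have "{} \<in> \<F>" by (simp add: \<F>_def)
  ultimately obtain F where F: "F \<in> \<F>" "\<And>G. G \<in> \<F> \<Longrightarrow> F \<subseteq> G \<Longrightarrow> F = G"
    using finite_has_maximal[of \<F>] by blast
  have FX: "F \<subseteq> U" and inj: "inj_on (\<lambda>(x, i). x + i) (F \<times> I)" using F(1) by (auto simp: \<F>_def)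
  have "finite {x + i |x i. x \<in> U \<and> i \<in> I}"
    using fin by (intro finite_image_set2) auto
  then have "card ((\<lambda>(x, i). x + i) ` (F \<times> I)) \<le> card {x + i |x i. x \<in> U \<and> i \<in> I}"
    by (rule card_mono) (use FX in auto)
  then have "card F * card I \<le> card {x + i |x i. x \<in> U \<and> i \<in> I}"
    using card_image[OF inj] by (simp add: card_cartesian_product)
  moreover have "\<exists>y\<in>F. \<exists>i\<in>I. \<exists>j\<in>I. x = y + (i - j)" if x: "x \<in> U" for x
  proof (cases "x \<in> F")
    case True
    obtain i where "i \<in> I" using ne by blast
    then show ?thesis using True by (intro bexI[of _ x] bexI[of _ i]) auto
  next
    case False
    have "insert x F \<notin> \<F>" using F(2)[of "insert x F"] False by auto
    then have "\<not> inj_on (\<lambda>(x, i). x + i) (insert x F \<times> I)" using x FX by (simp add: \<F>_def)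
    then obtain y i z j where h: "y \<in> insert x F" "z \<in> insert x F" "i \<in> I" "j \<in> I" "y + i = z + j" "(y, i) \<noteq> (z, j)"
      unfolding inj_on_def by auto
    have "\<not> (y \<in> F \<and> z \<in> F)"
    proof
      assume "y \<in> F \<and> z \<in> F"
      then have "(y, i) = (z, j)" using inj_onD[OF inj, of "(y, i)" "(z, j)"] h by simp
      with h(6) show False by simp
    qed
    then consider "y = x" "z = x" | "y = x" "z \<in> F" | "z = x" "y \<in> F" using h(1,2) by blast
    then show ?thesis
    proof cases
      case 1
      then show ?thesis using h by simp
    next
      case 2
      then have "x = z + (j - i)" using h(5) by (simp add: algebra_simps)
      then show ?thesis using 2 h by blast
    next
      case 3
      then have "x = y + (i - j)" using h(5) by (simp add: algebra_simps)
      then show ?thesis using 3 h by blast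
    qed
  qed
  ultimately show ?thesis using that FX by blast
qed

text \<open>Cauchy-Schwarz for the fibre sizes of \<open>f\<close>.\<close>

lemma card_image_ge_square_div_collisions:
  assumes fin: "finite S"
  shows "card S ^ 2 \<le> card (f ` S) * card {(s, t). s \<in> S \<and> t \<in> S \<and> f s = f t}"
proof -
  let ?n = "\<lambda>z. card {s\<in>S. f s = z}"
  have "card S = (\<Sum>z\<in>f ` S. ?n z)"
    using sum.group[of S "f ` S" f "\<lambda>_. 1 :: nat"] fin by simp
  then have "real (card S) ^ 2 = (\<Sum>z\<in>f ` S. 1 * real (?n z))\<^sup>2" by simp
  also have "\<dots> \<le> (\<Sum>z\<in>f ` S. 1\<^sup>2) * (\<Sum>z\<in>f ` S. (real (?n z))\<^sup>2)"
    by (rule Cauchy_Schwarz_ineq_sum)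
  also have "(\<Sum>z\<in>f ` S. (real (?n z))\<^sup>2) = real (\<Sum>z\<in>f ` S. ?n z ^ 2)" by simp
  also have "(\<Sum>z\<in>f ` S. ?n z ^ 2) = (\<Sum>z\<in>f ` S. card ({s\<in>S. f s = z} \<times> {s\<in>S. f s = z}))"
    by (simp add: card_cartesian_product power2_eq_square)
  also have "\<dots> = card (\<Union>z\<in>f ` S. {s\<in>S. f s = z} \<times> {s\<in>S. f s = z})"
    by (rule card_UN_disjoint[symmetric]) (use fin in auto)
  also have "(\<Union>z\<in>f ` S. {s\<in>S. f s = z} \<times> {s\<in>S. f s = z}) = {(s, t). s \<in> S \<and> t \<in> S \<and> f s = f t}"
    by auto
  finally have "real (card S ^ 2) \<le> real (card (f ` S) * card {(s, t). s \<in> S \<and> t \<in> S \<and> f s = f t})"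
    by simp
  then show ?thesis by (simp only: of_nat_le_iff)
qed

text \<open>Averaging over \<open>\<xi>\<close>: the diagonal contributes \<open>card A ^ 2\<close>
  collisions for each \<open>\<xi>\<close>, and a collision with distinct second coordinates
  determines \<open>\<xi>\<close>. For a \<open>\<xi>\<close> with at most the average number of
  collisions the image is large.\<close>

lemma exists_large_dilate_sum:
  fixes A :: "'a::{finite,field} set"
  shows "\<exists>\<xi>. min (real (card A ^ 2)) (real CARD('a)) \<le> 2 * real (card ((\<lambda>(x, y). x + \<xi> * y) ` (A \<times> A)))"
proof -
  let ?p = "CARD('a)" and ?n = "card A"
  define c where "c = (\<lambda>\<xi>. card {(s, t). s \<in> A \<times> A \<and> t \<in> A \<times> A \<and> (case s of (x, y) \<Rightarrow> x + \<xi> * y) = (case t of (x, y) \<Rightarrow> x + \<xi> * y)})"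
  have "(\<Sum>\<xi>\<in>UNIV. c \<xi>) \<le> ?p * ?n ^ 2 + ?n ^ 4"
  proof -
    have c_le: "c \<xi> \<le> ?n ^ 2 + card {(x, y, x', y'). x \<in> A \<and> y \<in> A \<and> x' \<in> A \<and> y' \<in> A \<and> y \<noteq> y' \<and> \<xi> = (x - x') / (y' - y)}" (is "_ \<le> _ + card (?R \<xi>)") for \<xi>
    proof -
      let ?S = "{(s, t). s \<in> A \<times> A \<and> t \<in> A \<times> A \<and> (case s of (x, y) \<Rightarrow> x + \<xi> * y) = (case t of (x, y) \<Rightarrow> x + \<xi> * y)}"
      let ?h = "\<lambda>(x, y, x', y'). ((x, y), (x', y'))"
      have "?S \<subseteq> (\<lambda>s. (s, s)) ` (A \<times> A) \<union> ?h ` ?R \<xi>"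
      proof
        fix z assume "z \<in> ?S"
        then obtain x y x' y' where z: "z = ((x, y), (x', y'))" "x \<in> A" "y \<in> A" "x' \<in> A" "y' \<in> A" "x + \<xi> * y = x' + \<xi> * y'"
          by auto
        show "z \<in> (\<lambda>s. (s, s)) ` (A \<times> A) \<union> ?h ` ?R \<xi>"
        proof (cases "y = y'")
          case True
          then show ?thesis using z by auto
        next
          case False
          have "x - x' = \<xi> * (y' - y)" using z(6) by (simp add: algebra_simps)
          then have "\<xi> = (x - x') / (y' - y)" using False by simp
          then have "(x, y, x', y') \<in> ?R \<xi>" using z False by blast
          then show ?thesis using z(1) by (intro UnI2 image_eqI[of _ _ "(x, y, x', y')"]) auto
        qed
      qed
      then have "c \<xi> \<le> card ((\<lambda>s. (s, s)) ` (A \<times> A) \<union> ?h ` ?R \<xi>)"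
        unfolding c_def by (intro card_mono) auto
      also have "\<dots> \<le> card ((\<lambda>s. (s, s)) ` (A \<times> A)) + card (?h ` ?R \<xi>)" by (rule card_Un_le)
      also have "\<dots> \<le> card (A \<times> A) + card (?R \<xi>)" by (intro add_mono card_image_le) auto
      finally show ?thesis by (simp add: card_cartesian_product power2_eq_square)
    qed
    have "(\<Sum>\<xi>\<in>UNIV. c \<xi>) \<le> (\<Sum>\<xi>\<in>(UNIV :: 'a set). ?n ^ 2 + card (?R \<xi>))" by (rule sum_mono) (rule c_le)
    also have "\<dots> = ?p * ?n ^ 2 + (\<Sum>\<xi>\<in>UNIV. card (?R \<xi>))" by (simp add: sum.distrib)
    also have "(\<Sum>\<xi>\<in>UNIV. card (?R \<xi>)) = card (\<Union>\<xi>\<in>UNIV. ?R \<xi>)"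
      by (rule card_UN_disjoint[symmetric]) auto
    also have "\<dots> \<le> card (A \<times> A \<times> A \<times> A)" by (intro card_mono) auto
    also have "\<dots> = ?n ^ 4" by (simp add: card_cartesian_product power4_eq_xxxx)
    finally show ?thesis by simp
  qed
  moreover have "\<exists>\<xi>. ?p * c \<xi> \<le> (\<Sum>\<xi>\<in>UNIV. c \<xi>)"
  proof (rule ccontr)
    assume "\<nexists>\<xi>. ?p * c \<xi> \<le> (\<Sum>\<xi>\<in>UNIV. c \<xi>)"
    then have "(\<Sum>\<eta>\<in>(UNIV :: 'a set). \<Sum>\<xi>\<in>UNIV. c \<xi>) < (\<Sum>\<eta>\<in>UNIV. ?p * c \<eta>)"
      by (intro sum_strict_mono) (auto simp: not_le)
    then show False by (simp add: sum_distrib_left[symmetric])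
  qed
  ultimately obtain \<xi> where \<xi>: "?p * c \<xi> \<le> ?p * ?n ^ 2 + ?n ^ 4" using le_trans by blast
  let ?m = "card ((\<lambda>(x, y). x + \<xi> * y) ` (A \<times> A))"
  have "(?n ^ 2) ^ 2 \<le> ?m * c \<xi>"
    using card_image_ge_square_div_collisions[of "A \<times> A" "\<lambda>(x, y). x + \<xi> * y"]
    by (simp add: c_def card_cartesian_product power2_eq_square)
  then have "?p * (?n ^ 2) ^ 2 \<le> ?p * (?m * c \<xi>)" by (rule mult_le_mono2)
  also have "\<dots> = ?m * (?p * c \<xi>)" by (simp only: mult.left_commute)
  also have "\<dots> \<le> ?m * (?p * ?n ^ 2 + ?n ^ 4)" using \<xi> by (rule mult_le_mono2)
  finally have le: "?p * ?n ^ 2 * ?n ^ 2 \<le> ?m * (?p + ?n ^ 2) * ?n ^ 2"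
    by (simp add: algebra_simps power_add[symmetric] power_mult[symmetric])
  have "min (real (?n ^ 2)) (real ?p) \<le> 2 * real ?m"
  proof (cases "?n = 0")
    case False
    then have "?p * ?n ^ 2 \<le> ?m * (?p + ?n ^ 2)" using le by (metis mult_le_cancel2 zero_less_power neq0_conv)
    then have le': "real ?p * real (?n ^ 2) \<le> real ?m * (real ?p + real (?n ^ 2))"
      by (simp only: of_nat_mult[symmetric] of_nat_add[symmetric] of_nat_le_iff)
    have p0: "real ?p > 0" and n0: "real (?n ^ 2) > 0" using False finite_UNIV_card_ge_0[where 'a = 'a] by simp_all
    show ?thesis
    proof (cases "real (?n ^ 2) \<le> real ?p")
      case True
      have "real ?m * (real ?p + real (?n ^ 2)) \<le> real ?m * (2 * real ?p)" using True by (intro mult_left_mono) auto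
      with le' have "real ?p * real (?n ^ 2) \<le> real ?m * (2 * real ?p)" by (rule order_trans)
      also have "\<dots> = real ?p * (2 * real ?m)" by simp
      finally show ?thesis using p0 by (simp only: mult_le_cancel_left_pos min_le_iff_disj) simp
    next
      case False
      have "real ?m * (real ?p + real (?n ^ 2)) \<le> real ?m * (2 * real (?n ^ 2))" using False by (intro mult_left_mono) auto
      with le' have "real ?p * real (?n ^ 2) \<le> real ?m * (2 * real (?n ^ 2))" by (rule order_trans)
      then have "real (?n ^ 2) * real ?p \<le> real (?n ^ 2) * (2 * real ?m)" by (simp only: mult_ac)
      then show ?thesis using n0 by (simp only: mult_le_cancel_left_pos min_le_iff_disj) simp
    qed
  qed simp
  then show ?thesis by blast
qed

text \<open>If the set of quotients of differences is not closed under adding \<open>1\<close>, then some \<open>\<xi>\<close> outside it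
  makes \<open>(x, y) \<mapsto> x + \<xi> y\<close> injective; if it is closed, it is the whole prime field.\<close>

lemma pivot:
  fixes A :: "'a::{finite_field} set"
  assumes ch: "CHAR('a) = CARD('a)" and A: "card A \<ge> 2"
  obtains a b c d where "a \<in> A" "b \<in> A" "c \<in> A" "d \<in> A" "c \<noteq> d"
    "min (real (card A ^ 2)) (real CARD('a))
      \<le> 2 * real (card ((\<lambda>(x, y). x + ((a - b) + (c - d)) / (c - d) * y) ` (A \<times> A)))"
proof -
  define Q where "Q = {(a - b) / (c - d) |a b c d. a \<in> A \<and> b \<in> A \<and> c \<in> A \<and> d \<in> A \<and> c \<noteq> d}"
  have "\<exists>\<xi>. \<xi> \<in> Q \<and> min (real (card A ^ 2)) (real CARD('a)) \<le> 2 * real (card ((\<lambda>(x, y). x + (\<xi> + 1) * y) ` (A \<times> A)))"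
  proof (cases "\<exists>\<xi>\<in>Q. \<xi> + 1 \<notin> Q")
    case True
    then obtain \<xi> where \<xi>: "\<xi> \<in> Q" "\<xi> + 1 \<notin> Q" by blast
    have "inj_on (\<lambda>(x, y). x + (\<xi> + 1) * y) (A \<times> A)"
    proof (rule inj_onI, clarify)
      fix x y x' y' assume h: "x \<in> A" "y \<in> A" "x' \<in> A" "y' \<in> A" "x + (\<xi> + 1) * y = x' + (\<xi> + 1) * y'"
      have "y = y'"
      proof (rule ccontr)
        assume ne: "y \<noteq> y'"
        have "(\<xi> + 1) * (y' - y) = x - x'" using h(5) by (simp add: algebra_simps)
        then have "\<xi> + 1 = (x - x') / (y' - y)" using ne by (metis eq_iff_diff_eq_0 nonzero_eq_divide_eq)
        then show False using \<xi>(2) h ne unfolding Q_def by blast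
      qed
      then show "x = x' \<and> y = y'" using h(5) by simp
    qed
    then have "card ((\<lambda>(x, y). x + (\<xi> + 1) * y) ` (A \<times> A)) = card A ^ 2"
      by (simp add: card_image card_cartesian_product power2_eq_square)
    moreover have "min (real (card A ^ 2)) (real CARD('a)) \<le> 2 * real (card A ^ 2)" by (simp add: min.coboundedI1)
    ultimately show ?thesis using \<xi>(1) by metis
  next
    case False
    obtain c d where cd: "c \<in> A" "d \<in> A" "c \<noteq> d"
      using A card_le_Suc0_iff_eq[of A] by (auto simp: numeral_2_eq_2 not_less_eq_eq)
    then have "0 \<in> Q" unfolding Q_def by (intro CollectI exI[of _ c] exI[of _ d] conjI) auto
    then have nat: "of_nat n \<in> Q" for n
      using False by (induction n) (auto simp: add.commute)
    have "inj_on (of_nat :: nat \<Rightarrow> 'a) {..<CARD('a)}"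
    proof (rule inj_onI)
      fix i j assume ij: "i \<in> {..<CARD('a)}" "j \<in> {..<CARD('a)}" "(of_nat i :: 'a) = of_nat j"
      then have "[i = j] (mod CHAR('a))" by (simp only: of_nat_eq_iff_cong_CHAR)
      then show "i = j" using ij(1,2) unfolding ch by (simp add: cong_def)
    qed
    then have "card ((of_nat :: nat \<Rightarrow> 'a) ` {..<CARD('a)}) = CARD('a)" by (simp add: card_image)
    then have "(of_nat :: nat \<Rightarrow> 'a) ` {..<CARD('a)} = UNIV" by (intro card_subset_eq) auto
    then have Q: "\<xi> \<in> Q" for \<xi> using nat by (metis UNIV_I imageE)
    obtain \<xi> where "min (real (card A ^ 2)) (real CARD('a)) \<le> 2 * real (card ((\<lambda>(x, y). x + \<xi> * y) ` (A \<times> A)))"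
      using exists_large_dilate_sum by blast
    then show ?thesis using Q[of "\<xi> - 1"] by (intro exI[of _ "\<xi> - 1"]) simp
  qed
  then obtain \<xi> where \<xi>: "\<xi> \<in> Q" "min (real (card A ^ 2)) (real CARD('a)) \<le> 2 * real (card ((\<lambda>(x, y). x + (\<xi> + 1) * y) ` (A \<times> A)))"
    by blast
  then obtain a b c d where abcd: "a \<in> A" "b \<in> A" "c \<in> A" "d \<in> A" "c \<noteq> d" "\<xi> = (a - b) / (c - d)"
    unfolding Q_def by blast
  have "\<xi> + 1 = ((a - b) + (c - d)) / (c - d)" using abcd(5) unfolding abcd(6) by (subst add_divide_distrib) simp
  then show ?thesis using that[OF abcd(1-5)] \<xi>(2) by simp
qed

text \<open>The intermediate bound \<open>4 n s / (s + n)\<close> is chosen for its increments,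
  which are \<open>4 s^2 / ((s + x) (s + x - 1))\<close> with \<open>x = n + 1\<close> and dominate
  the summands.\<close>

lemma sum_min_inverse_squares:
  fixes s :: real
  assumes "s > 0"
  shows "(\<Sum>D=1..n. min 1 (s\<^sup>2 / (real D)\<^sup>2)) \<le> 4 * s"
proof -
  have "(\<Sum>D=1..n. min 1 (s\<^sup>2 / (real D)\<^sup>2)) \<le> 4 * real n * s / (s + real n)"
  proof (induction n)
    case (Suc n)
    define x where "x = real n + 1"
    have x: "x \<ge> 1" by (simp add: x_def)
    have "min 1 (s\<^sup>2 / x\<^sup>2) \<le> 4 * s\<^sup>2 / (s + x)\<^sup>2"
    proof (cases "s \<le> x")
      case True
      have "s\<^sup>2 / x\<^sup>2 = 4 * s\<^sup>2 / (2 * x)\<^sup>2" by (simp add: power_mult_distrib)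
      also have "\<dots> \<le> 4 * s\<^sup>2 / (s + x)\<^sup>2"
        using True assms x by (intro divide_left_mono power_mono mult_pos_pos zero_less_power) auto
      finally show ?thesis by simp
    next
      case False
      have "1 = 4 * s\<^sup>2 / (2 * s)\<^sup>2" using assms by (simp add: power_mult_distrib)
      also have "\<dots> \<le> 4 * s\<^sup>2 / (s + x)\<^sup>2"
        using False assms x by (intro divide_left_mono power_mono mult_pos_pos zero_less_power) auto
      finally show ?thesis by simp
    qed
    also have "\<dots> \<le> 4 * s\<^sup>2 / ((s + x) * (s + x - 1))"
      using assms x by (intro divide_left_mono mult_pos_pos) (auto simp: power2_eq_square)
    also have "\<dots> = 4 * x * s / (s + x) - 4 * (x - 1) * s / (s + (x - 1))"
      using assms x by (simp add: divide_simps power2_eq_square) (simp add: algebra_simps)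
    finally have "min 1 (s\<^sup>2 / (real (Suc n))\<^sup>2) \<le> 4 * real (Suc n) * s / (s + real (Suc n)) - 4 * real n * s / (s + real n)"
      by (simp add: x_def add.commute)
    then show ?case using Suc by simp
  qed simp
  also have "\<dots> \<le> 4 * s" using assms by (simp add: divide_simps)
  finally show ?thesis .
qed

section \<open>The sum-product argument for sets of small doubling\<close>

definition mult_energy :: "'a::field set \<Rightarrow> nat" where
  "mult_energy A = card {(a, b, x, y). a \<in> A - {0} \<and> b \<in> A - {0} \<and> x \<in> A - {0} \<and> y \<in> A - {0} \<and> a * x = b * y}"

text \<open>The sets \<open>A2\<close>, \<open>A4\<close> and \<open>A8\<close> may be any sets
  containing the successive sumsets: for Bohr sets they will be the Bohr sets of 2, 4 and 8 times
  the radius.\<close>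

locale small_doubling =
  fixes A A2 A4 A8 :: "'a::{finite_field} set" and Kc :: real
  assumes ch: "CHAR('a) = CARD('a)"
    and zero: "0 \<in> A" and sym: "x \<in> A \<Longrightarrow> - x \<in> A"
    and add1: "x \<in> A \<Longrightarrow> y \<in> A \<Longrightarrow> x + y \<in> A2"
    and add2: "x \<in> A2 \<Longrightarrow> y \<in> A2 \<Longrightarrow> x + y \<in> A4"
    and add4: "x \<in> A4 \<Longrightarrow> y \<in> A4 \<Longrightarrow> x + y \<in> A8"
    and card_A8: "real (card A8) \<le> Kc * real (card A)"
begin

lemma subsets: "A \<subseteq> A2" "A2 \<subseteq> A4" "A4 \<subseteq> A8"
proof -
  show 1: "A \<subseteq> A2" using add1[OF _ zero] by auto
  have "0 \<in> A2" using 1 zero by auto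
  then show 2: "A2 \<subseteq> A4" using add2 by fastforce
  then have "0 \<in> A4" using \<open>0 \<in> A2\<close> by auto
  then show "A4 \<subseteq> A8" using add4 by fastforce
qed

text \<open>For \<open>a \<noteq> 0\<close> this is the intersection of \<open>A - {0}\<close> with
  its dilate by \<open>b/a\<close>; the energy is the sum of the sizes of these sets.\<close>

definition common :: "'a \<Rightarrow> 'a \<Rightarrow> 'a set" where
  "common b a = {x \<in> A - {0}. \<exists>y\<in>A - {0}. a * x = b * y}"

text \<open>Ruzsa's covering with \<open>I\<close> the dilate of \<open>common b a\<close> by
  \<open>a\<close>. This set lies in both \<open>a A\<close> and \<open>b A\<close>: the first
  inclusion keeps \<open>a A2 + I\<close> inside \<open>a A4\<close>, the second puts
  \<open>I - I\<close> inside \<open>b A2\<close>.\<close>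

lemma cover:
  assumes a: "a \<noteq> 0" and D: "D \<ge> 1" "D \<le> card (common b a)"
  obtains F where "card F * D \<le> card A8"
    "\<And>x. x \<in> A2 \<Longrightarrow> \<exists>y\<in>F. \<exists>v\<in>A2. a * x = y + b * v"
proof -
  define I where "I = (*) a ` common b a"
  define U where "U = (*) a ` A2"
  have cI: "card I = card (common b a)" unfolding I_def by (rule card_image) (use a in \<open>auto simp: inj_on_def\<close>)
  have "I \<noteq> {}" using cI D by auto
  obtain F where "F \<subseteq> U" and F: "card F * card I \<le> card {x + i |x i. x \<in> U \<and> i \<in> I}"
    "\<forall>x\<in>U. \<exists>y\<in>F. \<exists>i\<in>I. \<exists>j\<in>I. x = y + (i - j)"
    by (rule ruzsa_covering[OF finite finite \<open>I \<noteq> {}\<close>, of U])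
  have "{x + i |x i. x \<in> U \<and> i \<in> I} \<subseteq> (*) a ` A4"
  proof
    fix z assume "z \<in> {x + i |x i. x \<in> U \<and> i \<in> I}"
    then obtain x i where "z = a * x + a * i" "x \<in> A2" "i \<in> A" by (auto simp: U_def I_def common_def)
    then show "z \<in> (*) a ` A4" using add2[of x i] subsets(1) by (intro image_eqI[of _ _ "x + i"]) (auto simp: algebra_simps)
  qed
  then have "card {x + i |x i. x \<in> U \<and> i \<in> I} \<le> card ((*) a ` A4)" by (intro card_mono) auto
  also have "\<dots> \<le> card A4" by (rule card_image_le) simp
  also have "\<dots> \<le> card A8" using subsets(3) by (intro card_mono) auto
  finally have "card F * card I \<le> card A8" using F(1) by linarith
  then have "card F * D \<le> card A8" using D(2) cI mult_le_mono2[of D "card I" "card F"] by linarith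
  moreover have "\<exists>y\<in>F. \<exists>v\<in>A2. a * x = y + b * v" if "x \<in> A2" for x
  proof -
    have "a * x \<in> U" using that unfolding U_def by (rule imageI)
    then obtain y i j where y: "y \<in> F" "i \<in> I" "j \<in> I" "a * x = y + (i - j)" using F(2) by meson
    obtain u where u: "u \<in> A" "i = b * u" using y(2) by (auto simp: I_def common_def)
    obtain v where v: "v \<in> A" "j = b * v" using y(3) by (auto simp: I_def common_def)
    have "u + - v \<in> A2" using u(1) sym[OF v(1)] by (rule add1)
    moreover have "a * x = y + b * (u + - v)" using y(4) u v by (simp add: algebra_simps)
    ultimately show ?thesis using y(1) by blast
  qed
  ultimately show ?thesis using that by blast
qed

lemma sym2: "x \<in> A \<Longrightarrow> y \<in> A \<Longrightarrow> - (x + y) \<in> A2"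
  using add1[OF sym sym, of x y] by (simp add: algebra_simps)

text \<open>Multiplied by \<open>c - d\<close>, the element \<open>x + \<xi> y\<close> becomes
  \<open>a y - b y + c (x + y) - d (x + y)\<close>. Each term is covered by few translates of the
  same set \<open>b0 A2\<close>, and the four elements of \<open>A2\<close> add up to one of
  \<open>A8\<close>.\<close>

lemma dilate_sum_bound:
  assumes A1: "A1 \<subseteq> A - {0}" and D: "D \<ge> 1" "\<And>a. a \<in> A1 \<Longrightarrow> D \<le> card (common b0 a)"
    and abcd: "a \<in> A1" "b \<in> A1" "c \<in> A1" "d \<in> A1" "c \<noteq> d"
  shows "card ((\<lambda>(x, y). x + ((a - b) + (c - d)) / (c - d) * y) ` (A1 \<times> A1)) * D ^ 4 \<le> card A8 ^ 5"
proof -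
  have nz: "z \<noteq> 0" if "z \<in> A1" for z using A1 that by auto
  obtain Fa where Fa: "card Fa * D \<le> card A8" "\<And>x. x \<in> A2 \<Longrightarrow> \<exists>y\<in>Fa. \<exists>v\<in>A2. a * x = y + b0 * v"
    using cover[OF nz D(1) D(2)] abcd(1) by metis
  obtain Fb where Fb: "card Fb * D \<le> card A8" "\<And>x. x \<in> A2 \<Longrightarrow> \<exists>y\<in>Fb. \<exists>v\<in>A2. b * x = y + b0 * v"
    using cover[OF nz D(1) D(2)] abcd(2) by metis
  obtain Fc where Fc: "card Fc * D \<le> card A8" "\<And>x. x \<in> A2 \<Longrightarrow> \<exists>y\<in>Fc. \<exists>v\<in>A2. c * x = y + b0 * v"
    using cover[OF nz D(1) D(2)] abcd(3) by metis
  obtain Fd where Fd: "card Fd * D \<le> card A8" "\<And>x. x \<in> A2 \<Longrightarrow> \<exists>y\<in>Fd. \<exists>v\<in>A2. d * x = y + b0 * v"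
    using cover[OF nz D(1) D(2)] abcd(4) by metis
  define \<xi> where "\<xi> = ((a - b) + (c - d)) / (c - d)"
  define Im where "Im = (\<lambda>(x, y). x + \<xi> * y) ` (A1 \<times> A1)"
  define g where "g = (\<lambda>(fa, fb, fc, fd, v). fa + fb + fc + fd + b0 * v)"
  have "(*) (c - d) ` Im \<subseteq> g ` (Fa \<times> Fb \<times> Fc \<times> Fd \<times> A8)"
  proof
    fix z assume "z \<in> (*) (c - d) ` Im"
    then obtain x y where xy: "x \<in> A1" "y \<in> A1" "z = (c - d) * (x + \<xi> * y)" by (auto simp: Im_def)
    have "x \<in> A" "y \<in> A" using xy A1 by auto
    then have s: "y \<in> A2" "- y \<in> A2" "x + y \<in> A2" "- (x + y) \<in> A2"
      using subsets(1) sym add1 sym2 by auto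
    have cd: "(c - d) * \<xi> = (a - b) + (c - d)" using abcd(5) by (simp add: \<xi>_def)
    have "z = (c - d) * x + ((c - d) * \<xi>) * y" using xy(3) by (simp add: algebra_simps)
    then have z: "z = a * y + b * (- y) + c * (x + y) + d * (- (x + y))"
      unfolding cd by (simp add: algebra_simps)
    obtain fa va where a': "fa \<in> Fa" "va \<in> A2" "a * y = fa + b0 * va" using Fa(2)[OF s(1)] by blast
    obtain fb vb where b': "fb \<in> Fb" "vb \<in> A2" "b * (- y) = fb + b0 * vb" using Fb(2)[OF s(2)] by blast
    obtain fc vc where c': "fc \<in> Fc" "vc \<in> A2" "c * (x + y) = fc + b0 * vc" using Fc(2)[OF s(3)] by blast
    obtain fd vd where d': "fd \<in> Fd" "vd \<in> A2" "d * (- (x + y)) = fd + b0 * vd" using Fd(2)[OF s(4)] by blast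
    have "(va + vb) + (vc + vd) \<in> A8" using a' b' c' d' by (intro add4 add2)
    moreover have "z = g (fa, fb, fc, fd, (va + vb) + (vc + vd))"
      unfolding z a'(3) b'(3) c'(3) d'(3) g_def by (simp add: algebra_simps)
    ultimately show "z \<in> g ` (Fa \<times> Fb \<times> Fc \<times> Fd \<times> A8)" using a'(1) b'(1) c'(1) d'(1) by blast
  qed
  then have "card ((*) (c - d) ` Im) \<le> card (g ` (Fa \<times> Fb \<times> Fc \<times> Fd \<times> A8))" by (intro card_mono) auto
  also have "\<dots> \<le> card (Fa \<times> Fb \<times> Fc \<times> Fd \<times> A8)" by (rule card_image_le) simp
  also have "\<dots> = card Fa * (card Fb * (card Fc * (card Fd * card A8)))" by (simp add: card_cartesian_product)
  also have "card ((*) (c - d) ` Im) = card Im" by (rule card_image) (use abcd(5) in \<open>auto simp: inj_on_def\<close>)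
  finally have "card Im * D ^ 4 \<le> card Fa * (card Fb * (card Fc * (card Fd * card A8))) * D ^ 4" by (rule mult_le_mono1)
  also have "\<dots> = (card Fa * D) * ((card Fb * D) * ((card Fc * D) * ((card Fd * D) * card A8)))"
    by (simp add: power4_eq_xxxx mult_ac)
  also have "\<dots> \<le> card A8 * (card A8 * (card A8 * (card A8 * card A8)))"
    using Fa(1) Fb(1) Fc(1) Fd(1) by (intro mult_le_mono order_refl)
  also have "\<dots> = card A8 ^ 5" by (simp add: numeral_eq_Suc)
  finally show ?thesis by (simp add: Im_def \<xi>_def)
qed

lemma card_A_pos: "card A \<ge> 1"
  using zero by (metis One_nat_def Suc_leI card_gt_0_iff empty_iff finite)

lemma Kc_ge_1: "Kc \<ge> 1"
proof -
  have "card A \<le> card A8" using subsets by (intro card_mono) auto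
  then have "1 * real (card A) \<le> Kc * real (card A)" using card_A8 by simp
  moreover have "real (card A) > 0" using card_A_pos by simp
  ultimately show ?thesis by (rule mult_right_le_imp_le)
qed

text \<open>Scale at which the energy argument works: \<open>V^4\<close> exceeds twice the bound for
  \<open>card A8 ^ 5\<close>. The power \<open>Kc ^ 2\<close> instead of
  \<open>Kc powr (5 / 4)\<close> keeps the exponent integral.\<close>

definition V :: real where "V = 2 * Kc ^ 2 * real (card A) powr (5 / 4)"

lemma V4: "V ^ 4 = 16 * Kc ^ 8 * real (card A) ^ 5" and V_ge: "V \<ge> real (card A)" and V_pos: "V > 0"
proof -
  have N: "real (card A) \<ge> 1" using card_A_pos by simp
  have "(real (card A) powr (5 / 4)) ^ 4 = (real (card A) powr (5 / 4)) powr (of_nat 4)"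
    using N by (subst powr_realpow) auto
  also have "\<dots> = real (card A) powr (of_nat 5)" by (simp add: powr_powr)
  also have "\<dots> = real (card A) ^ 5" using N by (subst powr_realpow) auto
  finally show "V ^ 4 = 16 * Kc ^ 8 * real (card A) ^ 5"
    by (simp add: V_def power_mult_distrib power_mult[symmetric])
  have "real (card A) = 1 * real (card A) powr 1" using N by simp
  also have "\<dots> \<le> (2 * Kc ^ 2) * real (card A) powr (5 / 4)"
  proof (intro mult_mono powr_mono)
    show "1 \<le> 2 * Kc ^ 2" using one_le_power[OF Kc_ge_1, of 2] by linarith
  qed (use N in auto)
  finally show "V \<ge> real (card A)" by (simp add: V_def)
  then show "V > 0" using N by linarith
qed

text \<open>\<open>pivot\<close> and \<open>dilate_sum_bound\<close> together bound the smaller of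
  \<open>card A1 ^ 2\<close> and \<open>p\<close>, times \<open>D^4\<close>, by \<open>V^4\<close>.
  The hypothesis on \<open>D\<close> excludes that \<open>p\<close> is the smaller one. A level set
  with at most one element needs only \<open>D \<le> V\<close>.\<close>

lemma level_bound:
  assumes D: "D \<ge> 1" "D \<le> card A" "real CARD('a) * real D ^ 4 > V ^ 4"
  shows "real (card {a \<in> A - {0}. D \<le> card (common b0 a)}) \<le> V ^ 2 / real D ^ 2"
proof -
  define A1 where "A1 = {a \<in> A - {0}. D \<le> card (common b0 a)}"
  have D0: "real D > 0" using D(1) by simp
  show ?thesis
  proof (cases "card A1 \<ge> 2")
    case True
    obtain a b c d where abcd: "a \<in> A1" "b \<in> A1" "c \<in> A1" "d \<in> A1" "c \<noteq> d"
      "min (real (card A1 ^ 2)) (real CARD('a)) \<le> 2 * real (card ((\<lambda>(x, y). x + ((a - b) + (c - d)) / (c - d) * y) ` (A1 \<times> A1)))"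
      using pivot[OF ch True] by metis
    let ?m = "card ((\<lambda>(x, y). x + ((a - b) + (c - d)) / (c - d) * y) ` (A1 \<times> A1))"
    have "?m * D ^ 4 \<le> card A8 ^ 5"
      by (rule dilate_sum_bound[of _ _ b0, OF _ D(1) _ abcd(1-5)]) (auto simp: A1_def)
    then have "real ?m * real D ^ 4 \<le> real (card A8) ^ 5"
      by (simp only: of_nat_power[symmetric] of_nat_mult[symmetric] of_nat_le_iff)
    also have "\<dots> \<le> (Kc * real (card A)) ^ 5" using card_A8 by (intro power_mono) auto
    finally have "2 * real ?m * real D ^ 4 \<le> 2 * (Kc ^ 5 * real (card A) ^ 5)" by (simp add: power_mult_distrib)
    also have "\<dots> \<le> 16 * (Kc ^ 8 * real (card A) ^ 5)"
    proof -
      have "Kc ^ 5 \<le> Kc ^ 8" using Kc_ge_1 by (intro power_increasing) auto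
      then have "Kc ^ 5 * real (card A) ^ 5 \<le> Kc ^ 8 * real (card A) ^ 5" by (rule mult_right_mono) simp
      moreover have "0 \<le> Kc ^ 8 * real (card A) ^ 5" using Kc_ge_1 by simp
      ultimately show ?thesis by linarith
    qed
    also have "\<dots> = V ^ 4" by (simp add: V4)
    finally have m: "2 * real ?m * real D ^ 4 \<le> V ^ 4" .
    have "min (real (card A1 ^ 2)) (real CARD('a)) * real D ^ 4 \<le> 2 * real ?m * real D ^ 4"
      using abcd(6) by (intro mult_right_mono) auto
    then have mn: "min (real (card A1 ^ 2)) (real CARD('a)) * real D ^ 4 \<le> V ^ 4" using m by linarith
    have "\<not> real CARD('a) * real D ^ 4 \<le> V ^ 4" using D(3) by simp
    then have "min (real (card A1 ^ 2)) (real CARD('a)) = real (card A1 ^ 2)" using mn by (metis min_def)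
    then have "(real (card A1) * real D ^ 2) ^ 2 \<le> (V ^ 2) ^ 2"
      using mn by (simp add: power_mult_distrib power_mult[symmetric])
    then have "real (card A1) * real D ^ 2 \<le> V ^ 2" by (rule power2_le_imp_le) simp
    then show ?thesis using D0 by (simp add: A1_def field_simps)
  next
    case False
    have "real D ^ 2 \<le> V ^ 2" using D(2) V_ge by (intro power_mono) auto
    then have "1 \<le> V ^ 2 / real D ^ 2" using D0 by (simp add: field_simps)
    moreover have "real (card A1) \<le> 1" using False by simp
    ultimately show ?thesis by (simp add: A1_def)
  qed
qed

lemma card_common_le: "card (common b a) \<le> card A"
  by (rule card_mono) (auto simp: common_def)

lemma sum_common_bound:
  "real (\<Sum>a\<in>A - {0}. card (common b0 a)) \<le> real (card A) * V * real CARD('a) powr (- 1 / 4) + 4 * sqrt (real (card A)) * V"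
proof -
  let ?N = "card A" and ?p = "real CARD('a)"
  \<comment> \<open>For levels \<open>D\<close> up to \<open>v\<close> the hypothesis of
    \<open>level_bound\<close> fails and the trivial bound \<open>card A\<close> is used;
    \<open>s\<close> is the level at which \<open>V^2/D^2\<close> equals
    \<open>card A\<close>.\<close>
  define v where "v = V * ?p powr (- 1 / 4)"
  define s where "s = V / sqrt (real ?N)"
  have N: "real ?N \<ge> 1" using card_A_pos by simp
  have p: "?p > 0" using finite_UNIV_card_ge_0[where 'a = 'a] by simp
  have s: "s > 0" using V_pos N by (simp add: s_def)
  have v0: "v \<ge> 0" using V_pos by (simp add: v_def)
  have v4: "v ^ 4 * ?p = V ^ 4"
  proof -
    have "(?p powr (- 1 / 4)) ^ 4 = ?p powr (- 1)" using p by (simp add: powr_power)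
    then have "(?p powr (- 1 / 4)) ^ 4 * ?p = 1" using p by (simp add: powr_minus)
    then show ?thesis by (simp add: v_def power_mult_distrib)
  qed
  define n where "n = (\<lambda>D. card {a \<in> A - {0}. D \<le> card (common b0 a)})"
  have n_le: "real (n D) \<le> real ?N * (if real D \<le> v then 1 else 0) + real ?N * min 1 (s\<^sup>2 / (real D)\<^sup>2)" if D: "D \<in> {1..?N}" for D
  proof -
    have "n D \<le> ?N" unfolding n_def by (intro card_mono) auto
    then have nN: "real (n D) \<le> real ?N" by simp
    show ?thesis
    proof (cases "real D \<le> v")
      case True
      have "0 \<le> real ?N * min 1 (s\<^sup>2 / (real D)\<^sup>2)" by (intro mult_nonneg_nonneg) (auto simp: min_def)
      then show ?thesis using nN True by (simp only: if_True mult_1_right)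
    next
      case False
      then have "v ^ 4 < real D ^ 4" using v0 by (intro power_strict_mono) auto
      then have "v ^ 4 * ?p < real D ^ 4 * ?p" using p by (rule mult_strict_right_mono)
      then have "?p * real D ^ 4 > V ^ 4" using v4 by (simp only: mult.commute)
      then have "real (n D) \<le> V ^ 2 / real D ^ 2"
        using level_bound[of D b0] D unfolding n_def by simp
      also have "V ^ 2 = real ?N * s\<^sup>2" using card_A_pos N by (simp add: s_def power_divide del: card_eq_0_iff card_0_eq)
      finally have "real (n D) \<le> real ?N * (s\<^sup>2 / (real D)\<^sup>2)" by simp
      then have "real (n D) \<le> min (real ?N * 1) (real ?N * (s\<^sup>2 / (real D)\<^sup>2))" using nN by simp
      also have "\<dots> = real ?N * min 1 (s\<^sup>2 / (real D)\<^sup>2)" by (subst min_mult_distrib_left) auto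
      finally show ?thesis using False by simp
    qed
  qed
  have "(\<Sum>a\<in>A - {0}. card (common b0 a)) = (\<Sum>a\<in>A - {0}. \<Sum>D\<in>{1..?N}. if D \<le> card (common b0 a) then 1 else 0)"
  proof (intro sum.cong refl)
    fix a
    have "{D \<in> {1..?N}. D \<le> card (common b0 a)} = {1..card (common b0 a)}" using card_common_le[of b0 a] by auto
    then show "card (common b0 a) = (\<Sum>D\<in>{1..?N}. if D \<le> card (common b0 a) then 1 else 0)"
      by (simp add: sum.inter_filter[symmetric])
  qed
  also have "\<dots> = (\<Sum>D\<in>{1..?N}. \<Sum>a\<in>A - {0}. if D \<le> card (common b0 a) then 1 else 0)" by (rule sum.swap)
  also have "\<dots> = (\<Sum>D\<in>{1..?N}. n D)" by (intro sum.cong refl) (simp add: n_def sum.inter_filter[symmetric])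
  finally have "real (\<Sum>a\<in>A - {0}. card (common b0 a)) = (\<Sum>D\<in>{1..?N}. real (n D))" by simp
  also have "\<dots> \<le> (\<Sum>D\<in>{1..?N}. real ?N * (if real D \<le> v then 1 else 0) + real ?N * min 1 (s\<^sup>2 / (real D)\<^sup>2))"
    by (intro sum_mono n_le)
  also have "\<dots> = real ?N * (\<Sum>D\<in>{1..?N}. if real D \<le> v then 1 else 0) + real ?N * (\<Sum>D\<in>{1..?N}. min 1 (s\<^sup>2 / (real D)\<^sup>2))"
    by (simp only: sum.distrib sum_distrib_left)
  also have "\<dots> \<le> real ?N * v + real ?N * (4 * s)"
  proof (intro add_mono mult_left_mono sum_min_inverse_squares s)
    have "{D \<in> {1..?N}. real D \<le> v} \<subseteq> {1..nat \<lfloor>v\<rfloor>}" by (auto simp: le_nat_floor)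
    then have "card {D \<in> {1..?N}. real D \<le> v} \<le> nat \<lfloor>v\<rfloor>" using card_mono[of "{1..nat \<lfloor>v\<rfloor>}"] by fastforce
    then have "real (card {D \<in> {1..?N}. real D \<le> v}) \<le> v" using v0 by linarith
    then show "(\<Sum>D\<in>{1..?N}. if real D \<le> v then 1 else 0) \<le> v" by (simp add: sum.inter_filter[symmetric])
  qed auto
  also have "real ?N * (4 * s) = 4 * sqrt (real ?N) * V"
  proof -
    have "real ?N * (4 * s) = 4 * (real ?N / sqrt (real ?N)) * V" by (simp add: s_def)
    then show ?thesis by (simp only: real_div_sqrt of_nat_0_le_iff)
  qed
  finally show ?thesis by (simp add: v_def mult.assoc)
qed

theorem energy_bound:
  "real (mult_energy A) \<le> 8 * Kc ^ 2 * (real (card A) powr (11 / 4) + real (card A) powr (13 / 4) * real CARD('a) powr (- 1 / 4))"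
proof -
  let ?N = "real (card A)" and ?p = "real CARD('a)"
  have N: "?N \<ge> 1" using card_A_pos by simp
  let ?S = "{(a, b, x, y). a \<in> A - {0} \<and> b \<in> A - {0} \<and> x \<in> A - {0} \<and> y \<in> A - {0} \<and> a * x = b * y}"
  have "card ?S \<le> card (SIGMA b:A - {0}. SIGMA a:A - {0}. common b a)"
  proof (rule card_inj_on_le[of "\<lambda>(a, b, x, y). (b, a, x)"])
    show "inj_on (\<lambda>(a, b, x, y). (b, a, x)) ?S" by (auto simp: inj_on_def)
    show "(\<lambda>(a, b, x, y). (b, a, x)) ` ?S \<subseteq> (SIGMA b:A - {0}. SIGMA a:A - {0}. common b a)"
      unfolding common_def by auto
  qed simp
  also have "\<dots> = (\<Sum>b\<in>A - {0}. \<Sum>a\<in>A - {0}. card (common b a))" by (simp add: card_SigmaI)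
  finally have "real (mult_energy A) \<le> (\<Sum>b\<in>A - {0}. real (\<Sum>a\<in>A - {0}. card (common b a)))"
    unfolding mult_energy_def of_nat_sum[symmetric] by (simp only: of_nat_le_iff)
  also have "\<dots> \<le> (\<Sum>b\<in>A - {0}. ?N * V * ?p powr (- 1 / 4) + 4 * sqrt ?N * V)"
    by (intro sum_mono sum_common_bound)
  also have "\<dots> \<le> ?N * (?N * V * ?p powr (- 1 / 4) + 4 * sqrt ?N * V)"
  proof -
    have "card (A - {0}) \<le> card A" by (intro card_mono) auto
    then show ?thesis using V_pos N by (simp only: sum_constant) (intro mult_right_mono; simp)
  qed
  also have "\<dots> = 2 * Kc ^ 2 * (?N powr (13 / 4) * ?p powr (- 1 / 4)) + 8 * Kc ^ 2 * ?N powr (11 / 4)"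
  proof -
    have "?N * ?N * ?N powr (5 / 4) = ?N powr (13 / 4)"
    proof -
      have "?N powr (13 / 4) = ?N powr (1 + 1 + 5 / 4)" by simp
      also have "\<dots> = ?N * ?N * ?N powr (5 / 4)" by (simp only: powr_add powr_one of_nat_0_le_iff)
      finally show ?thesis ..
    qed
    moreover have "?N * sqrt ?N * ?N powr (5 / 4) = ?N powr (11 / 4)"
    proof -
      have "?N powr (11 / 4) = ?N powr (1 + 1 / 2 + 5 / 4)" by simp
      also have "\<dots> = ?N * sqrt ?N * ?N powr (5 / 4)" by (simp only: powr_add powr_one powr_half_sqrt of_nat_0_le_iff)
      finally show ?thesis ..
    qed
    moreover have "?N * (?N * V * ?p powr (- 1 / 4) + 4 * sqrt ?N * V)
      = 2 * Kc ^ 2 * ((?N * ?N * ?N powr (5 / 4)) * ?p powr (- 1 / 4)) + 8 * Kc ^ 2 * (?N * sqrt ?N * ?N powr (5 / 4))"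
      by (simp add: V_def algebra_simps)
    ultimately show ?thesis by simp
  qed
  also have "\<dots> \<le> 8 * Kc ^ 2 * (?N powr (13 / 4) * ?p powr (- 1 / 4)) + 8 * Kc ^ 2 * ?N powr (11 / 4)"
    by (intro add_mono mult_right_mono) auto
  finally show ?thesis by (simp add: distrib_left add.commute)
qed

end

section \<open>Burgess's argument\<close>

lemma weighted_power_mean:
  fixes w g :: "'b \<Rightarrow> real"
  assumes "finite S" "\<And>i. i \<in> S \<Longrightarrow> w i \<ge> 0" "\<And>i. i \<in> S \<Longrightarrow> g i \<ge> 0"
  shows "(\<Sum>i\<in>S. w i * g i) ^ Suc k \<le> (\<Sum>i\<in>S. w i) ^ k * (\<Sum>i\<in>S. w i * g i ^ Suc k)"
proof -
  define W where "W = (\<Sum>i\<in>S. w i)"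
  have W0: "W \<ge> 0" using assms(2) by (simp add: W_def sum_nonneg)
  show ?thesis
  proof (cases "W = 0")
    case True
    then have "w i = 0" if "i \<in> S" for i
      using that assms(1,2) by (simp add: W_def sum_nonneg_eq_0_iff)
    then have "(\<Sum>i\<in>S. w i * g i) = 0" "(\<Sum>i\<in>S. w i * g i ^ Suc k) = 0" by (simp_all add: sum.neutral)
    then show ?thesis by simp
  next
    case False
    then have W: "W > 0" using W0 by simp
    then have ne: "S \<noteq> {}" by (auto simp: W_def)
    have conv: "convex_on {0..} (\<lambda>x :: real. x ^ Suc k)"
    proof (cases "even (Suc k)")
      case True
      then show ?thesis using convex_on_subset[OF convex_power_even] by blast
    qed (simp add: convex_power_odd del: power_Suc)
    have "(\<Sum>i\<in>S. (w i / W) *\<^sub>R g i) ^ Suc k \<le> (\<Sum>i\<in>S. (w i / W) * g i ^ Suc k)"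
      using convex_on_sum[OF assms(1) ne conv, of "\<lambda>i. w i / W" g] assms W
      by (auto simp: sum_divide_distrib[symmetric] W_def[symmetric])
    then have "((\<Sum>i\<in>S. w i * g i) / W) ^ Suc k \<le> (\<Sum>i\<in>S. w i * g i ^ Suc k) / W"
      by (simp only: real_scaleR_def times_divide_eq_left sum_divide_distrib[symmetric])
    then have "(\<Sum>i\<in>S. w i * g i) ^ Suc k / W ^ Suc k \<le> (\<Sum>i\<in>S. w i * g i ^ Suc k) / W"
      by (simp only: power_divide)
    then have "(\<Sum>i\<in>S. w i * g i) ^ Suc k \<le> (\<Sum>i\<in>S. w i * g i ^ Suc k) / W * W ^ Suc k"
      using W by (simp only: pos_divide_le_eq zero_less_power)
    also have "\<dots> = W ^ k * (\<Sum>i\<in>S. w i * g i ^ Suc k)" using W by simp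
    finally show ?thesis by (simp only: W_def)
  qed
qed

text \<open>The power mean inequality with exponent \<open>k\<close>, squared, and then
  Cauchy-Schwarz. The weights enter only through their sum and the sum of their squares.\<close>

lemma weighted_hoelder:
  fixes w g :: "'b \<Rightarrow> real"
  assumes "finite S" "\<And>i. i \<in> S \<Longrightarrow> w i \<ge> 0" "\<And>i. i \<in> S \<Longrightarrow> g i \<ge> 0" "k \<ge> 1"
  shows "(\<Sum>i\<in>S. w i * g i) ^ (2 * k) \<le> (\<Sum>i\<in>S. w i) ^ (2 * k - 2) * ((\<Sum>i\<in>S. (w i)\<^sup>2) * (\<Sum>i\<in>S. g i ^ (2 * k)))"
proof -
  obtain l where l: "k = Suc l" using assms(4) by (cases k) auto
  have 0: "0 \<le> (\<Sum>i\<in>S. w i * g i) ^ k" using assms by (intro zero_le_power sum_nonneg) simp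
  have "(\<Sum>i\<in>S. w i * g i) ^ (2 * k) = ((\<Sum>i\<in>S. w i * g i) ^ k)\<^sup>2" by (simp add: power_mult[symmetric] mult.commute)
  also have "\<dots> \<le> ((\<Sum>i\<in>S. w i) ^ l * (\<Sum>i\<in>S. w i * g i ^ k))\<^sup>2"
    using weighted_power_mean[OF assms(1-3), where k = l] 0 unfolding l by (intro power_mono) auto
  also have "\<dots> = (\<Sum>i\<in>S. w i) ^ (2 * k - 2) * (\<Sum>i\<in>S. w i * g i ^ k)\<^sup>2"
    by (simp add: l power_mult_distrib power_mult[symmetric] mult.commute)
  also have "\<dots> \<le> (\<Sum>i\<in>S. w i) ^ (2 * k - 2) * ((\<Sum>i\<in>S. (w i)\<^sup>2) * (\<Sum>i\<in>S. (g i ^ k)\<^sup>2))"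
    using assms by (intro mult_left_mono Cauchy_Schwarz_ineq_sum zero_le_power sum_nonneg) auto
  finally show ?thesis by (simp add: power_mult[symmetric] mult.commute)
qed

lemma sum_card_fibres_square:
  fixes f :: "'b \<Rightarrow> 'c::finite"
  assumes "finite S"
  shows "(\<Sum>u\<in>UNIV. real (card {s\<in>S. f s = u}) ^ 2) = real (card {(s, t). s \<in> S \<and> t \<in> S \<and> f s = f t})"
proof -
  have "{(s, t). s \<in> S \<and> t \<in> S \<and> f s = f t} = (\<Union>u\<in>UNIV. {s\<in>S. f s = u} \<times> {s\<in>S. f s = u})" by auto
  also have "card \<dots> = (\<Sum>u\<in>UNIV. card ({s\<in>S. f s = u} \<times> {s\<in>S. f s = u}))"
    using assms by (intro card_UN_disjoint) auto
  finally show ?thesis by (simp add: card_cartesian_product power2_eq_square)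
qed

definition ratio_count :: "'a::{finite,field} set \<Rightarrow> 'a \<Rightarrow> nat" where
  "ratio_count A w = card {(x, x'). x \<in> A - {0} \<and> x' \<in> A - {0} \<and> x / x' = w}"

lemma sum_ratio_count_square:
  fixes A :: "'a::{finite,field} set"
  shows "(\<Sum>w\<in>UNIV. real (ratio_count A w) ^ 2) = real (mult_energy A)"
proof -
  let ?S = "(A - {0}) \<times> (A - {0})"
  have "(\<Sum>w\<in>UNIV. real (ratio_count A w) ^ 2) = (\<Sum>w\<in>UNIV. real (card {s\<in>?S. (\<lambda>(x, x'). x / x') s = w}) ^ 2)"
    by (intro sum.cong refl arg_cong[where f = "\<lambda>n. real n ^ 2"])
       (auto simp: ratio_count_def intro!: arg_cong[where f = card])
  also have "\<dots> = real (card {(s, t). s \<in> ?S \<and> t \<in> ?S \<and> (\<lambda>(x, x'). x / x') s = (\<lambda>(x, x'). x / x') t})"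
    by (rule sum_card_fibres_square) simp
  also have "card {(s, t). s \<in> ?S \<and> t \<in> ?S \<and> (\<lambda>(x, x'). x / x') s = (\<lambda>(x, x'). x / x') t} = mult_energy A"
    unfolding mult_energy_def
  proof (rule bij_betw_same_card[of "\<lambda>((x, x'), (z, z')). (x, z, z', x')"], rule bij_betwI[where g = "\<lambda>(x, z, z', x'). ((x, x'), (z, z'))"])
    show "(\<lambda>((x, x'), (z, z')). (x, z, z', x')) \<in> {(s, t). s \<in> ?S \<and> t \<in> ?S \<and> (\<lambda>(x, x'). x / x') s = (\<lambda>(x, x'). x / x') t} \<rightarrow>
      {(a, b, x, y). a \<in> A - {0} \<and> b \<in> A - {0} \<and> x \<in> A - {0} \<and> y \<in> A - {0} \<and> a * x = b * y}"
      by (auto simp: frac_eq_eq)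
    show "(\<lambda>(x, z, z', x'). ((x, x'), (z, z'))) \<in>
      {(a, b, x, y). a \<in> A - {0} \<and> b \<in> A - {0} \<and> x \<in> A - {0} \<and> y \<in> A - {0} \<and> a * x = b * y} \<rightarrow>
      {(s, t). s \<in> ?S \<and> t \<in> ?S \<and> (\<lambda>(x, x'). x / x') s = (\<lambda>(x, x'). x / x') t}"
      by (auto simp: frac_eq_eq)
  qed auto
  finally show ?thesis .
qed

definition quot_count :: "'a::{finite,field} set \<Rightarrow> 'a set \<Rightarrow> 'a \<Rightarrow> nat" where
  "quot_count B B' u = card {(x, y). x \<in> B \<and> y \<in> B' - {0} \<and> x / y = u}"

text \<open>The term \<open>card (B' - {0})\<^sup>2\<close> accounts for the pairs with \<open>x = x' = 0\<close>.\<close>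

lemma sum_quot_count_square:
  fixes B B' :: "'a::{finite,field} set"
  shows "(\<Sum>u\<in>UNIV. real (quot_count B B' u) ^ 2)
    \<le> real (card (B' - {0})) ^ 2 + sqrt (real (mult_energy B) * real (mult_energy B'))"
proof -
  let ?S = "B \<times> (B' - {0})" and ?f = "\<lambda>(x, y). x / y"
  have "(\<Sum>u\<in>UNIV. real (quot_count B B' u) ^ 2) = (\<Sum>u\<in>UNIV. real (card {s\<in>?S. ?f s = u}) ^ 2)"
    by (intro sum.cong refl arg_cong[where f = "\<lambda>n. real n ^ 2"])
       (auto simp: quot_count_def intro!: arg_cong[where f = card])
  also have "\<dots> = real (card {(s, t). s \<in> ?S \<and> t \<in> ?S \<and> ?f s = ?f t})"
    by (rule sum_card_fibres_square) simp
  also have "\<dots> \<le> real (card ((B' - {0}) \<times> (B' - {0})) + (\<Sum>w\<in>UNIV. ratio_count B w * ratio_count B' w))"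
  proof -
    let ?P = "\<lambda>w. {(x, x'). x \<in> B - {0} \<and> x' \<in> B - {0} \<and> x / x' = w}"
    let ?P' = "\<lambda>w. {(x, x'). x \<in> B' - {0} \<and> x' \<in> B' - {0} \<and> x / x' = w}"
    let ?e = "\<lambda>(y :: 'a, y' :: 'a). ((0 :: 'a, y), (0 :: 'a, y'))" and ?h = "\<lambda>((x :: 'a, x' :: 'a), (y :: 'a, y' :: 'a)). ((x, y), (x', y'))"
    have "{(s, t). s \<in> ?S \<and> t \<in> ?S \<and> ?f s = ?f t} \<subseteq> ?e ` ((B' - {0}) \<times> (B' - {0})) \<union> ?h ` (\<Union>w\<in>UNIV. ?P w \<times> ?P' w)"
    proof
      fix z assume "z \<in> {(s, t). s \<in> ?S \<and> t \<in> ?S \<and> ?f s = ?f t}"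
      then obtain x y x' y' where z: "z = ((x, y), (x', y'))" "x \<in> B" "y \<in> B' - {0}" "x' \<in> B" "y' \<in> B' - {0}" "x / y = x' / y'"
        by auto
      show "z \<in> ?e ` ((B' - {0}) \<times> (B' - {0})) \<union> ?h ` (\<Union>w\<in>UNIV. ?P w \<times> ?P' w)"
      proof (cases "x = 0")
        case True
        then have "x' = 0" using z(3,5,6) by auto
        then have "z = ?e (y, y')" using True z(1) by simp
        then show ?thesis using z(3,5) by blast
      next
        case False
        then have x': "x' \<noteq> 0" using z(3,6) by auto
        then have "x / x' = y / y'" using z(3,5,6) by (auto simp: frac_eq_eq mult.commute)
        then have "((x, x'), (y, y')) \<in> ?P (x / x') \<times> ?P' (x / x')" using z False x' by auto
        moreover have "z = ?h ((x, x'), (y, y'))" using z(1) by simp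
        ultimately show ?thesis by blast
      qed
    qed
    then have "card {(s, t). s \<in> ?S \<and> t \<in> ?S \<and> ?f s = ?f t} \<le> card (?e ` ((B' - {0}) \<times> (B' - {0})) \<union> ?h ` (\<Union>w\<in>UNIV. ?P w \<times> ?P' w))"
      by (intro card_mono) auto
    also have "\<dots> \<le> card (?e ` ((B' - {0}) \<times> (B' - {0}))) + card (?h ` (\<Union>w\<in>UNIV. ?P w \<times> ?P' w))" by (rule card_Un_le)
    also have "\<dots> \<le> card ((B' - {0}) \<times> (B' - {0})) + card (\<Union>w\<in>UNIV. ?P w \<times> ?P' w)"
      by (intro add_mono card_image_le) auto
    also have "card (\<Union>w\<in>UNIV. ?P w \<times> ?P' w) \<le> (\<Sum>w\<in>UNIV. card (?P w \<times> ?P' w))" by (rule card_UN_le) simp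
    also have "\<dots> = (\<Sum>w\<in>UNIV. ratio_count B w * ratio_count B' w)" by (simp add: card_cartesian_product ratio_count_def)
    finally show ?thesis by (simp only: of_nat_le_iff add_left_mono)
  qed
  also have "\<dots> = real (card (B' - {0})) ^ 2 + (\<Sum>w\<in>UNIV. real (ratio_count B w) * real (ratio_count B' w))"
    by (simp add: card_cartesian_product power2_eq_square)
  also have "(\<Sum>w\<in>UNIV. real (ratio_count B w) * real (ratio_count B' w)) \<le> sqrt (real (mult_energy B) * real (mult_energy B'))"
    using Cauchy_Schwarz_ineq_sum[of "\<lambda>w. real (ratio_count B w)" "\<lambda>w. real (ratio_count B' w)" UNIV]
    unfolding sum_ratio_count_square by (rule real_le_rsqrt)
  finally show ?thesis by simp
qed

section \<open>Averaging the character sum over shifts\<close>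

definition energy_majorant :: "real \<Rightarrow> real \<Rightarrow> real \<Rightarrow> real" where
  "energy_majorant Kc p N = 8 * Kc ^ 2 * (N powr (11 / 4) + N powr (13 / 4) * p powr (- 1 / 4))"

definition moment_const :: "nat \<Rightarrow> real" where
  "moment_const k = real ((2 * k) ^ (2 * k) + 2 * k)"

text \<open>The factor 8 is 2, for absorbing the pairs with \<open>x = x' = 0\<close> into the
  energy term, times 4, for passing from \<open>B' - {0}\<close> to \<open>B'\<close> in a
  square.\<close>

definition burgess_bound :: "nat \<Rightarrow> real \<Rightarrow> real \<Rightarrow> real \<Rightarrow> real \<Rightarrow> real" where
  "burgess_bound k p Kc N M = 8 * moment_const k * N ^ (2 * k - 2)
     * (sqrt (energy_majorant Kc p N * energy_majorant Kc p M) * sqrt p)"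

lemma energy_majorant_nonneg: "energy_majorant Kc p N \<ge> 0"
  by (simp add: energy_majorant_def)

text \<open>Allows the square of \<open>card (B' - {0})\<close> in
  \<open>sum_quot_count_square\<close> to be absorbed by the energy term.\<close>

lemma energy_majorant_ge:
  assumes "Kc \<ge> 1" "N \<ge> 1"
  shows "energy_majorant Kc p N \<ge> N ^ 2"
proof -
  have "N ^ 2 = N powr 2" using assms(2) by simp
  also have "\<dots> \<le> N powr (11 / 4)" using assms(2) by (intro powr_mono) auto
  also have "\<dots> \<le> N powr (11 / 4) + N powr (13 / 4) * p powr (- 1 / 4)" by simp
  also have "\<dots> = 1 * (N powr (11 / 4) + N powr (13 / 4) * p powr (- 1 / 4))" by simp
  also have "\<dots> \<le> (8 * Kc ^ 2) * (N powr (11 / 4) + N powr (13 / 4) * p powr (- 1 / 4))"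
  proof (rule mult_right_mono)
    show "1 \<le> 8 * Kc ^ 2" using one_le_power[OF assms(1), of 2] by linarith
  qed simp
  finally show ?thesis by (simp add: energy_majorant_def)
qed

context mult_char begin

lemma burgess_inequality:
  assumes ch: "CHAR('a) = CARD('a)" and k: "k \<ge> 1" and T: "T \<ge> 1" "T < CARD('a)" "CARD('a) \<le> T ^ (2 * k)"
    and B: "small_doubling B B2 B4 B8 Kc" and B': "small_doubling B' B2' B4' B8' Kc"
    and sub: "B' \<subseteq> B" and card: "card B' \<ge> 2"
    and shift: "\<And>y t. y \<in> B' \<Longrightarrow> t \<in> {1..T} \<Longrightarrow> cmod ((\<Sum>x\<in>B. chi (x + y * of_nat t)) - (\<Sum>x\<in>B. chi x)) \<le> err"
    and S: "cmod (\<Sum>x\<in>B. chi x) \<ge> err"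
  shows "(cmod (\<Sum>x\<in>B. chi x) - err) ^ (2 * k) * real (card B') ^ 2
    \<le> burgess_bound k (real CARD('a)) Kc (real (card B)) (real (card B'))"
proof -
  interpret B: small_doubling B B2 B4 B8 Kc by (rule B)
  interpret B': small_doubling B' B2' B4' B8' Kc by (rule B')
  let ?p = "real CARD('a)" and ?N = "real (card B)" and ?M = "real (card B')" and ?B = "B' - {0}"
  let ?EB = "energy_majorant Kc ?p ?N" and ?EM = "energy_majorant Kc ?p ?M"
  define M' where "M' = real (card ?B)"
  define s where "s = cmod (\<Sum>x\<in>B. chi x) - err"
  define g where "g = (\<lambda>u. cmod (\<Sum>t=1..T. chi (u + of_nat t)))"
  define \<nu> where "\<nu> = (\<lambda>u. real (quot_count B B' u))"
  define Y where "Y = (\<Sum>u\<in>UNIV. \<nu> u * g u)"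
  have s0: "s \<ge> 0" using S by (simp add: s_def)
  have "card ?B = card B' - 1" using B'.zero by (simp add: card_Diff_singleton)
  \<comment> \<open>As \<open>B'\<close> has at least two elements, removing 0 at most halves
    it.\<close>
  then have M': "M' \<ge> ?M / 2" "M' \<le> ?M" "M' > 0" using card by (auto simp: M'_def)
  have N1: "?N \<ge> 1" using B.card_A_pos by simp
  have MN: "?M \<le> ?N" using sub by (simp add: card_mono)
  have "M' * real T * s \<le> Y"
  proof -
    have "of_real (M' * real T) * (\<Sum>x\<in>B. chi x) = (\<Sum>y\<in>?B. \<Sum>t=1..T. \<Sum>x\<in>B. chi x)" by (simp add: M'_def)
    then have "M' * real T * cmod (\<Sum>x\<in>B. chi x) = cmod (\<Sum>y\<in>?B. \<Sum>t=1..T. \<Sum>x\<in>B. chi x)"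
      by (metis norm_mult norm_of_real abs_of_nonneg M'_def of_nat_0_le_iff of_nat_mult)
    also have "(\<Sum>y\<in>?B. \<Sum>t=1..T. \<Sum>x\<in>B. chi x) = (\<Sum>y\<in>?B. \<Sum>t=1..T. \<Sum>x\<in>B. chi (x + y * of_nat t))
        - (\<Sum>y\<in>?B. \<Sum>t=1..T. (\<Sum>x\<in>B. chi (x + y * of_nat t)) - (\<Sum>x\<in>B. chi x))"
      by (simp add: sum_subtractf)
    also have "cmod \<dots> \<le> cmod (\<Sum>y\<in>?B. \<Sum>t=1..T. \<Sum>x\<in>B. chi (x + y * of_nat t))
        + cmod (\<Sum>y\<in>?B. \<Sum>t=1..T. (\<Sum>x\<in>B. chi (x + y * of_nat t)) - (\<Sum>x\<in>B. chi x))"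
      by (rule norm_triangle_ineq4)
    also have "cmod (\<Sum>y\<in>?B. \<Sum>t=1..T. (\<Sum>x\<in>B. chi (x + y * of_nat t)) - (\<Sum>x\<in>B. chi x)) \<le> (\<Sum>y\<in>?B. \<Sum>t=1..T. err)"
      by (intro sum_norm_le shift) auto
    also have "(\<Sum>y\<in>?B. \<Sum>t=1..T. err) = M' * real T * err" by (simp add: M'_def)
    also have "cmod (\<Sum>y\<in>?B. \<Sum>t=1..T. \<Sum>x\<in>B. chi (x + y * of_nat t)) \<le> (\<Sum>y\<in>?B. \<Sum>x\<in>B. g (x / y))"
    proof (rule sum_norm_le)
      fix y assume y: "y \<in> ?B"
      have "(\<Sum>t=1..T. \<Sum>x\<in>B. chi (x + y * of_nat t)) = (\<Sum>x\<in>B. \<Sum>t=1..T. chi (x + y * of_nat t))" by (rule sum.swap)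
      also have "cmod \<dots> \<le> (\<Sum>x\<in>B. g (x / y))"
      proof (rule sum_norm_le)
        fix x
        have "chi (x + y * of_nat t) = chi y * chi (x / y + of_nat t)" for t
          using y by (simp add: chi_mult[symmetric] algebra_simps)
        then have "(\<Sum>t=1..T. chi (x + y * of_nat t)) = chi y * (\<Sum>t=1..T. chi (x / y + of_nat t))"
          by (simp add: sum_distrib_left)
        then show "cmod (\<Sum>t=1..T. chi (x + y * of_nat t)) \<le> g (x / y)"
          using y by (simp add: norm_mult cmod_chi g_def)
      qed
      finally show "cmod (\<Sum>t=1..T. \<Sum>x\<in>B. chi (x + y * of_nat t)) \<le> (\<Sum>x\<in>B. g (x / y))" .
    qed
    also have "(\<Sum>y\<in>?B. \<Sum>x\<in>B. g (x / y)) = Y"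
    proof -
      have "(\<Sum>y\<in>?B. \<Sum>x\<in>B. g (x / y)) = (\<Sum>x\<in>B. \<Sum>y\<in>?B. g (x / y))" by (rule sum.swap)
      also have "\<dots> = (\<Sum>z\<in>B \<times> ?B. g (fst z / snd z))" by (simp add: sum.cartesian_product case_prod_unfold)
      also have "\<dots> = (\<Sum>u\<in>UNIV. \<Sum>z\<in>{z\<in>B \<times> ?B. fst z / snd z = u}. g (fst z / snd z))"
        by (rule sum.group[symmetric]) auto
      also have "\<dots> = (\<Sum>u\<in>UNIV. \<nu> u * g u)"
      proof (intro sum.cong refl)
        fix u
        have "{z\<in>B \<times> ?B. fst z / snd z = u} = {(x, y). x \<in> B \<and> y \<in> ?B \<and> x / y = u}" by auto
        then have "\<nu> u = real (card {z\<in>B \<times> ?B. fst z / snd z = u})" by (simp only: \<nu>_def quot_count_def)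
        moreover have "(\<Sum>z\<in>{z\<in>B \<times> ?B. fst z / snd z = u}. g (fst z / snd z)) = (\<Sum>z\<in>{z\<in>B \<times> ?B. fst z / snd z = u}. g u)"
          by (rule sum.cong) auto
        ultimately show "(\<Sum>z\<in>{z\<in>B \<times> ?B. fst z / snd z = u}. g (fst z / snd z)) = \<nu> u * g u" by simp
      qed
      finally show ?thesis by (simp add: Y_def)
    qed
    finally show ?thesis by (simp add: s_def algebra_simps)
  qed
  then have "(M' * real T * s) ^ (2 * k) \<le> Y ^ (2 * k)"
    using M'(3) s0 by (intro power_mono) auto
  also have "\<dots> \<le> (\<Sum>u\<in>UNIV. \<nu> u) ^ (2 * k - 2) * ((\<Sum>u\<in>UNIV. (\<nu> u)\<^sup>2) * (\<Sum>u\<in>UNIV. g u ^ (2 * k)))"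
    unfolding Y_def by (rule weighted_hoelder) (use k in \<open>auto simp: \<nu>_def g_def\<close>)
  also have "(\<Sum>u\<in>UNIV. \<nu> u) = ?N * M'"
  proof -
    have "(\<Sum>u\<in>UNIV. \<nu> u) = real (\<Sum>u\<in>UNIV. \<Sum>z\<in>{z\<in>B \<times> ?B. fst z / snd z = u}. 1)"
    proof -
      have "{z\<in>B \<times> ?B. fst z / snd z = u} = {(x, y). x \<in> B \<and> y \<in> ?B \<and> x / y = u}" for u by auto
      then show ?thesis by (simp add: \<nu>_def quot_count_def)
    qed
    also have "(\<Sum>u\<in>UNIV. \<Sum>z\<in>{z\<in>B \<times> ?B. fst z / snd z = u}. 1) = (\<Sum>z\<in>B \<times> ?B. 1)"
      by (rule sum.group) auto
    finally show ?thesis by (simp add: card_cartesian_product M'_def)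
  qed
  also have "(?N * M') ^ (2 * k - 2) * ((\<Sum>u\<in>UNIV. (\<nu> u)\<^sup>2) * (\<Sum>u\<in>UNIV. g u ^ (2 * k)))
    \<le> (?N * M') ^ (2 * k - 2) * ((2 * sqrt (?EB * ?EM)) * (moment_const k * (real T ^ (2 * k) * sqrt ?p)))"
  proof (intro mult_left_mono mult_mono)
    have EB: "real (mult_energy B) \<le> ?EB" "real (mult_energy B') \<le> ?EM"
      using B.energy_bound B'.energy_bound by (simp_all add: energy_majorant_def)
    have Kc: "Kc \<ge> 1" by (rule B.Kc_ge_1)
    have "?M ^ 2 \<le> ?EM" using card by (intro energy_majorant_ge Kc) simp
    moreover have "?M ^ 2 \<le> ?EB"
      using order_trans[OF power_mono[OF MN, of 2] energy_majorant_ge[OF Kc N1, of ?p]] by simp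
    ultimately have "?M ^ 2 * ?M ^ 2 \<le> ?EB * ?EM" by (intro mult_mono energy_majorant_nonneg) auto
    then have "?M ^ 2 \<le> sqrt (?EB * ?EM)" by (intro real_le_rsqrt) (simp add: power2_eq_square)
    moreover have "M' ^ 2 \<le> ?M ^ 2" using M' by (intro power_mono) auto
    moreover have "sqrt (real (mult_energy B) * real (mult_energy B')) \<le> sqrt (?EB * ?EM)"
      using EB by (intro real_sqrt_le_mono mult_mono) auto
    ultimately show "(\<Sum>u\<in>UNIV. (\<nu> u)\<^sup>2) \<le> 2 * sqrt (?EB * ?EM)"
      using sum_quot_count_square[of B B'] unfolding \<nu>_def M'_def by linarith
    have "sqrt ?p ^ 2 \<le> (real T ^ k) ^ 2"
    proof -
      have "real CARD('a) \<le> real (T ^ (2 * k))" using T(3) by (simp only: of_nat_le_iff)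
      then show ?thesis by (simp add: power_mult[symmetric] mult.commute)
    qed
    \<comment> \<open>Here the lower bound on \<open>T\<close> enters: it makes the part
      \<open>T^k p\<close> of the moment at most \<open>T^(2k) sqrt p\<close>, the size of the Weil
      part.\<close>
    then have sp: "sqrt ?p \<le> real T ^ k" by (rule power2_le_imp_le) simp
    have "real T ^ k * ?p = real T ^ k * (sqrt ?p * sqrt ?p)" by simp
    also have "\<dots> \<le> real T ^ k * (real T ^ k * sqrt ?p)" using sp by (intro mult_left_mono mult_right_mono) auto
    also have "\<dots> = real T ^ (2 * k) * sqrt ?p" by (simp add: mult_2 power_add)
    finally have "real T ^ k * ?p \<le> real T ^ (2 * k) * sqrt ?p" .
    then have "real ((2 * k) ^ (2 * k)) * (real T ^ k * ?p) \<le> real ((2 * k) ^ (2 * k)) * (real T ^ (2 * k) * sqrt ?p)"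
      by (intro mult_left_mono) auto
    then show "(\<Sum>u\<in>UNIV. g u ^ (2 * k)) \<le> moment_const k * (real T ^ (2 * k) * sqrt ?p)"
      using moment_bound[OF ch T(2) k] by (simp add: g_def moment_const_def algebra_simps)
  qed (use N1 M' in \<open>auto simp: g_def energy_majorant_nonneg intro!: sum_nonneg mult_nonneg_nonneg\<close>)
  finally have main: "(M' * real T * s) ^ (2 * k) \<le> (?N * M') ^ (2 * k - 2) * ((2 * sqrt (?EB * ?EM)) * (moment_const k * (real T ^ (2 * k) * sqrt ?p)))" .
  define Z where "Z = ?N ^ (2 * k - 2) * (2 * sqrt (?EB * ?EM) * moment_const k * sqrt ?p)"
  obtain l where l: "2 * k = l + 2" using k by (metis le_add_diff_inverse2 mult_le_mono2 mult_2_right nat_mult_1_right one_add_one)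
  have c0: "M' ^ l * real T ^ (2 * k) > 0" using M'(3) T(1) by simp
  have "(M' ^ l * real T ^ (2 * k)) * (s ^ (2 * k) * M' ^ 2) = (M' * real T * s) ^ (2 * k)"
    unfolding power_mult_distrib l power_add by simp
  also have "\<dots> \<le> (M' ^ l * real T ^ (2 * k)) * Z"
  proof -
    have "2 * k - 2 = l" using l by simp
    with main show ?thesis by (simp add: Z_def power_mult_distrib mult_ac)
  qed
  finally have "s ^ (2 * k) * M' ^ 2 \<le> Z" using c0 by (simp only: mult_le_cancel_left_pos)
  moreover have "?M ^ 2 \<le> 4 * M' ^ 2" using power_mono[OF M'(1), of 2] by (simp add: power_divide)
  then have "s ^ (2 * k) * ?M ^ 2 \<le> s ^ (2 * k) * (4 * M' ^ 2)" using s0 by (intro mult_left_mono) auto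
  ultimately have "s ^ (2 * k) * ?M ^ 2 \<le> 4 * Z" by linarith
  then show ?thesis by (simp add: Z_def s_def burgess_bound_def mult_ac)
qed

end

section \<open>From types of prime order to all primes\<close>

definition int_doubling :: "nat \<Rightarrow> int set \<Rightarrow> int set \<Rightarrow> int set \<Rightarrow> int set \<Rightarrow> real \<Rightarrow> bool" where
  "int_doubling p A A2 A4 A8 Kc \<longleftrightarrow>
     A \<subseteq> {0..<int p} \<and> A8 \<subseteq> {0..<int p} \<and> 0 \<in> A \<and> (\<forall>x\<in>A. (- x) mod int p \<in> A) \<and>
     (\<forall>x\<in>A. \<forall>y\<in>A. (x + y) mod int p \<in> A2) \<and> (\<forall>x\<in>A2. \<forall>y\<in>A2. (x + y) mod int p \<in> A4) \<and>
     (\<forall>x\<in>A4. \<forall>y\<in>A4. (x + y) mod int p \<in> A8) \<and> real (card A8) \<le> Kc * real (card A)"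

text \<open>All that is taken over from the residue field as a type, restated for integer
  representatives so that \<open>p\<close> may be a bound variable. The complete sum is included for
  radii at which the Bohr set is the whole field.\<close>

definition burgess_at :: "nat \<Rightarrow> bool" where
  "burgess_at p \<longleftrightarrow> (\<forall>chi. nontrivial_mult_character p chi \<longrightarrow>
     (\<forall>x\<in>{0..<int p}. cmod (chi x) \<le> 1) \<and> (\<Sum>x\<in>{0..<int p}. chi x) = 0 \<and>
     (\<forall>k T B B2 B4 B8 B' B2' B4' B8' Kc err.
     k \<ge> 1 \<longrightarrow> T \<ge> 1 \<longrightarrow> T < p \<longrightarrow> p \<le> T ^ (2 * k) \<longrightarrow>
     int_doubling p B B2 B4 B8 Kc \<longrightarrow> int_doubling p B' B2' B4' B8' Kc \<longrightarrow>
     B' \<subseteq> B \<longrightarrow> card B' \<ge> 2 \<longrightarrow>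
     (\<forall>y\<in>B'. \<forall>t\<in>{1..T}. cmod ((\<Sum>x\<in>B. chi ((x + y * int t) mod int p)) - (\<Sum>x\<in>B. chi x)) \<le> err) \<longrightarrow>
     cmod (\<Sum>x\<in>B. chi x) \<ge> err \<longrightarrow>
     (cmod (\<Sum>x\<in>B. chi x) - err) ^ (2 * k) * real (card B') ^ 2
       \<le> burgess_bound k (real p) Kc (real (card B)) (real (card B'))))"

lemma to_int_of_int: "to_int_mod_ring (of_int x :: 'a::prime_card mod_ring) = x mod int CARD('a)"
  unfolding of_int_of_int_mod_ring by transfer simp

lemma of_int_mod_card: "(of_int (x mod int CARD('a)) :: 'a::prime_card mod_ring) = of_int x"
  by (metis mod_mod_trivial of_int_mod_ring_to_int_mod_ring of_int_of_int_mod_ring to_int_of_int)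

lemma of_int_inj: "inj_on (of_int :: int \<Rightarrow> 'a::prime_card mod_ring) {0..<int CARD('a)}"
proof (rule inj_onI)
  fix x y assume xy: "x \<in> {0..<int CARD('a)}" "y \<in> {0..<int CARD('a)}" "(of_int x :: 'a mod_ring) = of_int y"
  then have "x mod int CARD('a) = y mod int CARD('a)" by (metis to_int_of_int)
  then show "x = y" using xy(1,2) by simp
qed

lemma mult_char_mod_ring:
  fixes chi :: "int \<Rightarrow> complex"
  assumes "nontrivial_mult_character CARD('a) chi"
  shows "mult_char (\<lambda>z :: 'a::prime_card mod_ring. chi (to_int_mod_ring z))"
proof -
  let ?p = "int CARD('a)"
  let ?R = "residue_ring ?p"
  interpret residues_prime "CARD('a)" ?R by unfold_locales (simp_all add: prime_card)
  have U: "Units ?R = {1..?p - 1}"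
    using res_prime_units_eq by (simp add: of_nat_diff Suc_leI)
  have hom: "chi \<in> hom (units_of ?R) complex_mult_group" and nc: "\<not> chi constant_on Units ?R" and c0: "chi 0 = 0"
    using assms by (auto simp: nontrivial_mult_character_def)
  have mult: "chi (x * y mod ?p) = chi x * chi y" if "x \<in> {1..?p - 1}" "y \<in> {1..?p - 1}" for x y
  proof -
    have "chi (x \<otimes>\<^bsub>units_of ?R\<^esub> y) = chi x \<otimes>\<^bsub>complex_mult_group\<^esub> chi y"
      using that U by (intro hom_mult[OF hom]) (simp_all add: units_of_carrier)
    then show ?thesis by (simp add: units_of_mult res_mult_eq complex_mult_group_def)
  qed
  have nz: "chi x \<noteq> 0" if "x \<in> {1..?p - 1}" for x
  proof -
    have "chi x \<in> carrier complex_mult_group"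
      using that U by (intro hom_in_carrier[OF hom]) (simp add: units_of_carrier)
    then show ?thesis by (simp add: complex_mult_group_def)
  qed
  have p2: "?p \<ge> 2" using p_prime prime_ge_2_nat by simp
  have rng: "to_int_mod_ring z \<in> {1..?p - 1}" if "z \<noteq> 0" for z :: "'a mod_ring"
  proof -
    have "to_int_mod_ring z \<in> {0..<?p}" using range_to_int_mod_ring[where 'a = 'a] by blast
    moreover have "to_int_mod_ring z \<noteq> 0" using that by simp
    ultimately show ?thesis by (simp only: atLeastLessThan_iff atLeastAtMost_iff) linarith
  qed
  have chi1: "chi 1 = 1"
  proof -
    have "1 \<in> {1..?p - 1}" using p2 by simp
    from mult[OF this this] have "chi 1 = chi 1 * chi 1" using p2 by simp
    then show ?thesis using nz[OF \<open>1 \<in> {1..?p - 1}\<close>] by simp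
  qed
  show ?thesis
  proof
    show "chi (to_int_mod_ring (0 :: 'a mod_ring)) = 0" by (simp add: c0)
    show "chi (to_int_mod_ring (1 :: 'a mod_ring)) = 1" by (simp add: chi1)
    show "chi (to_int_mod_ring (x * y)) = chi (to_int_mod_ring x) * chi (to_int_mod_ring y)" for x y :: "'a mod_ring"
    proof (cases "x = 0 \<or> y = 0")
      case False
      have "to_int_mod_ring (x * y) = to_int_mod_ring x * to_int_mod_ring y mod ?p" by transfer simp
      then show ?thesis using mult[OF rng rng] False by simp
    qed (auto simp: c0)
    have "\<exists>x\<in>Units ?R. chi x \<noteq> 1" using nc unfolding constant_on_def by blast
    then obtain x where x: "x \<in> {1..?p - 1}" "chi x \<noteq> 1" using U by auto
    have "to_int_mod_ring (of_int x :: 'a mod_ring) = x" using x(1) by (simp add: to_int_of_int)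
    then show "\<exists>z :: 'a mod_ring. z \<noteq> 0 \<and> chi (to_int_mod_ring z) \<noteq> 1"
      using x by (intro exI[of _ "of_int x"]) (auto simp: c0)
  qed
qed

lemma small_doubling_mod_ring:
  assumes "int_doubling CARD('a) A A2 A4 A8 Kc"
  shows "small_doubling ((of_int :: int \<Rightarrow> 'a::prime_card mod_ring) ` A) (of_int ` A2) (of_int ` A4) (of_int ` A8) Kc"
proof -
  let ?p = "int CARD('a)" and ?i = "of_int :: int \<Rightarrow> 'a mod_ring"
  note a = assms[unfolded int_doubling_def]
  have im: "?i z \<in> ?i ` S" if "z mod ?p \<in> S" for z S
    using that by (metis image_eqI of_int_mod_card)
  show ?thesis
  proof
    show "CHAR('a mod_ring) = CARD('a mod_ring)" by simp
    show "0 \<in> ?i ` A" using a by (intro image_eqI[of _ _ 0]) auto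
    show "- x \<in> ?i ` A" if x: "x \<in> ?i ` A" for x
    proof -
      obtain u where "u \<in> A" "x = ?i u" using x by blast
      then show ?thesis using im[of "- u" A] a by simp
    qed
    show "x + y \<in> ?i ` A2" if xy: "x \<in> ?i ` A" "y \<in> ?i ` A" for x y
    proof -
      obtain u v where "u \<in> A" "x = ?i u" "v \<in> A" "y = ?i v" using xy by blast
      then show ?thesis using im[of "u + v" A2] a by simp
    qed
    show "x + y \<in> ?i ` A4" if xy: "x \<in> ?i ` A2" "y \<in> ?i ` A2" for x y
    proof -
      obtain u v where "u \<in> A2" "x = ?i u" "v \<in> A2" "y = ?i v" using xy by blast
      then show ?thesis using im[of "u + v" A4] a by simp
    qed
    show "x + y \<in> ?i ` A8" if xy: "x \<in> ?i ` A4" "y \<in> ?i ` A4" for x y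
    proof -
      obtain u v where "u \<in> A4" "x = ?i u" "v \<in> A4" "y = ?i v" using xy by blast
      then show ?thesis using im[of "u + v" A8] a by simp
    qed
    have "inj_on ?i A" "inj_on ?i A8" using a inj_on_subset[OF of_int_inj] by blast+
    then show "real (card (?i ` A8)) \<le> Kc * real (card (?i ` A))" using a by (simp add: card_image)
  qed
qed

lemma burgess_at_card: "burgess_at CARD('a::prime_card)"
  unfolding burgess_at_def
proof (intro allI impI)
  fix chi assume chi: "nontrivial_mult_character CARD('a) chi"
  let ?i = "of_int :: int \<Rightarrow> 'a mod_ring" and ?p = "int CARD('a)"
  interpret mult_char "\<lambda>z :: 'a mod_ring. chi (to_int_mod_ring z)" by (rule mult_char_mod_ring[OF chi])
  have le_1: "cmod (chi x) \<le> 1" if "x \<in> {0..<?p}" for x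
    using cmod_chi_le[of "?i x"] that by (simp add: to_int_of_int)
  have "(\<Sum>x\<in>{0..<?p}. chi x) = (\<Sum>z\<in>range (to_int_mod_ring :: 'a mod_ring \<Rightarrow> int). chi z)"
    by (simp only: range_to_int_mod_ring)
  also have "\<dots> = (\<Sum>z\<in>(UNIV :: 'a mod_ring set). chi (to_int_mod_ring z))"
    by (rule sum.reindex_cong[OF to_int_mod_ring_hom.inj_f]) auto
  finally have sum_0: "(\<Sum>x\<in>{0..<?p}. chi x) = 0" by (simp only: sum_chi)
  have main: "(cmod (\<Sum>x\<in>B. chi x) - err) ^ (2 * k) * real (card B') ^ 2
    \<le> burgess_bound k (real CARD('a)) Kc (real (card B)) (real (card B'))"
    if k: "k \<ge> 1" and T: "T \<ge> 1" "T < CARD('a)" "CARD('a) \<le> T ^ (2 * k)"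
    and B: "int_doubling CARD('a) B B2 B4 B8 Kc" and B': "int_doubling CARD('a) B' B2' B4' B8' Kc"
    and sub: "B' \<subseteq> B" and card: "card B' \<ge> 2"
    and shift: "\<forall>y\<in>B'. \<forall>t\<in>{1..T}. cmod ((\<Sum>x\<in>B. chi ((x + y * int t) mod ?p)) - (\<Sum>x\<in>B. chi x)) \<le> err"
    and S: "cmod (\<Sum>x\<in>B. chi x) \<ge> err"
    for k T B B2 B4 B8 B' B2' B4' B8' Kc err
  proof -
    have Bp: "B \<subseteq> {0..<?p}" using B by (simp add: int_doubling_def)
    have injB: "inj_on ?i B" and injB': "inj_on ?i B'"
      using inj_on_subset[OF of_int_inj] Bp sub by blast+
    have sumB: "(\<Sum>z\<in>?i ` B. chi (to_int_mod_ring z)) = (\<Sum>x\<in>B. chi x)"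
      unfolding sum.reindex[OF injB] o_def
      by (intro sum.cong refl) (use Bp in \<open>auto simp: to_int_of_int\<close>)
    have sumBt: "(\<Sum>z\<in>?i ` B. chi (to_int_mod_ring (z + ?i y * of_nat t))) = (\<Sum>x\<in>B. chi ((x + y * int t) mod ?p))" for y t
    proof -
      have "?i x + ?i y * of_nat t = ?i (x + y * int t)" for x by simp
      then show ?thesis unfolding sum.reindex[OF injB] o_def by (simp only: to_int_of_int)
    qed
    have cards: "card (?i ` B) = card B" "card (?i ` B') = card B'" by (simp_all add: card_image injB injB')
    have shift': "cmod ((\<Sum>z\<in>?i ` B. chi (to_int_mod_ring (z + y * of_nat t))) - (\<Sum>z\<in>?i ` B. chi (to_int_mod_ring z))) \<le> err"
      if yt: "y \<in> ?i ` B'" "t \<in> {1..T}" for y t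
    proof -
      obtain v where v: "v \<in> B'" "y = ?i v" using yt(1) by blast
      show ?thesis unfolding v(2) sumBt sumB using shift v(1) yt(2) by blast
    qed
    have "(cmod (\<Sum>z\<in>?i ` B. chi (to_int_mod_ring z)) - err) ^ (2 * k) * real (card (?i ` B')) ^ 2
      \<le> burgess_bound k (real CARD('a mod_ring)) Kc (real (card (?i ` B))) (real (card (?i ` B')))"
      by (rule burgess_inequality[OF _ k _ _ _ small_doubling_mod_ring[OF B] small_doubling_mod_ring[OF B'] _ _ shift'])
         (use T sub card S in \<open>auto simp: cards sumB\<close>)
    then show ?thesis by (simp only: cards sumB CARD_mod_ring)
  qed
  show "(\<forall>x\<in>{0..<?p}. cmod (chi x) \<le> 1) \<and> (\<Sum>x\<in>{0..<?p}. chi x) = 0 \<and> (\<forall>k T B B2 B4 B8 B' B2' B4' B8' Kc err.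
     k \<ge> 1 \<longrightarrow> T \<ge> 1 \<longrightarrow> T < CARD('a) \<longrightarrow> CARD('a) \<le> T ^ (2 * k) \<longrightarrow>
     int_doubling CARD('a) B B2 B4 B8 Kc \<longrightarrow> int_doubling CARD('a) B' B2' B4' B8' Kc \<longrightarrow>
     B' \<subseteq> B \<longrightarrow> card B' \<ge> 2 \<longrightarrow>
     (\<forall>y\<in>B'. \<forall>t\<in>{1..T}. cmod ((\<Sum>x\<in>B. chi ((x + y * int t) mod ?p)) - (\<Sum>x\<in>B. chi x)) \<le> err) \<longrightarrow>
     cmod (\<Sum>x\<in>B. chi x) \<ge> err \<longrightarrow>
     (cmod (\<Sum>x\<in>B. chi x) - err) ^ (2 * k) * real (card B') ^ 2
       \<le> burgess_bound k (real CARD('a)) Kc (real (card B)) (real (card B')))"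
  proof (intro conjI ballI le_1 sum_0, assumption, intro allI impI)
    fix k T and B B2 B4 B8 B' B2' B4' B8' :: "int set" and Kc err
    assume "k \<ge> 1" and T: "T \<ge> 1" "T < CARD('a)" "CARD('a) \<le> T ^ (2 * k)"
      and "int_doubling CARD('a) B B2 B4 B8 Kc" "int_doubling CARD('a) B' B2' B4' B8' Kc" "B' \<subseteq> B" "card B' \<ge> 2"
        "\<forall>y\<in>B'. \<forall>t\<in>{1..T}. cmod ((\<Sum>x\<in>B. chi ((x + y * int t) mod ?p)) - (\<Sum>x\<in>B. chi x)) \<le> err"
        "cmod (\<Sum>x\<in>B. chi x) \<ge> err"
    then show "(cmod (\<Sum>x\<in>B. chi x) - err) ^ (2 * k) * real (card B') ^ 2
       \<le> burgess_bound k (real CARD('a)) Kc (real (card B)) (real (card B'))"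
      by (rule main[where T = T])
  qed
qed

text \<open>A type cannot depend on the variable \<open>p\<close>, but it may depend on a closed term: the field of
  residues is built for one prime at which the inequality fails, if there is such a prime.\<close>

definition exceptional_prime :: nat where
  "exceptional_prime = (if \<exists>p. prime p \<and> \<not> burgess_at p then SOME p. prime p \<and> \<not> burgess_at p else 2)"

lemma prime_exceptional_prime: "prime exceptional_prime"
proof (cases "\<exists>p. prime p \<and> \<not> burgess_at p")
  case True
  then show ?thesis using someI_ex[OF True] by (simp add: exceptional_prime_def)
next
  case False
  then have "exceptional_prime = 2" unfolding exceptional_prime_def by (rule if_not_P)
  then show ?thesis using two_is_prime_nat by (simp only:)
qed

typedef exceptional_index = "{0..<exceptional_prime}"
  using prime_gt_0_nat[OF prime_exceptional_prime] by auto

lemma card_exceptional_index: "CARD(exceptional_index) = exceptional_prime"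
  using type_definition.card[OF type_definition_exceptional_index] by simp

instance exceptional_index :: prime_card
  by standard (simp add: card_exceptional_index prime_exceptional_prime)

theorem burgess_at_prime:
  assumes "prime p"
  shows "burgess_at p"
proof (rule ccontr)
  assume "\<not> burgess_at p"
  then have ex: "\<exists>p. prime p \<and> \<not> burgess_at p" using assms by blast
  then have "\<not> burgess_at exceptional_prime"
    unfolding exceptional_prime_def using someI_ex[OF ex] by simp
  then show False using burgess_at_card[where 'a = exceptional_index] by (simp add: card_exceptional_index)
qed

section \<open>Bohr sets\<close>

text \<open>The infimum is attained because the integers form a closed set.\<close>

lemma dist_int_le_iff: "dist_int \<theta> \<le> \<epsilon> \<longleftrightarrow> (\<exists>n::int. \<bar>\<theta> - of_int n\<bar> \<le> \<epsilon>)"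
proof
  obtain z where z: "z \<in> \<int>" "infdist \<theta> \<int> = dist \<theta> z"
  proof -
    have "(\<int> :: real set) \<noteq> {}" using Ints_0 by blast
    then show thesis using infdist_attains_inf[OF closed_Ints] that by metis
  qed
  then obtain n where "z = of_int n" by (auto elim: Ints_cases)
  then show "dist_int \<theta> \<le> \<epsilon> \<Longrightarrow> \<exists>n::int. \<bar>\<theta> - of_int n\<bar> \<le> \<epsilon>"
    using z(2) by (auto simp: dist_int_def dist_real_def)
next
  assume "\<exists>n::int. \<bar>\<theta> - of_int n\<bar> \<le> \<epsilon>"
  then obtain n :: int where n: "\<bar>\<theta> - of_int n\<bar> \<le> \<epsilon>" by blast
  have "infdist \<theta> \<int> \<le> dist \<theta> (of_int n)" by (rule infdist_le) simp
  then show "dist_int \<theta> \<le> \<epsilon>" using n by (simp add: dist_int_def dist_real_def)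
qed

lemma bohr_set_iff:
  "x \<in> bohr_set p \<Gamma> \<epsilon> \<longleftrightarrow> x \<in> {0..<int p} \<and> (\<forall>r\<in>\<Gamma>. \<exists>n::int. \<bar>of_int (x * r) / real p - of_int n\<bar> \<le> \<epsilon>)"
proof -
  have "carrier (residue_ring (int p)) = {0..<int p}" by (auto simp: residue_ring_def)
  then show ?thesis by (simp add: bohr_set_def dist_int_le_iff)
qed

lemma bohr_set_subset: "bohr_set p \<Gamma> \<epsilon> \<subseteq> {0..<int p}"
  by (auto simp: bohr_set_iff)

lemma finite_bohr_set [simp]: "finite (bohr_set p \<Gamma> \<epsilon>)"
  by (rule finite_subset[OF bohr_set_subset]) simp

lemma bohr_set_mono: "\<epsilon> \<le> \<epsilon>' \<Longrightarrow> bohr_set p \<Gamma> \<epsilon> \<subseteq> bohr_set p \<Gamma> \<epsilon>'"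
  unfolding subset_iff bohr_set_iff by (meson order_trans)

text \<open>Reducing \<open>z\<close> modulo \<open>p\<close> changes \<open>z r / p\<close> by an
  integer only.\<close>

lemma mod_mult_div_eq:
  assumes "p > 0"
  shows "of_int ((z mod int p) * r) / real p = of_int (z * r) / real p - of_int ((z div int p) * r)"
proof -
  have "z = int p * (z div int p) + z mod int p" by simp
  then have "z * r = (z mod int p) * r + int p * ((z div int p) * r)" by (metis add.commute distrib_right mult.assoc)
  then have "real_of_int (z * r) = of_int ((z mod int p) * r) + real p * of_int ((z div int p) * r)"
    by (metis of_int_add of_int_mult of_int_of_nat_eq)
  then show ?thesis using assms by (simp add: field_simps)
qed

lemma mod_in_bohr_setI:
  assumes "p > 0" "\<And>r. r \<in> \<Gamma> \<Longrightarrow> \<exists>n::int. \<bar>of_int (z * r) / real p - of_int n\<bar> \<le> \<epsilon>"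
  shows "z mod int p \<in> bohr_set p \<Gamma> \<epsilon>"
  unfolding bohr_set_iff
proof (intro conjI ballI)
  fix r assume "r \<in> \<Gamma>"
  then obtain n :: int where "\<bar>of_int (z * r) / real p - of_int n\<bar> \<le> \<epsilon>" using assms(2) by blast
  then show "\<exists>n::int. \<bar>of_int ((z mod int p) * r) / real p - of_int n\<bar> \<le> \<epsilon>"
    unfolding mod_mult_div_eq[OF assms(1)]
    by (intro exI[of _ "n - (z div int p) * r"]) (simp add: algebra_simps)
qed (use assms(1) in simp)

lemma zero_in_bohr_set: "p > 0 \<Longrightarrow> \<epsilon> \<ge> 0 \<Longrightarrow> 0 \<in> bohr_set p \<Gamma> \<epsilon>"
  unfolding bohr_set_iff by (auto intro!: exI[of _ 0])

lemma neg_in_bohr_set: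
  assumes "p > 0" "x \<in> bohr_set p \<Gamma> \<epsilon>"
  shows "(- x) mod int p \<in> bohr_set p \<Gamma> \<epsilon>"
proof (rule mod_in_bohr_setI[OF assms(1)])
  fix r assume "r \<in> \<Gamma>"
  then obtain n :: int where "\<bar>of_int (x * r) / real p - of_int n\<bar> \<le> \<epsilon>" using assms(2) by (auto simp: bohr_set_iff)
  then show "\<exists>n::int. \<bar>of_int (- x * r) / real p - of_int n\<bar> \<le> \<epsilon>"
    by (intro exI[of _ "- n"]) simp
qed

lemma add_mult_in_bohr_set:
  assumes "p > 0" "x \<in> bohr_set p \<Gamma> \<epsilon>" "y \<in> bohr_set p \<Gamma> \<delta>"
  shows "(x + y * int t) mod int p \<in> bohr_set p \<Gamma> (\<epsilon> + real t * \<delta>)"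
proof (rule mod_in_bohr_setI[OF assms(1)])
  fix r assume r: "r \<in> \<Gamma>"
  obtain n :: int where n: "\<bar>of_int (x * r) / real p - of_int n\<bar> \<le> \<epsilon>" using assms(2) r by (auto simp: bohr_set_iff)
  obtain m :: int where m: "\<bar>of_int (y * r) / real p - of_int m\<bar> \<le> \<delta>" using assms(3) r by (auto simp: bohr_set_iff)
  have "\<bar>real t * (of_int (y * r) / real p - of_int m)\<bar> \<le> real t * \<delta>"
    using m by (simp only: abs_mult abs_of_nat) (rule mult_left_mono; simp)
  then have "\<bar>(of_int (x * r) / real p - of_int n) + real t * (of_int (y * r) / real p - of_int m)\<bar> \<le> \<epsilon> + real t * \<delta>"
    using n by linarith
  moreover have "(of_int (x * r) / real p - of_int n) + real t * (of_int (y * r) / real p - of_int m)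
    = of_int ((x + y * int t) * r) / real p - of_int (n + int t * m)"
    by (simp add: algebra_simps add_divide_distrib)
  ultimately show "\<exists>n::int. \<bar>of_int ((x + y * int t) * r) / real p - of_int n\<bar> \<le> \<epsilon> + real t * \<delta>" by metis
qed

lemma add_in_bohr_set:
  assumes "p > 0" "x \<in> bohr_set p \<Gamma> \<epsilon>" "y \<in> bohr_set p \<Gamma> \<delta>"
  shows "(x + y) mod int p \<in> bohr_set p \<Gamma> (\<epsilon> + \<delta>)"
  using add_mult_in_bohr_set[OF assms, of 1] by simp

lemma diff_in_bohr_setI:
  assumes "p > 0" "\<And>r. r \<in> \<Gamma> \<Longrightarrow> \<exists>n n'::int. \<bar>(of_int (x * r) / real p - of_int n) - (of_int (y * r) / real p - of_int n')\<bar> \<le> \<delta>"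
  shows "(x - y) mod int p \<in> bohr_set p \<Gamma> \<delta>"
proof (rule mod_in_bohr_setI[OF assms(1)])
  fix r assume "r \<in> \<Gamma>"
  then obtain n n' :: int where n: "\<bar>(of_int (x * r) / real p - of_int n) - (of_int (y * r) / real p - of_int n')\<bar> \<le> \<delta>"
    using assms(2) by blast
  have "(of_int (x * r) / real p - of_int n) - (of_int (y * r) / real p - of_int n') = of_int ((x - y) * r) / real p - of_int (n - n')"
    by (simp add: algebra_simps diff_divide_distrib)
  then show "\<exists>n::int. \<bar>of_int ((x - y) * r) / real p - of_int n\<bar> \<le> \<delta>" using n by metis
qed

text \<open>Common pigeonhole step of both size estimates for Bohr sets. Points are classified by
  their labels \<open>c x r\<close>, and subtracting a fixed point of a cell maps the cell
  injectively into \<open>B\<close>.\<close>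

lemma card_le_cells:
  fixes c :: "int \<Rightarrow> int \<Rightarrow> 'c"
  assumes U: "U \<subseteq> {0..<int p}" and fin: "finite \<Gamma>" "finite S"
    and c: "\<And>x r. x \<in> U \<Longrightarrow> r \<in> \<Gamma> \<Longrightarrow> c x r \<in> S"
    and diff: "\<And>x y. x \<in> U \<Longrightarrow> y \<in> U \<Longrightarrow> (\<And>r. r \<in> \<Gamma> \<Longrightarrow> c x r = c y r) \<Longrightarrow> (x - y) mod int p \<in> B"
    and B: "finite B"
  shows "card U \<le> card S ^ card \<Gamma> * card B"
proof -
  define cell where "cell = (\<lambda>g. {x\<in>U. \<forall>r\<in>\<Gamma>. c x r = g r})"
  have finX: "finite U" by (rule finite_subset[OF U]) simp
  have "U \<subseteq> (\<Union>g\<in>\<Gamma> \<rightarrow>\<^sub>E S. cell g)"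
  proof
    fix x assume x: "x \<in> U"
    have "restrict (c x) \<Gamma> \<in> \<Gamma> \<rightarrow>\<^sub>E S" using c[OF x] by auto
    moreover have "x \<in> cell (restrict (c x) \<Gamma>)" using x by (simp add: cell_def)
    ultimately show "x \<in> (\<Union>g\<in>\<Gamma> \<rightarrow>\<^sub>E S. cell g)" by blast
  qed
  then have "card U \<le> card (\<Union>g\<in>\<Gamma> \<rightarrow>\<^sub>E S. cell g)"
    using fin finX by (intro card_mono finite_UN_I finite_PiE) (auto simp: cell_def)
  also have "\<dots> \<le> (\<Sum>g\<in>\<Gamma> \<rightarrow>\<^sub>E S. card (cell g))" using fin by (intro card_UN_le finite_PiE)
  also have "\<dots> \<le> (\<Sum>g\<in>\<Gamma> \<rightarrow>\<^sub>E S. card B)"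
  proof (rule sum_mono)
    fix g
    show "card (cell g) \<le> card B"
    proof (cases "cell g = {}")
      case False
      then obtain y where y: "y \<in> cell g" by blast
      show ?thesis
      proof (rule card_inj_on_le[of "\<lambda>x. (x - y) mod int p", OF _ _ B])
        show "inj_on (\<lambda>x. (x - y) mod int p) (cell g)"
        proof (rule inj_onI)
          fix u v assume uv: "u \<in> cell g" "v \<in> cell g" "(u - y) mod int p = (v - y) mod int p"
          have "(u - y + y) mod int p = (v - y + y) mod int p" using uv(3) by (rule mod_add_cong) simp
          then have "u mod int p = v mod int p" by simp
          moreover have "u \<in> {0..<int p}" "v \<in> {0..<int p}" using uv(1,2) U by (auto simp: cell_def)
          ultimately show "u = v" by simp
        qed
        show "(\<lambda>x. (x - y) mod int p) ` cell g \<subseteq> B"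
          using y by (auto simp: cell_def intro!: diff)
      qed
    qed simp
  qed
  also have "\<dots> = card S ^ card \<Gamma> * card B" using fin by (simp add: card_PiE)
  finally show ?thesis .
qed

text \<open>The torus of dimension \<open>card \<Gamma>\<close> is cut into boxes of side
  \<open>1/L\<close>, which is at most \<open>\<delta>\<close>.\<close>

lemma card_bohr_set_lower:
  assumes p: "p > 0" and fin: "finite \<Gamma>" and L: "L \<ge> 1" "real L * \<delta> \<ge> 1"
  shows "p \<le> L ^ card \<Gamma> * card (bohr_set p \<Gamma> \<delta>)"
proof -
  define c where "c = (\<lambda>x r. \<lfloor>real L * frac (of_int (x * r) / real p)\<rfloor>)"
  have "card {0..<int p} \<le> card {0..<int L} ^ card \<Gamma> * card (bohr_set p \<Gamma> \<delta>)"
  proof (rule card_le_cells[where c = c and p = p])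
    fix x r :: int
    have "frac (of_int (x * r) / real p) < 1" by (rule frac_lt_1)
    then have "real L * frac (of_int (x * r) / real p) < real L * 1" using L(1) by (intro mult_strict_left_mono) auto
    moreover have "0 \<le> real L * frac (of_int (x * r) / real p)" by simp
    ultimately show "c x r \<in> {0..<int L}" by (simp add: c_def floor_less_iff)
  next
    fix x y assume c: "\<And>r. r \<in> \<Gamma> \<Longrightarrow> c x r = c y r"
    show "(x - y) mod int p \<in> bohr_set p \<Gamma> \<delta>"
    proof (rule diff_in_bohr_setI[OF p])
      fix r assume "r \<in> \<Gamma>"
      let ?u = "real_of_int (x * r) / real p" and ?v = "real_of_int (y * r) / real p"
      have "\<lfloor>real L * frac ?u\<rfloor> = \<lfloor>real L * frac ?v\<rfloor>" using c[OF \<open>r \<in> \<Gamma>\<close>] by (simp add: c_def)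
      then have "\<bar>real L * frac ?u - real L * frac ?v\<bar> \<le> 1" by linarith
      then have "real L * \<bar>frac ?u - frac ?v\<bar> \<le> real L * \<delta>"
        using L(2) by (simp add: right_diff_distrib[symmetric] abs_mult)
      then have "\<bar>frac ?u - frac ?v\<bar> \<le> \<delta>" using L(1) by simp
      then show "\<exists>n n'. \<bar>(?u - of_int n) - (?v - of_int n')\<bar> \<le> \<delta>"
        unfolding frac_def by blast
    qed
  qed (use fin in auto)
  then show ?thesis by simp
qed

text \<open>Cells of side \<open>\<epsilon>\<close> inside
  \<open>[-8 \<epsilon>, 8 \<epsilon>]\<close>; the floor of a number between -8 and 8 takes 17
  values.\<close>

lemma card_bohr_set_8:
  assumes p: "p > 0" and fin: "finite \<Gamma>" and \<epsilon>: "\<epsilon> > 0"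
  shows "card (bohr_set p \<Gamma> (8 * \<epsilon>)) \<le> 17 ^ card \<Gamma> * card (bohr_set p \<Gamma> \<epsilon>)"
proof -
  \<comment> \<open>An integer within \<open>8 * \<epsilon>\<close> need not be unique for large
    radii, so one is fixed for each \<open>x\<close> and \<open>r\<close>.\<close>
  define n where "n = (\<lambda>x r. SOME n::int. \<bar>of_int (x * r) / real p - of_int n\<bar> \<le> 8 * \<epsilon>)"
  define c where "c = (\<lambda>x r. \<lfloor>(of_int (x * r) / real p - of_int (n x r)) / \<epsilon>\<rfloor>)"
  have n: "\<bar>of_int (x * r) / real p - of_int (n x r)\<bar> \<le> 8 * \<epsilon>" if "x \<in> bohr_set p \<Gamma> (8 * \<epsilon>)" "r \<in> \<Gamma>" for x r
    unfolding n_def by (rule someI_ex) (use that in \<open>simp add: bohr_set_iff\<close>)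
  have "card (bohr_set p \<Gamma> (8 * \<epsilon>)) \<le> card {- 8..8 :: int} ^ card \<Gamma> * card (bohr_set p \<Gamma> \<epsilon>)"
  proof (rule card_le_cells[where c = c, OF bohr_set_subset fin])
    fix x r assume "x \<in> bohr_set p \<Gamma> (8 * \<epsilon>)" "r \<in> \<Gamma>"
    from n[OF this] have "\<bar>(of_int (x * r) / real p - of_int (n x r)) / \<epsilon>\<bar> \<le> 8"
      using \<epsilon> by (simp add: pos_divide_le_eq)
    then show "c x r \<in> {- 8..8}" unfolding c_def by (simp only: atLeastAtMost_iff) linarith
  next
    fix x y assume c: "\<And>r. r \<in> \<Gamma> \<Longrightarrow> c x r = c y r"
    show "(x - y) mod int p \<in> bohr_set p \<Gamma> \<epsilon>"
    proof (rule diff_in_bohr_setI[OF p])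
      fix r assume "r \<in> \<Gamma>"
      let ?u = "real_of_int (x * r) / real p - of_int (n x r)" and ?v = "real_of_int (y * r) / real p - of_int (n y r)"
      have "\<lfloor>?u / \<epsilon>\<rfloor> = \<lfloor>?v / \<epsilon>\<rfloor>" using c[OF \<open>r \<in> \<Gamma>\<close>] by (simp add: c_def)
      then have "\<bar>?u / \<epsilon> - ?v / \<epsilon>\<bar> \<le> 1" by linarith
      then have "\<bar>?u - ?v\<bar> \<le> \<epsilon>" using \<epsilon> by (simp add: diff_divide_distrib[symmetric] pos_divide_le_eq)
      then show "\<exists>n n'. \<bar>(real_of_int (x * r) / real p - of_int n) - (real_of_int (y * r) / real p - of_int n')\<bar> \<le> \<epsilon>" by blast
    qed
  qed auto
  then show ?thesis by simp
qed

lemma bohr_set_eq_all: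
  assumes "\<epsilon> \<ge> 1 / 2"
  shows "bohr_set p \<Gamma> \<epsilon> = {0..<int p}"
proof -
  have "\<exists>n::int. \<bar>z - of_int n\<bar> \<le> \<epsilon>" for z :: real
    using of_int_round_abs_le[of z] assms by (intro exI[of _ "round z"]) (simp add: abs_minus_commute)
  then show ?thesis by (auto simp: bohr_set_iff)
qed

section \<open>The character sum over a Bohr set\<close>

lemma moment_const_ge_1:
  assumes "k \<ge> 1"
  shows "moment_const k \<ge> 1"
proof -
  have "1 \<le> (2 * k) ^ (2 * k) + 2 * k" using assms by (intro trans_le_add2) simp
  then have "real 1 \<le> real ((2 * k) ^ (2 * k) + 2 * k)" by (simp only: of_nat_le_iff)
  then show ?thesis by (simp only: moment_const_def of_nat_1)
qed

text \<open>The quotient of the second term of the majorant by the first is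
  \<open>sqrt x * p powr (- 1 / 4)\<close>, which increases with \<open>x\<close>. Its value at the
  larger size \<open>N\<close>, or 1 if that is larger, therefore serves for both sizes.\<close>

lemma sqrt_energy_majorant_mult_le:
  fixes p M N :: real
  assumes "1 \<le> M" "M \<le> N" "p > 0"
  shows "sqrt (energy_majorant Kc p N * energy_majorant Kc p M)
    \<le> 16 * Kc ^ 2 * max 1 (sqrt N * p powr (- 1 / 4)) * (N * M) powr (11 / 8)"
proof -
  define \<tau> where "\<tau> = max 1 (sqrt N * p powr (- 1 / 4))"
  have \<tau>: "\<tau> \<ge> 1" by (simp add: \<tau>_def)
  have bd: "energy_majorant Kc p x \<le> 16 * Kc ^ 2 * \<tau> * x powr (11 / 4)" if x: "1 \<le> x" "x \<le> N" for x
  proof -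
    have "x powr (13 / 4) = x powr (11 / 4) * x powr (1 / 2)" using x by (simp add: powr_add[symmetric])
    then have "x powr (13 / 4) * p powr (- 1 / 4) = x powr (11 / 4) * (sqrt x * p powr (- 1 / 4))"
      using x by (simp add: powr_half_sqrt)
    also have "\<dots> \<le> x powr (11 / 4) * \<tau>"
    proof (rule mult_left_mono)
      have "sqrt x * p powr (- 1 / 4) \<le> sqrt N * p powr (- 1 / 4)" using x by (intro mult_right_mono) auto
      then show "sqrt x * p powr (- 1 / 4) \<le> \<tau>" by (simp add: \<tau>_def)
    qed simp
    finally have "x powr (13 / 4) * p powr (- 1 / 4) \<le> x powr (11 / 4) * \<tau>" .
    moreover have "x powr (11 / 4) * 1 \<le> x powr (11 / 4) * \<tau>" using \<tau> by (intro mult_left_mono) auto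
    ultimately have "x powr (11 / 4) + x powr (13 / 4) * p powr (- 1 / 4) \<le> 2 * (x powr (11 / 4) * \<tau>)" by simp
    then have "8 * Kc ^ 2 * (x powr (11 / 4) + x powr (13 / 4) * p powr (- 1 / 4)) \<le> 8 * Kc ^ 2 * (2 * (x powr (11 / 4) * \<tau>))"
      by (intro mult_left_mono) auto
    then show ?thesis by (simp add: energy_majorant_def mult_ac)
  qed
  have "energy_majorant Kc p N * energy_majorant Kc p M \<le> (16 * Kc ^ 2 * \<tau> * N powr (11 / 4)) * (16 * Kc ^ 2 * \<tau> * M powr (11 / 4))"
    using assms \<tau> by (intro mult_mono bd energy_majorant_nonneg) auto
  also have "\<dots> = (16 * Kc ^ 2 * \<tau> * (N * M) powr (11 / 8))\<^sup>2"
  proof -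
    have "((N * M) powr (11 / 8))\<^sup>2 = (N * M) powr (11 / 4)"
      using assms by (simp add: power2_eq_square powr_add[symmetric])
    also have "\<dots> = N powr (11 / 4) * M powr (11 / 4)" using assms by (simp add: powr_mult)
    finally show ?thesis by (simp add: power_mult_distrib power2_eq_square)
  qed
  finally have "sqrt (energy_majorant Kc p N * energy_majorant Kc p M) \<le> 16 * Kc ^ 2 * \<tau> * (N * M) powr (11 / 8)"
    using \<tau> by (intro real_le_lsqrt) auto
  then show ?thesis by (simp add: \<tau>_def)
qed

lemma le_powr_inverse_of_power_le:
  fixes s Z :: real
  assumes "s ^ n \<le> Z" "s \<ge> 0" "n > 0"
  shows "s \<le> Z powr (1 / real n)"
proof (cases "s = 0")
  case False
  then have "s > 0" using assms(2) by simp
  then have "s = (s powr real n) powr (1 / real n)" using assms(3) by (simp add: powr_powr)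
  also have "\<dots> \<le> Z powr (1 / real n)"
    using assms(1) \<open>s > 0\<close> by (intro powr_mono2) (auto simp: powr_realpow)
  finally show ?thesis .
qed simp

text \<open>The exponents rest on the identity between \<open>N^(2k-2) (N M)^(11/8)\<close> and
  \<open>N^(2k) M^2\<close> times \<open>N^(-5/4) (N/M)^(5/8)\<close>. \<open>R\<close> stands for
  the loss from passing to the smaller Bohr set and \<open>H\<close> for what depends on the range
  of \<open>N\<close>.\<close>

lemma extract_root:
  fixes p M N R H s Kc :: real
  assumes k: "k \<ge> 1" and MN: "1 \<le> M" "M \<le> N" and p: "p > 0" and R: "N / M \<le> R" and Kc: "Kc \<ge> 1"
    and H: "max 1 (sqrt N * p powr (- 1 / 4)) * sqrt p * N powr (- 5 / 4) \<le> H" and s: "s \<ge> 0"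
    and le: "s ^ (2 * k) * M ^ 2 \<le> burgess_bound k p Kc N M"
  shows "s \<le> 128 * moment_const k * Kc ^ 2 * N * (R powr (5 / 8) * H) powr (1 / (2 * real k))"
proof -
  define \<tau> where "\<tau> = max 1 (sqrt N * p powr (- 1 / 4))"
  define c where "c = 128 * moment_const k * Kc ^ 2"
  have mk: "moment_const k \<ge> 1" by (rule moment_const_ge_1[OF k])
  have "1 * 1 \<le> moment_const k * Kc ^ 2" using mk one_le_power[OF Kc, of 2] by (intro mult_mono) auto
  then have c: "c \<ge> 1" by (simp add: c_def)
  have \<tau>: "\<tau> \<ge> 1" by (simp add: \<tau>_def)
  have N0: "N > 0" and M0: "M > 0" using MN by auto
  have R0: "R > 0" using R N0 M0 by (meson divide_pos_pos less_le_trans)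
  have H0: "H > 0"
  proof -
    have "0 < \<tau> * sqrt p * N powr (- 5 / 4)" using \<tau> p N0 by (intro mult_pos_pos) auto
    then show ?thesis using H by (simp add: \<tau>_def)
  qed
  have "s ^ (2 * k) * M ^ 2 \<le> 8 * moment_const k * N ^ (2 * k - 2) * ((16 * Kc ^ 2 * \<tau> * (N * M) powr (11 / 8)) * sqrt p)"
    using sqrt_energy_majorant_mult_le[OF MN p, of Kc] mk N0 p
    by (intro order_trans[OF le[unfolded burgess_bound_def]] mult_left_mono mult_right_mono) (auto simp: \<tau>_def)
  also have "\<dots> = (N ^ (2 * k - 2) * (N * M) powr (11 / 8)) * (c * (\<tau> * sqrt p))" by (simp add: c_def)
  also have "N ^ (2 * k - 2) * (N * M) powr (11 / 8) = N ^ (2 * k) * M ^ 2 * (N powr (- 5 / 4) * (N / M) powr (5 / 8))"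
  proof -
    have "2 * k = (2 * k - 2) + 2" using k by simp
    then have Nk: "N ^ (2 * k) = N ^ (2 * k - 2) * N ^ 2" by (metis power_add)
    have "(N * M) powr (11 / 8) = N powr (11 / 8) * M powr (11 / 8)" using N0 M0 by (simp add: powr_mult)
    also have "N powr (11 / 8) = N ^ 2 * N powr (- 5 / 4) * N powr (5 / 8)"
    proof -
      have "N powr (11 / 8) = N powr (2 + - 5 / 4 + 5 / 8)" by simp
      also have "\<dots> = N powr 2 * N powr (- 5 / 4) * N powr (5 / 8)" by (simp only: powr_add)
      finally show ?thesis using N0 by simp
    qed
    also have "M powr (11 / 8) = M ^ 2 / M powr (5 / 8)"
    proof -
      have "M powr (11 / 8) = M powr (2 - 5 / 8)" by simp
      also have "\<dots> = M powr 2 / M powr (5 / 8)" by (simp only: powr_diff)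
      finally show ?thesis using M0 by simp
    qed
    also have "N ^ 2 * N powr (- 5 / 4) * N powr (5 / 8) * (M ^ 2 / M powr (5 / 8))
      = N ^ 2 * M ^ 2 * (N powr (- 5 / 4) * (N powr (5 / 8) / M powr (5 / 8)))" by (simp only: times_divide_eq_right mult_ac)
    also have "N powr (5 / 8) / M powr (5 / 8) = (N / M) powr (5 / 8)" using N0 M0 by (simp add: powr_divide)
    finally have E: "(N * M) powr (11 / 8) = N ^ 2 * M ^ 2 * (N powr (- 5 / 4) * (N / M) powr (5 / 8))" .
    show ?thesis unfolding Nk E by (simp only: mult_ac)
  qed
  finally have "M ^ 2 * s ^ (2 * k) \<le> M ^ 2 * (N ^ (2 * k) * (c * ((N / M) powr (5 / 8) * (\<tau> * sqrt p * N powr (- 5 / 4)))))"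
    by (simp add: mult_ac)
  then have "s ^ (2 * k) \<le> N ^ (2 * k) * (c * ((N / M) powr (5 / 8) * (\<tau> * sqrt p * N powr (- 5 / 4))))"
    using M0 by (simp add: mult_le_cancel_left_pos)
  also have "\<dots> \<le> N ^ (2 * k) * (c * (R powr (5 / 8) * H))"
  proof (intro mult_left_mono mult_mono)
    show "(N / M) powr (5 / 8) \<le> R powr (5 / 8)" using R N0 M0 by (intro powr_mono2) auto
    show "\<tau> * sqrt p * N powr (- 5 / 4) \<le> H" using H by (simp add: \<tau>_def)
  qed (use \<tau> p c N0 in auto)
  finally have "s \<le> (N ^ (2 * k) * (c * (R powr (5 / 8) * H))) powr (1 / real (2 * k))"
    using s k by (intro le_powr_inverse_of_power_le) auto
  also have "\<dots> = N * (c powr (1 / real (2 * k)) * (R powr (5 / 8) * H) powr (1 / real (2 * k)))"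
  proof -
    have "(N ^ (2 * k)) powr (1 / real (2 * k)) = (N powr real (2 * k)) powr (1 / real (2 * k))"
      by (subst powr_realpow[OF N0]) simp
    also have "\<dots> = N" using k N0 by (simp add: powr_powr)
    finally show ?thesis using N0 c R0 H0 by (simp add: powr_mult)
  qed
  \<comment> \<open>The root of a constant that is at least 1 is bounded by the constant
    itself.\<close>
  also have "\<dots> \<le> N * (c * (R powr (5 / 8) * H) powr (1 / real (2 * k)))"
  proof (intro mult_left_mono mult_right_mono)
    have "c powr (1 / real (2 * k)) \<le> c powr 1" using c k by (intro powr_mono) auto
    then show "c powr (1 / real (2 * k)) \<le> c" using c by simp
  qed (use N0 in auto)
  finally show ?thesis by (simp add: c_def mult_ac)
qed

text \<open>The two sums share the part over the intersection of \<open>B\<close> with its shift.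
  Each remaining part lies in \<open>B'\<close> outside a set with \<open>card B\<close>
  elements.\<close>

lemma shifted_sum_diff:
  fixes chi :: "int \<Rightarrow> complex"
  assumes B: "B \<subseteq> B'" "B' \<subseteq> {0..<int p}" and z: "\<And>x. x \<in> B \<Longrightarrow> (x + z) mod int p \<in> B'"
    and chi: "\<And>x. x \<in> {0..<int p} \<Longrightarrow> cmod (chi x) \<le> 1"
  shows "cmod ((\<Sum>x\<in>B. chi ((x + z) mod int p)) - (\<Sum>x\<in>B. chi x)) \<le> 2 * (real (card B') - real (card B))"
proof -
  define f where "f = (\<lambda>x. (x + z) mod int p)"
  have fin: "finite B'" "finite B" using B finite_subset[of _ "{0..<int p}"] by blast+
  have inj: "inj_on f B"
  proof (rule inj_onI)
    fix u v assume uv: "u \<in> B" "v \<in> B" "f u = f v"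
    have "(u + z - z) mod int p = (v + z - z) mod int p"
      using uv(3) unfolding f_def by (rule mod_diff_cong) simp
    then have "u mod int p = v mod int p" by simp
    moreover have "u \<in> {0..<int p}" "v \<in> {0..<int p}" using uv B by blast+
    ultimately show "u = v" by simp
  qed
  have fB: "f ` B \<subseteq> B'" using z by (auto simp: f_def)
  have part: "cmod (\<Sum>x\<in>S - U. chi x) \<le> real (card B') - real (card U)"
    if "S \<subseteq> B'" "U \<subseteq> B'" for S U
  proof -
    have "cmod (\<Sum>x\<in>S - U. chi x) \<le> (\<Sum>x\<in>S - U. 1)"
      by (rule sum_norm_le) (use that B chi in blast)
    also have "\<dots> = real (card (S - U))" by simp
    also have "\<dots> \<le> real (card (B' - U))" using fin that by (intro of_nat_mono card_mono) auto
    also have "\<dots> = real (card B') - real (card U)"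
      using that fin card_mono[OF fin(1) that(2)] finite_subset[OF that(2) fin(1)] by (simp add: card_Diff_subset of_nat_diff)
    finally show ?thesis .
  qed
  have "(\<Sum>x\<in>B. chi ((x + z) mod int p)) = (\<Sum>y\<in>f ` B. chi y)"
    unfolding sum.reindex[OF inj] o_def by (simp only: f_def)
  also have "\<dots> = (\<Sum>y\<in>f ` B \<inter> B. chi y) + (\<Sum>y\<in>f ` B - B. chi y)"
    using fin by (subst sum.Int_Diff[of _ _ B]) auto
  finally have 1: "(\<Sum>x\<in>B. chi ((x + z) mod int p)) = (\<Sum>y\<in>f ` B \<inter> B. chi y) + (\<Sum>y\<in>f ` B - B. chi y)" .
  have 2: "(\<Sum>x\<in>B. chi x) = (\<Sum>y\<in>f ` B \<inter> B. chi y) + (\<Sum>y\<in>B - f ` B. chi y)"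
    using fin by (subst sum.Int_Diff[of _ _ "f ` B"]) (auto simp: Int_commute)
  have "cmod ((\<Sum>x\<in>B. chi ((x + z) mod int p)) - (\<Sum>x\<in>B. chi x)) = cmod ((\<Sum>y\<in>f ` B - B. chi y) - (\<Sum>y\<in>B - f ` B. chi y))"
    unfolding 1 2 by simp
  also have "\<dots> \<le> cmod (\<Sum>y\<in>f ` B - B. chi y) + cmod (\<Sum>y\<in>B - f ` B. chi y)" by (rule norm_triangle_ineq4)
  also have "\<dots> \<le> (real (card B') - real (card B)) + (real (card B') - real (card (f ` B)))"
    by (intro add_mono part fB B(1))
  also have "card (f ` B) = card B" by (rule card_image[OF inj])
  finally show ?thesis by simp
qed

lemma int_doubling_bohr_set:
  assumes "p > 0" "finite \<Gamma>" "\<epsilon> > 0"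
  shows "int_doubling p (bohr_set p \<Gamma> \<epsilon>) (bohr_set p \<Gamma> (2 * \<epsilon>)) (bohr_set p \<Gamma> (4 * \<epsilon>)) (bohr_set p \<Gamma> (8 * \<epsilon>)) (17 ^ card \<Gamma>)"
proof -
  have "real (card (bohr_set p \<Gamma> (8 * \<epsilon>))) \<le> real (17 ^ card \<Gamma> * card (bohr_set p \<Gamma> \<epsilon>))"
    using card_bohr_set_8[OF assms] by (simp only: of_nat_le_iff)
  moreover have "(x + y) mod int p \<in> bohr_set p \<Gamma> (2 * e)" if "x \<in> bohr_set p \<Gamma> e" "y \<in> bohr_set p \<Gamma> e" for x y e
    using add_in_bohr_set[OF assms(1) that] by simp
  from this[of _ \<epsilon>] this[of _ "2 * \<epsilon>"] this[of _ "4 * \<epsilon>"]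
  have "\<forall>x\<in>bohr_set p \<Gamma> \<epsilon>. \<forall>y\<in>bohr_set p \<Gamma> \<epsilon>. (x + y) mod int p \<in> bohr_set p \<Gamma> (2 * \<epsilon>)"
    "\<forall>x\<in>bohr_set p \<Gamma> (2 * \<epsilon>). \<forall>y\<in>bohr_set p \<Gamma> (2 * \<epsilon>). (x + y) mod int p \<in> bohr_set p \<Gamma> (4 * \<epsilon>)"
    "\<forall>x\<in>bohr_set p \<Gamma> (4 * \<epsilon>). \<forall>y\<in>bohr_set p \<Gamma> (4 * \<epsilon>). (x + y) mod int p \<in> bohr_set p \<Gamma> (8 * \<epsilon>)"
    by simp_all
  moreover have "\<forall>x\<in>bohr_set p \<Gamma> \<epsilon>. (- x) mod int p \<in> bohr_set p \<Gamma> \<epsilon>" using neg_in_bohr_set[OF assms(1)] by blast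
  moreover have "0 \<in> bohr_set p \<Gamma> \<epsilon>" using zero_in_bohr_set[OF assms(1)] assms(3) by simp
  ultimately show ?thesis unfolding int_doubling_def using bohr_set_subset by simp
qed

text \<open>The three conditions on \<open>H\<close> match three estimates: the averaged sum, the
  shift error, where \<open>\<kappa>\<close> is the 2k-th root of \<open>p powr (- 1 / 8)\<close>,
  and the degenerate case \<open>card B' = 1\<close>. \<open>R\<close> bounds the quotient of the
  sizes of \<open>B\<close> and \<open>B'\<close>.\<close>

lemma bohr_sum_bound:
  fixes chi :: "int \<Rightarrow> complex"
  assumes k: "k \<ge> 1" and d: "d \<ge> 1" and p: "prime p" "p \<ge> 5" "real p > (100 * real d) ^ (16 * k)"
    and \<Gamma>: "finite \<Gamma>" "card \<Gamma> = d" and \<epsilon>: "\<epsilon> > 0" "\<epsilon> < 1 / 2" and reg: "bohr_regular p \<Gamma> \<epsilon>"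
    and chi: "nontrivial_mult_character p chi"
    and N: "N = real (card (bohr_set p \<Gamma> \<epsilon>))"
    and H: "max 1 (sqrt N * real p powr (- 1 / 4)) * sqrt (real p) * N powr (- 5 / 4) \<le> H"
      "real p powr (- 1 / 8) \<le> H" "1 \<le> N powr (5 / 8) * H"
    and R: "R = 4 ^ d * (N / (\<epsilon> ^ d * real p)) * real p powr (real d / real k)"
  shows "cmod (\<Sum>x\<in>bohr_set p \<Gamma> \<epsilon>. chi x)
    \<le> (200 * real d + 128 * moment_const k * (17 ^ d) ^ 2) * N * (R powr (5 / 8) * H) powr (1 / (2 * real k))"
proof -
  have ba: "burgess_at p" by (rule burgess_at_prime[OF p(1)])
  have chi1: "cmod (chi x) \<le> 1" if "x \<in> {0..<int p}" for x
    using ba chi that unfolding burgess_at_def by blast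
  \<comment> \<open>The lower bound on \<open>p\<close> is exactly what puts this below
    \<open>1 / (100 * d)\<close>, the range in which regularity applies.\<close>
  define \<kappa> where "\<kappa> = real p powr (- 1 / (16 * real k))"
  define T where "T = nat \<lceil>real p powr (1 / (2 * real k))\<rceil>"
  define \<delta> where "\<delta> = \<kappa> * \<epsilon> / real T"
  define B where "B = bohr_set p \<Gamma> \<epsilon>"
  define B' where "B' = bohr_set p \<Gamma> \<delta>"
  define M where "M = real (card B')"
  define err where "err = 200 * real d * \<kappa> * N"
  have p0: "real p > 0" "real p \<ge> 1" "p > 0" using p(2) by auto
  have k0: "real k \<ge> 1" using k by simp
  have "real p powr (- 1 / (16 * real k)) \<le> real p powr 0" using p0 k0 by (intro powr_mono) auto
  then have \<kappa>: "\<kappa> > 0" "\<kappa> \<le> 1" using p0 by (simp_all add: \<kappa>_def)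
  have \<kappa>d: "\<kappa> < 1 / (100 * real d)"
  proof -
    have "100 * real d = ((100 * real d) ^ (16 * k)) powr (1 / (16 * real k))"
      using d k by (subst powr_realpow[symmetric]) (auto simp: powr_powr)
    also have "\<dots> < real p powr (1 / (16 * real k))" using p(3) k by (intro powr_less_mono2) auto
    finally have "100 * real d < real p powr (1 / (16 * real k))" .
    then have "1 / real p powr (1 / (16 * real k)) < 1 / (100 * real d)" using d p0 by (intro divide_strict_left_mono mult_pos_pos) auto
    then show ?thesis by (simp add: \<kappa>_def powr_minus_divide)
  qed
  have Q1: "real p powr (1 / (2 * real k)) \<ge> 1" using p0 k0 by (intro ge_one_powr_ge_zero) auto
  have T_ge: "real T \<ge> real p powr (1 / (2 * real k))" by (simp add: T_def)
  have T_le: "real T \<le> 2 * real p powr (1 / (2 * real k))"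
  proof -
    have "real T \<le> real p powr (1 / (2 * real k)) + 1" using Q1 unfolding T_def by linarith
    then show ?thesis using Q1 by linarith
  qed
  have T1: "T \<ge> 1" using T_ge Q1 by linarith
  \<comment> \<open>From \<open>T \<le> 2 sqrt p\<close> and \<open>p > 4\<close>.\<close>
  have Tp: "T < p"
  proof -
    have "real p powr (1 / (2 * real k)) \<le> real p powr (1 / 2)" using p0 k0 by (intro powr_mono) (auto simp: field_simps)
    then have "real T \<le> 2 * sqrt (real p)" using T_le p0 by (simp add: powr_half_sqrt)
    also have "\<dots> < sqrt (real p) * sqrt (real p)"
    proof (rule mult_strict_right_mono)
      have "sqrt 4 < sqrt (real p)" using p(2) by (intro real_sqrt_less_mono) simp
      then show "2 < sqrt (real p)" by simp
    qed (use p0 in simp)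
    finally show ?thesis by simp
  qed
  have pT: "p \<le> T ^ (2 * k)"
  proof -
    have "real p = (real p powr (1 / (2 * real k))) powr real (2 * k)" using p0 k0 by (simp add: powr_powr)
    also have "\<dots> = (real p powr (1 / (2 * real k))) ^ (2 * k)" using p0 by (intro powr_realpow) simp
    also have "\<dots> \<le> real T ^ (2 * k)" using T_ge by (intro power_mono) auto
    finally have "real p \<le> real (T ^ (2 * k))" by simp
    then show ?thesis by (simp only: of_nat_le_iff)
  qed
  have \<delta>0: "\<delta> > 0" using \<kappa> \<epsilon> T1 by (simp add: \<delta>_def)
  have "\<kappa> * \<epsilon> \<le> 1 * \<epsilon>" using \<kappa> \<epsilon> by (intro mult_right_mono) auto
  also have "1 * \<epsilon> \<le> real T * \<epsilon>" using T1 \<epsilon> by (intro mult_right_mono) auto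
  finally have \<delta>\<epsilon>: "\<delta> \<le> \<epsilon>" unfolding \<delta>_def using T1 by (simp add: pos_divide_le_eq mult.commute)
  have sub: "B' \<subseteq> B" unfolding B_def B'_def by (rule bohr_set_mono[OF \<delta>\<epsilon>])
  have NB: "N = real (card B)" by (simp add: N B_def)
  have "0 \<in> B'" unfolding B'_def using zero_in_bohr_set p0(3) \<delta>0 by simp
  then have "card B' \<ge> 1" by (metis B'_def One_nat_def Suc_leI card_gt_0_iff empty_iff finite_bohr_set)
  then have M1: "M \<ge> 1" by (simp add: M_def)
  have MN: "M \<le> N" unfolding M_def NB using sub by (simp add: B_def card_mono)
  have lower: "N / M \<le> R"
  proof -
    define L where "L = nat \<lceil>1 / \<delta>\<rceil>"
    have "\<delta> < 1" using \<delta>\<epsilon> \<epsilon> by simp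
    then have d1: "1 / \<delta> > 1" using \<delta>0 by simp
    have L: "real L \<ge> 1 / \<delta>" "real L \<le> 2 / \<delta>" using d1 unfolding L_def by linarith+
    have "real L * \<delta> \<ge> 1" using L(1) \<delta>0 by (simp add: pos_divide_le_eq)
    moreover have "L \<ge> 1" using L(1) d1 by linarith
    ultimately have "p \<le> L ^ d * card B'"
      using card_bohr_set_lower[OF p0(3) \<Gamma>(1), of L \<delta>] by (simp add: B'_def \<Gamma>(2))
    then have "real p \<le> real (L ^ d * card B')" by (simp only: of_nat_le_iff)
    then have "real p \<le> real L ^ d * M" by (simp add: M_def)
    also have "\<dots> \<le> (2 / \<delta>) ^ d * M" using L(2) M1 by (intro mult_right_mono power_mono) auto
    \<comment> \<open>\<open>T\<close> costs \<open>p^(1/(2k))\<close> and \<open>1/\<kappa>\<close>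
      costs \<open>p^(1/(16k))\<close>; the latter is generously replaced by a second
      \<open>p^(1/(2k))\<close>. The constant 4 comes from rounding \<open>1/\<delta>\<close> and
      \<open>T\<close> up.\<close>
    also have "(2 / \<delta>) ^ d \<le> (4 * real p powr (1 / real k) / \<epsilon>) ^ d"
    proof (intro power_mono)
      have "2 / \<delta> = 2 * real T / \<kappa> / \<epsilon>" using T1 by (simp add: \<delta>_def)
      also have "\<dots> \<le> 4 * real p powr (1 / real k) / \<epsilon>"
      proof (intro divide_right_mono)
        have "2 * real T / \<kappa> = 2 * real T * real p powr (1 / (16 * real k))" by (simp add: \<kappa>_def powr_minus_divide)
        also have "\<dots> \<le> 2 * (2 * real p powr (1 / (2 * real k))) * real p powr (1 / (2 * real k))"
          using T_le p0 k0 by (intro mult_mono powr_mono) (auto simp: field_simps)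
        also have "\<dots> = 4 * real p powr (1 / real k)" by (simp add: powr_add[symmetric])
        finally show "2 * real T / \<kappa> \<le> 4 * real p powr (1 / real k)" .
      qed (use \<epsilon> in simp)
      finally show "2 / \<delta> \<le> 4 * real p powr (1 / real k) / \<epsilon>" .
    qed (use \<delta>0 in simp)
    then have "(2 / \<delta>) ^ d * M \<le> (4 * real p powr (1 / real k) / \<epsilon>) ^ d * M" using M1 by (intro mult_right_mono) auto
    also have "(4 * real p powr (1 / real k) / \<epsilon>) ^ d = 4 ^ d * real p powr (real d / real k) / \<epsilon> ^ d"
      using p0 by (simp add: power_divide power_mult_distrib powr_power mult.commute)
    finally have "real p \<le> 4 ^ d * real p powr (real d / real k) / \<epsilon> ^ d * M" .
    then have "N * real p \<le> N * (4 ^ d * real p powr (real d / real k) / \<epsilon> ^ d * M)" using M1 MN by (intro mult_left_mono) auto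
    then have "N \<le> (N * (4 ^ d * real p powr (real d / real k) / \<epsilon> ^ d) * M) / real p" by (simp only: pos_le_divide_eq[OF p0(1)] mult_ac)
    then have "N \<le> R * M" by (simp add: R mult_ac)
    then show ?thesis using M1 by (simp add: pos_divide_le_eq)
  qed
  have R1: "R \<ge> 1"
  proof -
    have "1 \<le> N / M" using M1 MN by simp
    then show ?thesis using lower by linarith
  qed
  have H0: "H > 0" proof -
    have "0 < real p powr (- 1 / 8)" using p0 by simp
    then show ?thesis using H(2) by linarith
  qed
  define Y where "Y = (R powr (5 / 8) * H) powr (1 / (2 * real k))"
  have Y0: "Y \<ge> 0" by (simp add: Y_def)
  have \<kappa>Y: "\<kappa> \<le> Y"
  proof -
    have "1 * real p powr (- 1 / 8) \<le> R powr (5 / 8) * H" using H(2) R1 by (intro mult_mono ge_one_powr_ge_zero) auto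
    then have "(real p powr (- 1 / 8)) powr (1 / (2 * real k)) \<le> Y" unfolding Y_def using k0 by (intro powr_mono2) auto
    then show ?thesis by (simp add: powr_powr \<kappa>_def)
  qed
  have c: "128 * moment_const k * (17 ^ d) ^ 2 \<ge> 1"
  proof -
    have "1 * 1 \<le> moment_const k * (17 ^ d) ^ 2" using moment_const_ge_1[OF k] by (intro mult_mono one_le_power) auto
    then show ?thesis by simp
  qed
  have errY: "err \<le> 200 * real d * N * Y" unfolding err_def
    using mult_left_mono[OF \<kappa>Y, of "200 * real d * N"] M1 MN by (simp add: mult_ac)
  \<comment> \<open>A sum below \<open>err\<close> needs no argument. If \<open>B'\<close> has only
    the element 0, there is nothing to average over, but then \<open>N \<le> R\<close> and the
    claimed bound exceeds the trivial one.\<close>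
  have main: "cmod (\<Sum>x\<in>B. chi x) \<le> err + 128 * moment_const k * (17 ^ d) ^ 2 * N * Y"
  proof (cases "card B' \<ge> 2 \<and> err \<le> cmod (\<Sum>x\<in>B. chi x)")
    case True
    have shift: "cmod ((\<Sum>x\<in>B. chi ((x + y * int t) mod int p)) - (\<Sum>x\<in>B. chi x)) \<le> err"
      if yt: "y \<in> B'" "t \<in> {1..T}" for y t
    proof -
      let ?B2 = "bohr_set p \<Gamma> ((1 + \<kappa>) * \<epsilon>)"
      have "real t * \<delta> \<le> real T * \<delta>" using yt(2) \<delta>0 by (intro mult_right_mono) auto
      also have "\<dots> = \<kappa> * \<epsilon>" using T1 by (simp add: \<delta>_def)
      finally have "\<epsilon> + real t * \<delta> \<le> (1 + \<kappa>) * \<epsilon>" by (simp add: algebra_simps)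
      then have in2: "(x + y * int t) mod int p \<in> ?B2" if "x \<in> B" for x
        using add_mult_in_bohr_set[OF p0(3), of x \<Gamma> \<epsilon> y \<delta> t] that yt(1) bohr_set_mono unfolding B_def B'_def by blast
      have "\<epsilon> \<le> (1 + \<kappa>) * \<epsilon>" using \<kappa> \<epsilon> by (simp add: algebra_simps)
      then have "B \<subseteq> ?B2" unfolding B_def by (rule bohr_set_mono)
      from shifted_sum_diff[OF this bohr_set_subset in2 chi1]
      have "cmod ((\<Sum>x\<in>B. chi ((x + y * int t) mod int p)) - (\<Sum>x\<in>B. chi x)) \<le> 2 * (real (card ?B2) - N)"
        by (simp add: NB)
      also have "\<dots> \<le> err"
      proof -
        have "\<bar>\<kappa>\<bar> < 1 / (100 * real (card \<Gamma>))" using \<kappa> \<kappa>d \<Gamma>(2) by simp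
        then have "real (card ?B2) / N \<le> 1 + 100 * real (card \<Gamma>) * \<bar>\<kappa>\<bar>"
          using reg unfolding bohr_regular_def N by blast
        then have "real (card ?B2) / N \<le> 1 + 100 * real d * \<kappa>" using \<kappa> \<Gamma>(2) by simp
        then have "real (card ?B2) \<le> (1 + 100 * real d * \<kappa>) * N" using M1 MN by (simp add: pos_divide_le_eq)
        then show ?thesis by (simp add: err_def algebra_simps)
      qed
      finally show ?thesis .
    qed
    let ?s = "cmod (\<Sum>x\<in>B. chi x) - err"
    have "?s ^ (2 * k) * real (card B') ^ 2 \<le> burgess_bound k (real p) (17 ^ card \<Gamma>) (real (card B)) (real (card B'))"
    proof -
      note bd = ba[unfolded burgess_at_def, rule_format, OF chi, THEN conjunct2, THEN conjunct2, rule_format,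
          OF k T1 Tp pT int_doubling_bohr_set[OF p0(3) \<Gamma>(1) \<epsilon>(1)] int_doubling_bohr_set[OF p0(3) \<Gamma>(1) \<delta>0]]
      show ?thesis using bd[of err] sub True shift unfolding B_def B'_def by blast
    qed
    then have "?s \<le> 128 * moment_const k * (17 ^ d) ^ 2 * N * Y"
      unfolding Y_def using True \<Gamma>(2)
      by (intro extract_root[OF k M1 MN p0(1) lower _ H(1)]) (auto simp: M_def NB)
    then show ?thesis by simp
  next
    case False
    then consider "cmod (\<Sum>x\<in>B. chi x) < err" | "M = 1" using \<open>card B' \<ge> 1\<close> by (force simp: M_def)
    then show ?thesis
    proof cases
      case 1
      have "0 \<le> 128 * moment_const k * (17 ^ d) ^ 2 * N * Y" using Y0 M1 MN moment_const_ge_1[OF k]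
        by (intro mult_nonneg_nonneg) auto
      then show ?thesis using 1 by linarith
    next
      case 2
      have "cmod (\<Sum>x\<in>B. chi x) \<le> (\<Sum>x\<in>B. 1)"
        using bohr_set_subset chi1 unfolding B_def by (intro sum_norm_le) blast
      then have "cmod (\<Sum>x\<in>B. chi x) \<le> 1 * N * 1" by (simp add: NB)
      also have "\<dots> \<le> 128 * moment_const k * (17 ^ d) ^ 2 * N * Y"
      proof (intro mult_mono c)
        have "N powr (5 / 8) * H \<le> R powr (5 / 8) * H"
          using lower 2 M1 MN H0 by (intro mult_right_mono powr_mono2) auto
        then have "1 \<le> R powr (5 / 8) * H" using H(3) by linarith
        then show "1 \<le> Y" unfolding Y_def using k0 by (intro ge_one_powr_ge_zero) auto
      qed (use c M1 MN in auto)
      finally have "cmod (\<Sum>x\<in>B. chi x) \<le> 128 * moment_const k * (17 ^ d) ^ 2 * N * Y" .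
      moreover have "err \<ge> 0" unfolding err_def using \<kappa> M1 MN by (intro mult_nonneg_nonneg) auto
      ultimately show ?thesis by simp
    qed
  qed
  also have "\<dots> \<le> 200 * real d * N * Y + 128 * moment_const k * (17 ^ d) ^ 2 * N * Y" using errY by simp
  also have "\<dots> = (200 * real d + 128 * moment_const k * (17 ^ d) ^ 2) * N * Y" by (simp add: algebra_simps)
  finally show ?thesis by (simp add: B_def Y_def)
qed

text \<open>The exponents \<open>5/8\<close> and \<open>1/(2k)\<close> multiply to
  \<open>5/(16k)\<close>, which turns the factor \<open>p^(d/k)\<close> of \<open>R\<close> into
  \<open>p^(5d/(16k^2))\<close>. The summand 0 in the exponent is the value of \<delta> at
  \<open>p\<close>.\<close>

lemma bound_rewrite:
  fixes N p \<epsilon> H c :: real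
  assumes k: "k \<ge> 1" and N: "N \<ge> 0" and p: "p > 0" and \<epsilon>: "\<epsilon> > 0" and H: "H > 0" and c: "c \<ge> 0"
  shows "c * N * ((4 ^ d * (N / (\<epsilon> ^ d * p)) * p powr (real d / real k)) powr (5 / 8) * H) powr (1 / (2 * real k))
    \<le> c * 4 ^ d * N * p powr (5 * real d / (16 * real k ^ 2) + 0) * (N / (\<epsilon> ^ d * p)) powr (5 / (16 * real k)) * H powr (1 / (2 * real k))"
proof -
  let ?K = "N / (\<epsilon> ^ d * p)" and ?a = "5 / (16 * real k)"
  have k0: "real k \<ge> 1" using k by simp
  have K0: "?K \<ge> 0" using N \<epsilon> p by simp
  have "((4 ^ d * ?K * p powr (real d / real k)) powr (5 / 8) * H) powr (1 / (2 * real k))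
    = (4 ^ d * ?K * p powr (real d / real k)) powr ?a * H powr (1 / (2 * real k))"
    using H K0 by (simp add: powr_mult powr_powr)
  also have "(4 ^ d * ?K * p powr (real d / real k)) powr ?a = (4 ^ d) powr ?a * ?K powr ?a * p powr (5 * real d / (16 * real k ^ 2) + 0)"
  proof -
    have "(4 ^ d * z * p powr (real d / real k)) powr ?a = (4 ^ d) powr ?a * z powr ?a * p powr (5 * real d / (16 * real k ^ 2) + 0)"
      if "z \<ge> 0" for z
      using that p by (simp add: powr_mult powr_powr power2_eq_square mult_ac)
    then show ?thesis using K0 by blast
  qed
  finally have e: "((4 ^ d * ?K * p powr (real d / real k)) powr (5 / 8) * H) powr (1 / (2 * real k))
    = (4 ^ d) powr ?a * (?K powr ?a * p powr (5 * real d / (16 * real k ^ 2) + 0) * H powr (1 / (2 * real k)))"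
    by (simp only: mult_ac)
  have "(4 ^ d :: real) powr ?a \<le> (4 ^ d) powr 1" using k0 by (intro powr_mono) (auto simp: field_simps)
  then have "(4 ^ d :: real) powr ?a \<le> 4 ^ d" by simp
  then have "c * N * ((4 ^ d) powr ?a * (?K powr ?a * p powr (5 * real d / (16 * real k ^ 2) + 0) * H powr (1 / (2 * real k))))
    \<le> c * N * (4 ^ d * (?K powr ?a * p powr (5 * real d / (16 * real k ^ 2) + 0) * H powr (1 / (2 * real k))))"
    using c N by (intro mult_left_mono mult_right_mono) auto
  also have "\<dots> = c * 4 ^ d * N * p powr (5 * real d / (16 * real k ^ 2) + 0) * ?K powr ?a * H powr (1 / (2 * real k))"
    by (simp only: mult_ac)
  finally show ?thesis by (simp only: e)
qed

text \<open>The maximum is its second entry here, and the left side of the first claim is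
  \<open>N^(-3/4) p^(1/4)\<close>. It equals \<open>(N/p)^(1/4)\<close> times
  \<open>sqrt p / N\<close>, a factor that is at most 1.\<close>

lemma large_range:
  fixes N p :: real
  assumes p: "p \<ge> 1" and N: "N \<ge> sqrt p" and k: "k \<ge> 1"
  shows "max 1 (sqrt N * p powr (- 1 / 4)) * sqrt p * N powr (- 5 / 4) \<le> (N / p) powr (1 / 4)"
    and "p powr (- 1 / 8) \<le> (N / p) powr (1 / 4)" and "1 \<le> N powr (5 / 8) * (N / p) powr (1 / 4)"
    and "((N / p) powr (1 / 4)) powr (1 / (2 * real k)) = (p / N) powr (- 1 / (8 * real k))"
proof -
  have p0: "p > 0" using p by simp
  have N0: "N > 0" using N p0 by (meson less_le_trans real_sqrt_gt_zero)
  have Np: "p powr (1 / 2) \<le> N" using N p0 by (simp add: powr_half_sqrt)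
  have q: "(N / p) powr (1 / 4) = N powr (1 / 4) * p powr (- 1 / 4)"
    using N0 p0 by (simp add: powr_divide powr_minus_divide)
  have "(p powr (1 / 2)) powr (1 / 2) \<le> N powr (1 / 2)" using Np by (intro powr_mono2) auto
  then have h: "p powr (1 / 4) \<le> N powr (1 / 2)" by (simp add: powr_powr)
  have "1 = p powr (1 / 4) * p powr (- 1 / 4)" using p0 by (simp add: powr_add[symmetric])
  also have "\<dots> \<le> N powr (1 / 2) * p powr (- 1 / 4)" using h by (intro mult_right_mono) auto
  finally have "max 1 (sqrt N * p powr (- 1 / 4)) = N powr (1 / 2) * p powr (- 1 / 4)"
    using N0 by (simp add: powr_half_sqrt)
  then have "max 1 (sqrt N * p powr (- 1 / 4)) * sqrt p * N powr (- 5 / 4)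
    = (N powr (1 / 2) * N powr (- 5 / 4)) * (p powr (- 1 / 4) * p powr (1 / 2))"
    using p0 by (simp add: powr_half_sqrt)
  also have "\<dots> = N powr (- 3 / 4) * p powr (1 / 4)" by (simp add: powr_add[symmetric])
  also have "\<dots> = (p powr (1 / 2) * N powr (- 1)) * (N powr (1 / 4) * p powr (- 1 / 4))"
  proof -
    have "p powr (1 / 4) = p powr (1 / 2) * p powr (- 1 / 4)" by (simp add: powr_add[symmetric])
    moreover have "N powr (- 3 / 4) = N powr (- 1) * N powr (1 / 4)" using powr_add[of N "- 1" "1 / 4"] by simp
    ultimately show ?thesis by (simp only: mult_ac)
  qed
  also have "\<dots> \<le> 1 * (N powr (1 / 4) * p powr (- 1 / 4))"
  proof (rule mult_right_mono)
    show "p powr (1 / 2) * N powr (- 1) \<le> 1" using Np N0 by (simp add: powr_minus_divide)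
  qed simp
  finally show "max 1 (sqrt N * p powr (- 1 / 4)) * sqrt p * N powr (- 5 / 4) \<le> (N / p) powr (1 / 4)" by (simp add: q)
  have "p powr (- 1 / 8) = (p powr (1 / 2) / p) powr (1 / 4)"
  proof -
    have "p powr (1 / 2) / p = p powr (1 / 2) / p powr 1" using p0 by simp
    also have "\<dots> = p powr (- 1 / 2)" using powr_diff[of p "1 / 2" 1] by simp
    finally show ?thesis by (simp add: powr_powr)
  qed
  also have "\<dots> \<le> (N / p) powr (1 / 4)" using Np p0 by (intro powr_mono2 divide_right_mono) auto
  finally show "p powr (- 1 / 8) \<le> (N / p) powr (1 / 4)" .
  have "1 \<le> p powr (3 / 16)" using p by (intro ge_one_powr_ge_zero) auto
  also have "p powr (3 / 16) = (p powr (1 / 2)) powr (7 / 8) * p powr (- 1 / 4)"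
    by (simp add: powr_powr powr_add[symmetric])
  also have "\<dots> \<le> N powr (7 / 8) * p powr (- 1 / 4)" using Np by (intro mult_right_mono powr_mono2) auto
  also have "\<dots> = N powr (5 / 8) * (N / p) powr (1 / 4)" by (simp add: q powr_add[symmetric] mult.assoc[symmetric])
  finally show "1 \<le> N powr (5 / 8) * (N / p) powr (1 / 4)" .
  have "(N / p) powr (1 / (8 * real k)) = (p / N) powr (- (1 / (8 * real k)))"
    using N0 p0 by (simp add: powr_divide powr_minus field_simps)
  then show "((N / p) powr (1 / 4)) powr (1 / (2 * real k)) = (p / N) powr (- 1 / (8 * real k))"
    by (simp add: powr_powr)
qed

text \<open>The maximum is 1 here, so the quantity \<open>H\<close> is just the rest of that
  product; its 2k-th root is the last factor of the stated bound.\<close>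

lemma small_range:
  fixes N p :: real
  assumes p: "p \<ge> 1" and N: "1 \<le> N" "N < sqrt p" and k: "k \<ge> 1"
  shows "max 1 (sqrt N * p powr (- 1 / 4)) * sqrt p * N powr (- 5 / 4) \<le> p powr (1 / 2) * N powr (- 5 / 4)"
    and "p powr (- 1 / 8) \<le> p powr (1 / 2) * N powr (- 5 / 4)"
    and "1 \<le> N powr (5 / 8) * (p powr (1 / 2) * N powr (- 5 / 4))"
    and "(p powr (1 / 2) * N powr (- 5 / 4)) powr (1 / (2 * real k)) = (N ^ 5 / p ^ 2) powr (- 1 / (8 * real k))"
proof -
  have p0: "p > 0" and N0: "N > 0" using p N by auto
  have Np: "N \<le> p powr (1 / 2)" using N p0 by (simp add: powr_half_sqrt)
  have "sqrt N = N powr (1 / 2)" using N0 by (simp add: powr_half_sqrt)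
  also have "\<dots> \<le> (p powr (1 / 2)) powr (1 / 2)" using Np N0 by (intro powr_mono2) auto
  also have "\<dots> = p powr (1 / 4)" by (simp add: powr_powr)
  finally have "sqrt N * p powr (- 1 / 4) \<le> p powr (1 / 4) * p powr (- 1 / 4)" by (intro mult_right_mono) auto
  also have "\<dots> = 1" using p0 by (simp add: powr_add[symmetric])
  finally show "max 1 (sqrt N * p powr (- 1 / 4)) * sqrt p * N powr (- 5 / 4) \<le> p powr (1 / 2) * N powr (- 5 / 4)"
    using p0 by (simp add: powr_half_sqrt max_def)
  have "p powr (- 1 / 8) = p powr (1 / 2) * (p powr (1 / 2)) powr (- 5 / 4)" by (simp add: powr_powr powr_add[symmetric])
  also have "\<dots> \<le> p powr (1 / 2) * N powr (- 5 / 4)" using Np N0 by (intro mult_left_mono powr_mono2') auto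
  finally show "p powr (- 1 / 8) \<le> p powr (1 / 2) * N powr (- 5 / 4)" .
  have "1 \<le> p powr (3 / 16)" using p by (intro ge_one_powr_ge_zero) auto
  also have "p powr (3 / 16) = p powr (1 / 2) * (p powr (1 / 2)) powr (- 5 / 8)" by (simp add: powr_powr powr_add[symmetric])
  also have "\<dots> \<le> p powr (1 / 2) * N powr (- 5 / 8)" using Np N0 by (intro mult_left_mono powr_mono2') auto
  also have "N powr (- 5 / 8) = N powr (5 / 8) * N powr (- 5 / 4)" by (simp add: powr_add[symmetric])
  finally show "1 \<le> N powr (5 / 8) * (p powr (1 / 2) * N powr (- 5 / 4))" by (simp only: mult_ac)
  have "N ^ 5 / p ^ 2 = N powr 5 * p powr (- 2)" using N0 p0 by (simp add: powr_minus_divide)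
  then have "(N ^ 5 / p ^ 2) powr (- 1 / (8 * real k)) = (N powr 5) powr (- 1 / (8 * real k)) * (p powr (- 2)) powr (- 1 / (8 * real k))"
    by (simp only: powr_mult powr_ge_zero)
  also have "\<dots> = (N powr (- 5 / 4)) powr (1 / (2 * real k)) * (p powr (1 / 2)) powr (1 / (2 * real k))"
    by (simp add: powr_powr)
  finally show "(p powr (1 / 2) * N powr (- 5 / 4)) powr (1 / (2 * real k)) = (N ^ 5 / p ^ 2) powr (- 1 / (8 * real k))"
    by (simp add: powr_mult mult.commute)
qed

theorem theorem2p2:
  fixes k d :: nat
  assumes "k \<ge> 1" and "d \<ge> 1"
  shows "\<exists>(C::real) (p0::nat) (\<delta>::nat \<Rightarrow> real).
    C > 0 \<and> (\<delta> \<longlongrightarrow> 0) (inf sequentially (principal {p. prime p})) \<and>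
    (\<forall>(p::nat) (\<Gamma>::int set) (\<epsilon>::real) (chi::int \<Rightarrow> complex).
       prime p \<longrightarrow> p \<ge> p0 \<longrightarrow>
       \<Gamma> \<subseteq> carrier (residue_ring (int p)) \<longrightarrow> card \<Gamma> = d \<longrightarrow>
       \<epsilon> > 0 \<longrightarrow> bohr_regular p \<Gamma> \<epsilon> \<longrightarrow> nontrivial_mult_character p chi \<longrightarrow>
       (let B = bohr_set p \<Gamma> \<epsilon>; N = real (card B) in
         (N \<ge> sqrt (real p) \<longrightarrow>
            cmod (\<Sum>x\<in>B. chi x)
              \<le> C * N * real p powr (5 * real d / (16 * real k ^ 2) + \<delta> p)
                  * (N / (\<epsilon> ^ d * real p)) powr (5 / (16 * real k))
                  * (real p / N) powr (- 1 / (8 * real k))) \<and>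
         (N < sqrt (real p) \<longrightarrow>
            cmod (\<Sum>x\<in>B. chi x)
              \<le> C * N * real p powr (5 * real d / (16 * real k ^ 2) + \<delta> p)
                  * (N / (\<epsilon> ^ d * real p)) powr (5 / (16 * real k))
                  * (N ^ 5 / real p ^ 2) powr (- 1 / (8 * real k)))))"
proof -
  define c where "c = 200 * real d + 128 * moment_const k * (17 ^ d) ^ 2"
  have c: "c > 0" using assms(2) moment_const_ge_1[OF assms(1)] by (simp add: c_def add_pos_nonneg)
  \<comment> \<open>The power gives the strict lower bound on \<open>p\<close> that regularity
    requires, and the summand 5 gives \<open>T < p\<close>.\<close>
  define p0 where "p0 = (100 * d) ^ (16 * k) + 5"
  have goal: "let B = bohr_set p \<Gamma> \<epsilon>; N = real (card B) in
         (N \<ge> sqrt (real p) \<longrightarrow>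
            cmod (\<Sum>x\<in>B. chi x)
              \<le> (c * 4 ^ d) * N * real p powr (5 * real d / (16 * real k ^ 2) + 0)
                  * (N / (\<epsilon> ^ d * real p)) powr (5 / (16 * real k))
                  * (real p / N) powr (- 1 / (8 * real k))) \<and>
         (N < sqrt (real p) \<longrightarrow>
            cmod (\<Sum>x\<in>B. chi x)
              \<le> (c * 4 ^ d) * N * real p powr (5 * real d / (16 * real k ^ 2) + 0)
                  * (N / (\<epsilon> ^ d * real p)) powr (5 / (16 * real k))
                  * (N ^ 5 / real p ^ 2) powr (- 1 / (8 * real k)))"
    if p: "prime p" "p \<ge> p0" and \<Gamma>: "\<Gamma> \<subseteq> carrier (residue_ring (int p))" "card \<Gamma> = d"
      and \<epsilon>: "\<epsilon> > 0" and reg: "bohr_regular p \<Gamma> \<epsilon>" and chi: "nontrivial_mult_character p chi"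
    for p \<Gamma> \<epsilon> and chi :: "int \<Rightarrow> complex"
  proof -
    define B where "B = bohr_set p \<Gamma> \<epsilon>"
    define N where "N = real (card B)"
    have p5: "p \<ge> 5" using p(2) by (simp add: p0_def)
    have "(100 * d) ^ (16 * k) < p" using p(2) by (simp add: p0_def)
    then have "real ((100 * d) ^ (16 * k)) < real p" by (simp only: of_nat_less_iff)
    then have plarge: "real p > (100 * real d) ^ (16 * k)" by simp
    have fin: "finite \<Gamma>" using \<Gamma>(2) assms(2) card_ge_0_finite[of \<Gamma>] by simp
    have "0 \<in> B" unfolding B_def using p5 \<epsilon> by (intro zero_in_bohr_set) auto
    then have "card B > 0" unfolding card_gt_0_iff by (auto simp: B_def)
    then have N1: "N \<ge> 1" by (simp add: N_def)
    have p1: "real p \<ge> 1" "real p > 0" using p5 by auto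
    have bound: "cmod (\<Sum>x\<in>B. chi x) \<le> (c * 4 ^ d) * N * real p powr (5 * real d / (16 * real k ^ 2) + 0)
                  * (N / (\<epsilon> ^ d * real p)) powr (5 / (16 * real k)) * H powr (1 / (2 * real k))"
      if H: "max 1 (sqrt N * real p powr (- 1 / 4)) * sqrt (real p) * N powr (- 5 / 4) \<le> H"
        "real p powr (- 1 / 8) \<le> H" "1 \<le> N powr (5 / 8) * H" for H
    proof (cases "\<epsilon> < 1 / 2")
      case True
      have "0 < real p powr (- 1 / 8)" using p1 by simp
      then have H0: "H > 0" using H(2) by linarith
      have "cmod (\<Sum>x\<in>B. chi x) \<le> c * N * ((4 ^ d * (N / (\<epsilon> ^ d * real p)) * real p powr (real d / real k)) powr (5 / 8) * H) powr (1 / (2 * real k))"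
        unfolding B_def c_def
        by (rule bohr_sum_bound[OF assms p(1) p5 plarge fin \<Gamma>(2) \<epsilon> True reg chi _ H refl]) (simp add: N_def B_def)
      also have "\<dots> \<le> (c * 4 ^ d) * N * real p powr (5 * real d / (16 * real k ^ 2) + 0)
                  * (N / (\<epsilon> ^ d * real p)) powr (5 / (16 * real k)) * H powr (1 / (2 * real k))"
        by (rule bound_rewrite[OF assms(1)]) (use N1 p1 \<epsilon> H0 c in auto)
      finally show ?thesis .
    next
      case False
      \<comment> \<open>The sum is complete, and a non-trivial character sums to 0 over the whole
        field.\<close>
      then have "B = {0..<int p}" unfolding B_def by (intro bohr_set_eq_all) simp
      then have "(\<Sum>x\<in>B. chi x) = 0" using burgess_at_prime[OF p(1)] chi unfolding burgess_at_def by blast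
      then show ?thesis using c N1 by simp
    qed
    show ?thesis
      unfolding Let_def B_def[symmetric] N_def[symmetric]
    proof (intro conjI impI)
      assume N: "N \<ge> sqrt (real p)"
      note L = large_range[OF p1(1) N assms(1)]
      show "cmod (\<Sum>x\<in>B. chi x) \<le> (c * 4 ^ d) * N * real p powr (5 * real d / (16 * real k ^ 2) + 0)
                  * (N / (\<epsilon> ^ d * real p)) powr (5 / (16 * real k)) * (real p / N) powr (- 1 / (8 * real k))"
        using bound[OF L(1-3)] unfolding L(4) .
    next
      assume N: "N < sqrt (real p)"
      note L = small_range[OF p1(1) N1 N assms(1)]
      show "cmod (\<Sum>x\<in>B. chi x) \<le> (c * 4 ^ d) * N * real p powr (5 * real d / (16 * real k ^ 2) + 0)
                  * (N / (\<epsilon> ^ d * real p)) powr (5 / (16 * real k)) * (N ^ 5 / real p ^ 2) powr (- 1 / (8 * real k))"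
        using bound[OF L(1-3)] unfolding L(4) .
    qed
  qed
  show ?thesis
    by (rule exI[of _ "c * 4 ^ d"], rule exI[of _ p0], rule exI[of _ "\<lambda>_. 0"], intro conjI allI impI goal tendsto_const)
       (use c in simp)
qed

end
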